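(* Let $(M,L)$ be a Finsler manifold with Finsler metric $g$, Cartan connection $\nabla$ and Berwald connection $D^{\circ}$. Let $T$, $\widehat{P}$ and $\beta$ be the (h)hv-torsion, the (v)hv-torsion and the horizontal map of $\nabla$, and let $G$ be the canonical spray. Then, for all $\overline{X},\overline{Y},\overline{Z}\in\mathfrak{X}(\pi(M))$: (a) $(D^{\circ}_{\gamma\overline{X}}\,g)(\overline{Y},\overline{Z})=2g(T(\overline{X},\overline{Y}),\overline{Z})$; (b) $(D^{\circ}_{\beta\overline{X}}\,g)(\overline{Y},\overline{Z})=-2g(\widehat{P}(\overline{X},\overline{Y}),\overline{Z})$; (c) $D^{\circ}_{G}\,g=0$. Consequently, $(M,L)$ is Riemannian if and only if $D^{\circ}_{\gamma\overline{X}}\,g=0$ for all $\overline{X}$; and $(M,L)$ is Landsbergian if and only if $D^{\circ}_{\beta\overline{X}}\,g=0$ for all $\overline{X}$.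
   Context: Pullback formalism. $M$ is a real $C^\infty$ manifold of finite dimension; all objects are $C^\infty$. $\pi_M:TM\to M$ is the tangent bundle, $\pi:\mathcal{T}M\to M$ its open subbundle of nonzero tangent vectors, and $\pi^{-1}(TM)\to\mathcal{T}M$ is the pullback of $TM$ by $\pi$ (fibre over $u$: pairs $(u,v)$ with $v\in T_{\pi(u)}M$). $\mathfrak{X}(\mathcal{T}M)$ denotes the vector fields on $\mathcal{T}M$, and $\mathfrak{X}(\pi(M))$ the smooth sections of $\pi^{-1}(TM)$, written with bars. The fundamental section is $\overline{\eta}(u)=(u,u)$. The bundle morphisms $\rho:T(\mathcal{T}M)\to\pi^{-1}(TM)$ and $\gamma:\pi^{-1}(TM)\to T(\mathcal{T}M)$ are $\rho(X)=(u,d\pi(X))$ for $X\in T_u(\mathcal{T}M)$ and $\gamma(u,v)=\frac{d}{dt}\big|_{t=0}(u+tv)$; the image of $\gamma$ is $\ker\rho=V(\mathcal{T}M)$, the vertical bundle. Put $J:=\gamma\circ\rho$. Regular connections. For a linear connection $D$ on the vector bundle $\pi^{-1}(TM)$, the connection map is $K(X)=D_X\overline{\eta}$, and the horizontal space at $u$ is $H_u(\mathcal{T}M)=\{X\in T_u(\mathcal{T}M):K(X)=0\}$. $D$ is regular if $T_u(\mathcal{T}M)=V_u(\mathcal{T}M)\oplus H_u(\mathcal{T}M)$ for all $u\in\mathcal{T}M$. Then $\rho|_{H(\mathcal{T}M)}$ is an isomorphism onto $\pi^{-1}(TM)$, with inverse $\beta:=(\rho|_{H(\mathcal{T}M)})^{-1}$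 (the horizontal map of $D$), and the horizontal projector of $D$ is $h=\beta\circ\rho$. As usual $(D_Xg)(\overline{Y},\overline{Z})=X\cdot g(\overline{Y},\overline{Z})-g(D_X\overline{Y},\overline{Z})-g(\overline{Y},D_X\overline{Z})$. Torsions and curvature. For $X,Y,Z\in\mathfrak{X}(\mathcal{T}M)$: $\mathbf{T}(X,Y)=D_X\rho Y-D_Y\rho X-\rho[X,Y]$ and $\mathbf{K}(X,Y)\rho Z=-D_XD_Y\rho Z+D_YD_X\rho Z+D_{[X,Y]}\rho Z$. The horizontal ((h)h-) torsion is $Q(\overline{X},\overline{Y})=\mathbf{T}(\beta\overline{X},\beta\overline{Y})$, the mixed ((h)hv-) torsion is $T(\overline{X},\overline{Y})=\mathbf{T}(\gamma\overline{X},\beta\overline{Y})$, and the (v)hv-torsion is $\widehat{P}(\overline{X},\overline{Y})=\mathbf{K}(\beta\overline{X},\gamma\overline{Y})\overline{\eta}$. Finsler structure. $(M,L)$ is a Finsler manifold: $L:TM\to\mathbb{R}$ is continuous, $C^\infty$ and positive on $\mathcal{T}M$, positively homogeneous of degree 1 on fibres, and with $E:=\frac12L^2$ the fibrewise Hessian of $E$ on $\mathcal{T}M$ is positive definite. The Finsler metric $g$ on $\pi^{-1}(TM)$ is this Hessian, i.e. $g(\rho X,\rho Y)=\Omega(JX,Y)$ with $\Omega:=dd_JE$, $d_JE:=dE\circ J$. The canonical spray $G$ is the vector field with $i_G\Omega=-dE$. $(M,L)$ is Riemannian if $g$ is (the pullback of) a Riemannian metric on $M$, i.e. $g$ does not depend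 on the directional argument; it is Landsbergian if the (v)hv-torsion $\widehat{P}$ of its Cartan connection vanishes. Cartan connection $\nabla$: the unique regular connection on $\pi^{-1}(TM)$ with $\nabla g=0$, $Q=0$, and $g(T(\overline{X},\overline{Y}),\overline{Z})=g(T(\overline{X},\overline{Z}),\overline{Y})$. Berwald connection $D^{\circ}$: the unique regular connection on $\pi^{-1}(TM)$ with $h^{\circ}X\cdot L=0$ for all $X$ ($h^{\circ}$ its horizontal projector), $\mathbf{T}^{\circ}=0$ and $\widehat{P}^{\circ}=0$.
   Formalization: That D°_{γX}g=0 for all X implies Riemannian is stated only if dim M ≥ 2 or L(-v)=L(v); it fails on M=R for L=y (y≥0), L=-2y (y<0), and in dimension 1 for every non-reversible L. M has dimension at least 1 (in dimension 0 all claims are vacuous). *)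

theory Defs
  imports "HOL-Analysis.Analysis" "HOL-Library.Function_Algebras"
begin

section \<open>Smooth manifolds\<close>

fun Ck_on :: "nat \<Rightarrow> ('a::euclidean_space \<Rightarrow> 'b::real_normed_vector) \<Rightarrow> 'a set \<Rightarrow> bool" where
  "Ck_on 0 f S \<longleftrightarrow> continuous_on S f"
| "Ck_on (Suc k) f S \<longleftrightarrow>
     (\<forall>x\<in>S. f differentiable (at x)) \<and> (\<forall>v. Ck_on k (\<lambda>x. frechet_derivative f (at x) v) S)"

definition smooth_on :: "'a::euclidean_space set \<Rightarrow> ('a \<Rightarrow> 'b::real_normed_vector) \<Rightarrow> bool" where
  "smooth_on S f \<longleftrightarrow> (\<forall>k. Ck_on k f S)"

text \<open>A chart is a pair of its domain and its coordinate map.  A manifold is represented by an atlas;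
  its underlying set is the union of the chart domains and its topology is the one induced by the
  charts.  (No topology on the ambient type is used, so that the construction can be iterated to
  form the tangent bundle and the tangent bundle of its slit part.)\<close>

type_synonym ('a, 'e) chart = "'a set \<times> ('a \<Rightarrow> 'e)"
type_synonym ('a, 'e) atlas = "('a, 'e) chart set"

definition carrier :: "('a, 'e) atlas \<Rightarrow> 'a set" where
  "carrier A = \<Union>(fst ` A)"

definition manifold_topology :: "('a, 'e::euclidean_space) atlas \<Rightarrow> 'a topology" where
  "manifold_topology A = topology (\<lambda>W. W \<subseteq> carrier A \<and> (\<forall>(U, \<phi>)\<in>A. open (\<phi> ` (U \<inter> W))))"

definition smooth_atlas :: "('a, 'e::euclidean_space) atlas \<Rightarrow> bool" where
  "smooth_atlas A \<longleftrightarrow>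
     (\<forall>(U, \<phi>)\<in>A. inj_on \<phi> U \<and> open (\<phi> ` U)) \<and>
     (\<forall>(U, \<phi>)\<in>A. \<forall>(V, \<psi>)\<in>A.
        open (\<phi> ` (U \<inter> V)) \<and> smooth_on (\<phi> ` (U \<inter> V)) (\<psi> \<circ> inv_into U \<phi>))"

definition smooth_manifold :: "('a, 'e::euclidean_space) atlas \<Rightarrow> bool" where
  "smooth_manifold A \<longleftrightarrow> smooth_atlas A \<and>
     Hausdorff_space (manifold_topology A) \<and> second_countable (manifold_topology A)"

definition open_submanifold :: "('a, 'e) atlas \<Rightarrow> 'a set \<Rightarrow> ('a, 'e) atlas" where
  "open_submanifold A W = (\<lambda>(U, \<phi>). (U \<inter> W, \<phi>)) ` A"

definition smooth_fun :: "('a, 'e::euclidean_space) atlas \<Rightarrow> 'a set \<Rightarrow> ('a \<Rightarrow> real) \<Rightarrow> bool" where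
  "smooth_fun A W f \<longleftrightarrow> (\<forall>(U, \<phi>)\<in>A. smooth_on (\<phi> ` (U \<inter> W)) (f \<circ> inv_into U \<phi>))"

definition smooth_at :: "('a, 'e::euclidean_space) atlas \<Rightarrow> 'a \<Rightarrow> ('a \<Rightarrow> real) \<Rightarrow> bool" where
  "smooth_at A p f \<longleftrightarrow> (\<exists>W. openin (manifold_topology A) W \<and> p \<in> W \<and> smooth_fun A W f)"

definition smooth_map ::
  "('a, 'd::euclidean_space) atlas \<Rightarrow> ('b, 'e::euclidean_space) atlas \<Rightarrow> ('a \<Rightarrow> 'b) \<Rightarrow> bool" where
  "smooth_map A B F \<longleftrightarrow> F \<in> carrier A \<rightarrow> carrier B \<and>
     (\<forall>(U, \<phi>)\<in>A. \<forall>(V, \<psi>)\<in>B.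
        openin (manifold_topology A) (U \<inter> F -` V) \<and>
        smooth_on (\<phi> ` (U \<inter> F -` V)) (\<psi> \<circ> F \<circ> inv_into U \<phi>))"


section \<open>Tangent vectors and vector fields\<close>

text \<open>A tangent vector at \<open>p\<close> is a derivation on the germs at \<open>p\<close> of smooth functions.  It is
  extended by the value 0 to functions that are not smooth near \<open>p\<close>, so that equality of tangent
  vectors is equality of functionals.\<close>

type_synonym 'a tvec = "('a \<Rightarrow> real) \<Rightarrow> real"

definition scal :: "real \<Rightarrow> 'a tvec \<Rightarrow> 'a tvec" where
  "scal a v = (\<lambda>f. a * v f)"

definition tangent_space :: "('a, 'e::euclidean_space) atlas \<Rightarrow> 'a \<Rightarrow> 'a tvec set" where
  "tangent_space A p = {v.
     (\<forall>f g a b. smooth_at A p f \<and> smooth_at A p g \<longrightarrow> v (\<lambda>q. a * f q + b * g q) = a * v f + b * v g) \<and>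
     (\<forall>f g. smooth_at A p f \<and> smooth_at A p g \<longrightarrow> v (\<lambda>q. f q * g q) = v f * g p + f p * v g) \<and>
     (\<forall>f g W. smooth_at A p f \<and> smooth_at A p g \<and> openin (manifold_topology A) W \<and> p \<in> W \<and>
        (\<forall>q\<in>W. f q = g q) \<longrightarrow> v f = v g) \<and>
     (\<forall>f. \<not> smooth_at A p f \<longrightarrow> v f = 0)}"

definition differential ::
  "('a, 'd::euclidean_space) atlas \<Rightarrow> ('b, 'e::euclidean_space) atlas \<Rightarrow> ('a \<Rightarrow> 'b) \<Rightarrow> 'a \<Rightarrow> 'a tvec \<Rightarrow> 'b tvec" where
  "differential A B F p v = (\<lambda>f. if smooth_at B (F p) f then v (f \<circ> F) else 0)"

definition velocity :: "('a, 'e::euclidean_space) atlas \<Rightarrow> (real \<Rightarrow> 'a) \<Rightarrow> real \<Rightarrow> 'a tvec" where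
  "velocity A c t = (\<lambda>f. if smooth_at A (c t) f then deriv (\<lambda>s. f (c s)) t else 0)"

definition tvec_components :: "('a \<Rightarrow> 'e::euclidean_space) \<Rightarrow> 'a tvec \<Rightarrow> 'e" where
  "tvec_components \<phi> v = (\<Sum>i\<in>Basis. v (\<lambda>q. \<phi> q \<bullet> i) *\<^sub>R i)"

definition tangent_bundle :: "('a, 'e::euclidean_space) atlas \<Rightarrow> ('a \<times> 'a tvec, 'e \<times> 'e) atlas" where
  "tangent_bundle A =
     (\<lambda>(U, \<phi>). ({(p, v). p \<in> U \<and> v \<in> tangent_space A p}, \<lambda>(p, v). (\<phi> p, tvec_components \<phi> v))) ` A"

definition vector_fields :: "('a, 'e::euclidean_space) atlas \<Rightarrow> ('a \<Rightarrow> 'a tvec) set" where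
  "vector_fields A = {X. smooth_map A (tangent_bundle A) (\<lambda>p. (p, X p))}"

definition lie_bracket ::
  "('a, 'e::euclidean_space) atlas \<Rightarrow> ('a \<Rightarrow> 'a tvec) \<Rightarrow> ('a \<Rightarrow> 'a tvec) \<Rightarrow> 'a \<Rightarrow> 'a tvec" where
  "lie_bracket A X Y p =
     (\<lambda>f. if smooth_at A p f then X p (\<lambda>q. Y q f) - Y p (\<lambda>q. X q f) else 0)"

definition exterior_derivative ::
  "('a, 'e::euclidean_space) atlas \<Rightarrow> ('a \<Rightarrow> 'a tvec \<Rightarrow> real) \<Rightarrow>
   ('a \<Rightarrow> 'a tvec) \<Rightarrow> ('a \<Rightarrow> 'a tvec) \<Rightarrow> 'a \<Rightarrow> real" where
  "exterior_derivative A \<omega> X Y p =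
     X p (\<lambda>q. \<omega> q (Y q)) - Y p (\<lambda>q. \<omega> q (X q)) - \<omega> p (lie_bracket A X Y p)"

definition riemannian_metric ::
  "('a, 'e::euclidean_space) atlas \<Rightarrow> ('a \<Rightarrow> 'a tvec \<Rightarrow> 'a tvec \<Rightarrow> real) \<Rightarrow> bool" where
  "riemannian_metric A a \<longleftrightarrow>
     (\<forall>p\<in>carrier A. \<forall>u\<in>tangent_space A p. \<forall>v\<in>tangent_space A p. \<forall>w\<in>tangent_space A p. \<forall>r.
        a p (scal r u + v) w = r * a p u w + a p v w) \<and>
     (\<forall>p\<in>carrier A. \<forall>v\<in>tangent_space A p. \<forall>w\<in>tangent_space A p. a p v w = a p w v) \<and>
     (\<forall>p\<in>carrier A. \<forall>v\<in>tangent_space A p. v \<noteq> 0 \<longrightarrow> a p v v > 0) \<and>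
     (\<forall>X\<in>vector_fields A. \<forall>Y\<in>vector_fields A. smooth_fun A (carrier A) (\<lambda>p. a p (X p) (Y p)))"


section \<open>The pullback bundle over the slit tangent bundle\<close>

text \<open>In what follows \<open>M\<close> is the base manifold.  A point \<open>u\<close> of the slit tangent bundle is a pair
  \<open>(p, y)\<close>, so \<open>fst\<close> is the bundle projection.\<close>

type_synonym 'm tpoint = "'m \<times> 'm tvec"

definition slit :: "('m, 'e::euclidean_space) atlas \<Rightarrow> ('m tpoint, 'e \<times> 'e) atlas" where
  "slit M = open_submanifold (tangent_bundle M) {(p, v). v \<noteq> 0}"

definition pullback_bundle ::
  "('m, 'e::euclidean_space) atlas \<Rightarrow> ('m tpoint \<times> 'm tvec, ('e \<times> 'e) \<times> 'e) atlas" where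
  "pullback_bundle M =
     (\<lambda>(U, \<phi>). ({(u, v). u \<in> carrier (slit M) \<and> fst u \<in> U \<and> v \<in> tangent_space M (fst u)},
               \<lambda>((p, y), v). ((\<phi> p, tvec_components \<phi> y), tvec_components \<phi> v))) ` M"

text \<open>A section is represented by its fibre component; only its values on the slit tangent bundle
  matter.\<close>

type_synonym 'm psection = "'m tpoint \<Rightarrow> 'm tvec"
type_synonym 'm vfield = "'m tpoint \<Rightarrow> 'm tpoint tvec"

definition psections :: "('m, 'e::euclidean_space) atlas \<Rightarrow> 'm psection set" where
  "psections M = {Y. smooth_map (slit M) (pullback_bundle M) (\<lambda>u. (u, Y u))}"

definition eta :: "'m psection" where
  "eta u = snd u"

definition rho :: "('m, 'e::euclidean_space) atlas \<Rightarrow> 'm tpoint \<Rightarrow> 'm tpoint tvec \<Rightarrow> 'm tvec" where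
  "rho M u X = differential (slit M) M fst u X"

definition gamma :: "('m, 'e::euclidean_space) atlas \<Rightarrow> 'm tpoint \<Rightarrow> 'm tvec \<Rightarrow> 'm tpoint tvec" where
  "gamma M u v = velocity (slit M) (\<lambda>t. (fst u, snd u + scal t v)) 0"

definition J :: "('m, 'e::euclidean_space) atlas \<Rightarrow> 'm tpoint \<Rightarrow> 'm tpoint tvec \<Rightarrow> 'm tpoint tvec" where
  "J M u X = gamma M u (rho M u X)"


section \<open>Regular connections, torsions and curvature\<close>

text \<open>\<open>D u X Y\<close> is the covariant derivative of the section \<open>Y\<close> in the direction of the tangent
  vector \<open>X\<close> to the slit tangent bundle at \<open>u\<close>.\<close>

type_synonym 'm conn = "'m tpoint \<Rightarrow> 'm tpoint tvec \<Rightarrow> 'm psection \<Rightarrow> 'm tvec"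

definition linear_connection :: "('m, 'e::euclidean_space) atlas \<Rightarrow> 'm conn \<Rightarrow> bool" where
  "linear_connection M D \<longleftrightarrow>
     (\<forall>u\<in>carrier (slit M). \<forall>X\<in>tangent_space (slit M) u. \<forall>Y\<in>psections M.
        D u X Y \<in> tangent_space M (fst u)) \<and>
     (\<forall>u\<in>carrier (slit M). \<forall>X\<in>tangent_space (slit M) u. \<forall>X'\<in>tangent_space (slit M) u. \<forall>Y\<in>psections M. \<forall>a.
        D u (scal a X + X') Y = scal a (D u X Y) + D u X' Y) \<and>
     (\<forall>u\<in>carrier (slit M). \<forall>X\<in>tangent_space (slit M) u. \<forall>Y\<in>psections M. \<forall>Z\<in>psections M.
        D u X (\<lambda>w. Y w + Z w) = D u X Y + D u X Z) \<and>
     (\<forall>u\<in>carrier (slit M). \<forall>X\<in>tangent_space (slit M) u. \<forall>Y\<in>psections M. \<forall>f.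
        smooth_fun (slit M) (carrier (slit M)) f \<longrightarrow>
        D u X (\<lambda>w. scal (f w) (Y w)) = scal (f u) (D u X Y) + scal (X f) (Y u)) \<and>
     (\<forall>u\<in>carrier (slit M). \<forall>X\<in>tangent_space (slit M) u. \<forall>Y\<in>psections M. \<forall>Z\<in>psections M.
        (\<forall>w\<in>carrier (slit M). Y w = Z w) \<longrightarrow> D u X Y = D u X Z) \<and>
     (\<forall>X\<in>vector_fields (slit M). \<forall>Y\<in>psections M. (\<lambda>u. D u (X u) Y) \<in> psections M)"

definition vertical_space :: "('m, 'e::euclidean_space) atlas \<Rightarrow> 'm tpoint \<Rightarrow> 'm tpoint tvec set" where
  "vertical_space M u = {X \<in> tangent_space (slit M) u. rho M u X = 0}"

definition horizontal_space ::
  "('m, 'e::euclidean_space) atlas \<Rightarrow> 'm conn \<Rightarrow> 'm tpoint \<Rightarrow> 'm tpoint tvec set" where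
  "horizontal_space M D u = {X \<in> tangent_space (slit M) u. D u X eta = 0}"

definition regular_connection :: "('m, 'e::euclidean_space) atlas \<Rightarrow> 'm conn \<Rightarrow> bool" where
  "regular_connection M D \<longleftrightarrow> linear_connection M D \<and>
     (\<forall>u\<in>carrier (slit M).
        vertical_space M u \<inter> horizontal_space M D u = {0} \<and>
        (\<forall>X\<in>tangent_space (slit M) u.
           \<exists>V\<in>vertical_space M u. \<exists>H\<in>horizontal_space M D u. X = V + H))"

definition beta :: "('m, 'e::euclidean_space) atlas \<Rightarrow> 'm conn \<Rightarrow> 'm tpoint \<Rightarrow> 'm tvec \<Rightarrow> 'm tpoint tvec" where
  "beta M D u v = (THE X. X \<in> horizontal_space M D u \<and> rho M u X = v)"

definition horizontal_projector ::
  "('m, 'e::euclidean_space) atlas \<Rightarrow> 'm conn \<Rightarrow> 'm tpoint \<Rightarrow> 'm tpoint tvec \<Rightarrow> 'm tpoint tvec" where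
  "horizontal_projector M D u X = beta M D u (rho M u X)"

definition torsion ::
  "('m, 'e::euclidean_space) atlas \<Rightarrow> 'm conn \<Rightarrow> 'm vfield \<Rightarrow> 'm vfield \<Rightarrow> 'm psection" where
  "torsion M D X Y u =
     D u (X u) (\<lambda>w. rho M w (Y w)) - D u (Y u) (\<lambda>w. rho M w (X w))
     - rho M u (lie_bracket (slit M) X Y u)"

text \<open>The sign convention for the curvature is the opposite of the most common one.\<close>

definition curvature ::
  "('m, 'e::euclidean_space) atlas \<Rightarrow> 'm conn \<Rightarrow> 'm vfield \<Rightarrow> 'm vfield \<Rightarrow> 'm psection \<Rightarrow> 'm psection" where
  "curvature M D X Y Z u =
     - D u (X u) (\<lambda>w. D w (Y w) Z) + D u (Y u) (\<lambda>w. D w (X w) Z)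
     + D u (lie_bracket (slit M) X Y u) Z"

definition h_torsion ::
  "('m, 'e::euclidean_space) atlas \<Rightarrow> 'm conn \<Rightarrow> 'm psection \<Rightarrow> 'm psection \<Rightarrow> 'm psection" where
  "h_torsion M D X Y = torsion M D (\<lambda>u. beta M D u (X u)) (\<lambda>u. beta M D u (Y u))"

definition mixed_torsion ::
  "('m, 'e::euclidean_space) atlas \<Rightarrow> 'm conn \<Rightarrow> 'm psection \<Rightarrow> 'm psection \<Rightarrow> 'm psection" where
  "mixed_torsion M D X Y = torsion M D (\<lambda>u. gamma M u (X u)) (\<lambda>u. beta M D u (Y u))"

definition vhv_torsion ::
  "('m, 'e::euclidean_space) atlas \<Rightarrow> 'm conn \<Rightarrow> 'm psection \<Rightarrow> 'm psection \<Rightarrow> 'm psection" where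
  "vhv_torsion M D X Y = curvature M D (\<lambda>u. beta M D u (X u)) (\<lambda>u. gamma M u (Y u)) eta"


section \<open>Finsler manifolds\<close>

definition energy :: "('m tpoint \<Rightarrow> real) \<Rightarrow> 'm tpoint \<Rightarrow> real" where
  "energy L u = (L u)\<^sup>2 / 2"

text \<open>The fibrewise Hessian of the energy; equivalently \<open>g(\<rho>X, \<rho>Y) = \<Omega>(JX, Y)\<close> with \<open>\<Omega>\<close> as defined below.\<close>

definition finsler_metric :: "('m tpoint \<Rightarrow> real) \<Rightarrow> 'm tpoint \<Rightarrow> 'm tvec \<Rightarrow> 'm tvec \<Rightarrow> real" where
  "finsler_metric L u v w =
     deriv (\<lambda>s. deriv (\<lambda>t. energy L (fst u, snd u + scal s v + scal t w)) 0) 0"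

definition finsler_manifold :: "('m, 'e::euclidean_space) atlas \<Rightarrow> ('m tpoint \<Rightarrow> real) \<Rightarrow> bool" where
  "finsler_manifold M L \<longleftrightarrow> smooth_manifold M \<and>
     continuous_map (manifold_topology (tangent_bundle M)) euclideanreal L \<and>
     smooth_fun (slit M) (carrier (slit M)) L \<and>
     (\<forall>u\<in>carrier (slit M). L u > 0) \<and>
     (\<forall>(p, v)\<in>carrier (tangent_bundle M). \<forall>c>0. L (p, scal c v) = c * L (p, v)) \<and>
     (\<forall>u\<in>carrier (slit M). \<forall>v\<in>tangent_space M (fst u). v \<noteq> 0 \<longrightarrow> finsler_metric L u v v > 0)"

definition Omega ::
  "('m, 'e::euclidean_space) atlas \<Rightarrow> ('m tpoint \<Rightarrow> real) \<Rightarrow> 'm vfield \<Rightarrow> 'm vfield \<Rightarrow> 'm tpoint \<Rightarrow> real" where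
  "Omega M L = exterior_derivative (slit M) (\<lambda>u X. J M u X (energy L))"

definition canonical_spray :: "('m, 'e::euclidean_space) atlas \<Rightarrow> ('m tpoint \<Rightarrow> real) \<Rightarrow> 'm vfield \<Rightarrow> bool" where
  "canonical_spray M L G \<longleftrightarrow> G \<in> vector_fields (slit M) \<and>
     (\<forall>Y\<in>vector_fields (slit M). \<forall>u\<in>carrier (slit M). Omega M L G Y u = - Y u (energy L))"

text \<open>\<open>metric_derivative D L X Y Z\<close> is the function \<open>(D\<^sub>X g)(Y, Z)\<close> for the Finsler metric \<open>g\<close> of \<open>L\<close>.\<close>

definition metric_derivative ::
  "'m conn \<Rightarrow> ('m tpoint \<Rightarrow> real) \<Rightarrow> 'm vfield \<Rightarrow> 'm psection \<Rightarrow> 'm psection \<Rightarrow> 'm tpoint \<Rightarrow> real" where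
  "metric_derivative D L X Y Z u =
     X u (\<lambda>w. finsler_metric L w (Y w) (Z w))
     - finsler_metric L u (D u (X u) Y) (Z u) - finsler_metric L u (Y u) (D u (X u) Z)"

definition metric_parallel_along ::
  "('m, 'e::euclidean_space) atlas \<Rightarrow> 'm conn \<Rightarrow> ('m tpoint \<Rightarrow> real) \<Rightarrow> 'm vfield \<Rightarrow> bool" where
  "metric_parallel_along M D L X \<longleftrightarrow>
     (\<forall>Y\<in>psections M. \<forall>Z\<in>psections M. \<forall>u\<in>carrier (slit M). metric_derivative D L X Y Z u = 0)"

definition cartan_connection :: "('m, 'e::euclidean_space) atlas \<Rightarrow> ('m tpoint \<Rightarrow> real) \<Rightarrow> 'm conn \<Rightarrow> bool" where
  "cartan_connection M L D \<longleftrightarrow> regular_connection M D \<and>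
     (\<forall>X\<in>vector_fields (slit M). metric_parallel_along M D L X) \<and>
     (\<forall>X\<in>psections M. \<forall>Y\<in>psections M. \<forall>u\<in>carrier (slit M). h_torsion M D X Y u = 0) \<and>
     (\<forall>X\<in>psections M. \<forall>Y\<in>psections M. \<forall>Z\<in>psections M. \<forall>u\<in>carrier (slit M).
        finsler_metric L u (mixed_torsion M D X Y u) (Z u) =
        finsler_metric L u (mixed_torsion M D X Z u) (Y u))"

definition berwald_connection :: "('m, 'e::euclidean_space) atlas \<Rightarrow> ('m tpoint \<Rightarrow> real) \<Rightarrow> 'm conn \<Rightarrow> bool" where
  "berwald_connection M L D \<longleftrightarrow> regular_connection M D \<and>
     (\<forall>u\<in>carrier (slit M). \<forall>X\<in>tangent_space (slit M) u. horizontal_projector M D u X L = 0) \<and>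
     (\<forall>X\<in>vector_fields (slit M). \<forall>Y\<in>vector_fields (slit M). \<forall>u\<in>carrier (slit M). torsion M D X Y u = 0) \<and>
     (\<forall>X\<in>psections M. \<forall>Y\<in>psections M. \<forall>u\<in>carrier (slit M). vhv_torsion M D X Y u = 0)"

definition riemannian :: "('m, 'e::euclidean_space) atlas \<Rightarrow> ('m tpoint \<Rightarrow> real) \<Rightarrow> bool" where
  "riemannian M L \<longleftrightarrow> (\<exists>a. riemannian_metric M a \<and>
     (\<forall>u\<in>carrier (slit M). \<forall>v\<in>tangent_space M (fst u). \<forall>w\<in>tangent_space M (fst u).
        finsler_metric L u v w = a (fst u) v w))"

text \<open>The quantifier over \<open>D\<close> ranges over the Cartan connection of \<open>(M, L)\<close>, which exists and is
  unique (up to the irrelevant values of \<open>D\<close> at arguments outside its domain).\<close>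

definition landsbergian :: "('m, 'e::euclidean_space) atlas \<Rightarrow> ('m tpoint \<Rightarrow> real) \<Rightarrow> bool" where
  "landsbergian M L \<longleftrightarrow> (\<forall>D. cartan_connection M L D \<longrightarrow>
     (\<forall>X\<in>psections M. \<forall>Y\<in>psections M. \<forall>u\<in>carrier (slit M). vhv_torsion M D X Y u = 0))"

text \<open>Needed only in dimension one.  There a slit fibre has two components, on which \<open>g\<close> may take two
  different constant values: \<open>L(x, y) = y\<close> for \<open>y \<ge> 0\<close> and \<open>L(x, y) = -2y\<close> for \<open>y < 0\<close> has a
  vertically parallel metric that is not the pullback of a Riemannian metric.\<close>

definition reversible :: "('m, 'e::euclidean_space) atlas \<Rightarrow> ('m tpoint \<Rightarrow> real) \<Rightarrow> bool" where
  "reversible M L \<longleftrightarrow> (\<forall>(p, v)\<in>carrier (tangent_bundle M). L (p, scal (-1) v) = L (p, v))"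

end

theory Submission
  imports Defs
begin

text \<open>
  Write \<open>\<gamma>X\<close> for the vertical lift of a section \<open>X\<close>, \<open>\<beta>X\<close> and \<open>\<beta>\<^sub>0X\<close> for its horizontal lifts with respect to the
  Cartan connection \<open>\<nabla>\<close> and the Berwald connection \<open>D\<close>, and \<open>E\<close> for the energy.  The idea is to
  compare the two connections by covariant calculus on the slit tangent bundle; coordinates enter only
  through the elementary description of tangent vectors, of \<open>\<gamma>\<close> and of the Hessian \<open>g\<close>.

  \<^emph>\<open>Vertical directions.\<close>  The bracket \<open>[\<gamma>X, W]\<close> is mapped by \<open>\<rho>\<close> to the derivative of \<open>\<rho>W\<close> along the fibre
  in the direction \<open>X\<close> (\<open>rho_bracket\<close>).  So vanishing torsion forces \<open>D\<^bsub>\<gamma>X\<^esub>\<close> to be the fibre derivative,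
  while the mixed torsion of \<open>\<nabla>\<close> is \<open>T(X, Y) = \<nabla>\<^bsub>\<gamma>X\<^esub>Y - D\<^bsub>\<gamma>X\<^esub>Y\<close>.  Inserting this into \<open>\<nabla>g = 0\<close> and using that
  \<open>g(T(X, Y), Z)\<close> is symmetric in \<open>Y\<close> and \<open>Z\<close> gives (a).

  \<^emph>\<open>Horizontal lifts are smooth.\<close>  The spray satisfies \<open>\<rho>G = \<eta>\<close>, hence \<open>[\<gamma>Y, G]\<close> is a globally defined smooth
  vector field over \<open>Y\<close>.  For both connections the connection map \<open>K\<close> inverts \<open>\<gamma>\<close>, so the horizontal lift
  of \<open>Y\<close> is \<open>[\<gamma>Y, G]\<close> minus \<open>\<gamma>\<close> of its image under \<open>K\<close>.

  \<^emph>\<open>The Berwald connection along horizontal directions.\<close>  Since \<open>\<beta>\<^sub>0X\<close> annihilates \<open>E\<close>, the form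
  \<open>\<alpha>(Y) = \<gamma>Y \<cdot> E = g(\<eta>, Y)\<close> is parallel along \<open>\<beta>\<^sub>0X\<close> (\<open>hor_dE\<close>).  As \<open>g\<close> is the fibre derivative of \<open>\<alpha>\<close>, the
  Ricci identity turns \<open>(D\<^bsub>\<beta>\<^sub>0X\<^esub>g)(Y, Z)\<close> into \<open>\<alpha>\<close> of the mixed curvature \<open>\<^bold>K(\<beta>\<^sub>0X, \<gamma>Y)Z\<close>
  (\<open>metric_derivative_hor\<close>).  The first Bianchi identity of a torsion-free connection makes this
  expression symmetric in \<open>X\<close> and \<open>Z\<close>; it is symmetric in \<open>Y\<close> and \<open>Z\<close> anyway, hence totally symmetric,
  and it vanishes when one argument is \<open>\<eta>\<close>.  Because \<open>G = \<beta>\<^sub>0\<eta>\<close> (\<open>spray_horizontal\<close>), this is (c).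

  \<^emph>\<open>The Cartan connection along horizontal directions.\<close>  Let \<open>B(X, Y) = \<nabla>\<^bsub>\<beta>X\<^esub>Y - D\<^bsub>\<beta>X\<^esub>Y\<close>.  It is symmetric because
  both connections have no horizontal torsion, and \<open>\<nabla>g = 0\<close> expresses it through \<open>D\<^bsub>\<beta>X\<^esub>g\<close> by the Christoffel
  trick (\<open>Dg_Christoffel\<close>).  Writing \<open>\<beta>X = \<beta>\<^sub>0X + \<gamma>A(X)\<close>, one has \<open>B(X, \<eta>) = -A(X)\<close>; evaluating the Christoffel formula
  on \<open>\<eta>\<close> gives first \<open>A(\<eta>) = 0\<close> and then \<open>A = 0\<close>, so \<open>\<beta> = \<beta>\<^sub>0\<close>.  Then the \<open>(v)hv\<close>-torsion of \<open>\<nabla>\<close> is \<open>-B\<close>, and total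
  symmetry of \<open>D\<^bsub>\<beta>X\<^esub>g\<close> reduces the Christoffel formula to (b).  The Landsberg criterion follows since
  \<open>g\<close> is nondegenerate.

  \<^emph>\<open>The Riemannian criterion.\<close>  If \<open>g\<close> does not change along a fibre, it is parallel for the fibre derivative,
  which is \<open>D\<^bsub>\<gamma>X\<^esub>\<close>.  Conversely, on sections that are constant along the fibres, \<open>D\<^bsub>\<gamma>X\<^esub>g\<close> is the derivative of the
  coefficients of \<open>g\<close> in the direction \<open>X\<close>.  Cut-off functions provide enough such sections, so \<open>D\<^bsub>\<gamma>X\<^esub>g = 0\<close> makes
  \<open>g\<close> locally constant on each slit fibre, which is connected in dimension at least two; in dimension one
  reversibility compares the two half-lines.
\<close>

section \<open>Calculus of smooth maps between Euclidean spaces\<close>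

lemma frechet_derivative_cong_open:
  assumes "open S" "x \<in> S" "\<And>x. x \<in> S \<Longrightarrow> f x = g x" "f differentiable (at x)"
  shows "g differentiable (at x)" "frechet_derivative g (at x) = frechet_derivative f (at x)"
proof -
  have "(f has_derivative frechet_derivative f (at x)) (at x)"
    using assms(4) frechet_derivative_works by blast
  then have d: "(g has_derivative frechet_derivative f (at x)) (at x)"
    by (rule has_derivative_transform_within_open[OF _ assms(1,2)]) (rule assms(3))
  show "g differentiable (at x)" using d by (rule differentiableI)
  show "frechet_derivative g (at x) = frechet_derivative f (at x)"
    using frechet_derivative_at[OF d] by simp
qed

lemma Ck_on_cong:
  assumes "open S"
  shows "(\<And>x. x \<in> S \<Longrightarrow> f x = g x) \<Longrightarrow> Ck_on k f S \<Longrightarrow> Ck_on k g S"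
proof (induction k arbitrary: f g)
  case 0
  then have "continuous_on S f" by simp
  then have "continuous_on S g" by (rule continuous_on_eq) (rule 0(1))
  then show ?case by simp
next
  case (Suc k)
  have d: "f differentiable (at x)" if "x \<in> S" for x using Suc.prems(2) that by simp
  have "Ck_on k (\<lambda>x. frechet_derivative g (at x) v) S" for v
  proof (rule Suc.IH)
    show "Ck_on k (\<lambda>x. frechet_derivative f (at x) v) S" using Suc.prems(2) by simp
    show "frechet_derivative f (at x) v = frechet_derivative g (at x) v" if "x \<in> S" for x
      using frechet_derivative_cong_open(2)[of S x f g] that assms Suc.prems(1) d[OF that] by simp
  qed
  moreover have "g differentiable (at x)" if "x \<in> S" for x
    using frechet_derivative_cong_open(1)[of S x f g] that assms Suc.prems(1) d[OF that] by simp
  ultimately show ?case by simp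
qed

text \<open>Together with \<open>Ck_on_SucE\<close> this trades the total function \<open>frechet_derivative\<close> for an explicit
  derivative, so that the closure properties below follow from the usual differentiation rules.\<close>

lemma Ck_on_SucI:
  assumes "open S" and "\<And>x. x \<in> S \<Longrightarrow> (f has_derivative f' x) (at x)"
    and "\<And>v. Ck_on k (\<lambda>x. f' x v) S"
  shows "Ck_on (Suc k) f S"
proof -
  have eq: "f' x v = frechet_derivative f (at x) v" if "x \<in> S" for x v
    using frechet_derivative_at[OF assms(2)[OF that]] by simp
  have "Ck_on k (\<lambda>x. frechet_derivative f (at x) v) S" for v
    by (rule Ck_on_cong[OF assms(1) eq assms(3)])
  moreover have "f differentiable (at x)" if "x \<in> S" for x
    using assms(2)[OF that] by (rule differentiableI)
  ultimately show ?thesis by simp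
qed

lemma Ck_on_SucE:
  assumes "Ck_on (Suc k) f S"
  obtains f' where "\<And>x. x \<in> S \<Longrightarrow> (f has_derivative f' x) (at x)"
    and "\<And>v. Ck_on k (\<lambda>x. f' x v) S"
proof
  show "(f has_derivative frechet_derivative f (at x)) (at x)" if "x \<in> S" for x
    using assms that frechet_derivative_works by auto
  show "Ck_on k (\<lambda>x. frechet_derivative f (at x) v) S" for v using assms by simp
qed

lemma Ck_on_subset: "Ck_on k f S \<Longrightarrow> T \<subseteq> S \<Longrightarrow> Ck_on k f T"
proof (induction k arbitrary: f)
  case 0
  then show ?case using continuous_on_subset by auto
next
  case (Suc k)
  then show ?case by (auto simp: subset_iff)
qed

lemma Ck_on_mono: "Ck_on (Suc k) f S \<Longrightarrow> Ck_on k f S"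
proof (induction k arbitrary: f)
  case 0
  then show ?case
    by (auto intro!: continuous_at_imp_continuous_on differentiable_imp_continuous_within)
next
  case (Suc k)
  then show ?case by (metis Ck_on.simps(2))
qed

lemma Ck_on_continuous: "Ck_on k f S \<Longrightarrow> continuous_on S f"
proof (induction k)
  case (Suc k)
  then show ?case using Ck_on_mono by blast
qed simp

lemma Ck_on_local:
  assumes "\<And>x. x \<in> S \<Longrightarrow> \<exists>T. open T \<and> x \<in> T \<and> Ck_on k f T"
  shows "Ck_on k f S"
  using assms
proof (induction k arbitrary: f)
  case 0
  then show ?case
    by (fastforce intro!: continuous_at_imp_continuous_on simp: continuous_on_eq_continuous_at)
next
  case (Suc k)
  have "f differentiable (at x)" if "x \<in> S" for x using Suc.prems[OF that] by auto
  moreover have "Ck_on k (\<lambda>x. frechet_derivative f (at x) v) S" for v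
    by (rule Suc.IH) (use Suc.prems in fastforce)
  ultimately show ?case by simp
qed

lemma Ck_on_const: "open S \<Longrightarrow> Ck_on k (\<lambda>x. c) S"
proof (induction k arbitrary: c)
  case (Suc k)
  show ?case by (rule Ck_on_SucI[where f' = "\<lambda>x v. 0"]) (use Suc in auto)
qed auto

lemma Ck_on_linear:
  assumes "open S" "bounded_linear h" shows "Ck_on k h S"
proof (cases k)
  case 0
  then show ?thesis using linear_continuous_on[OF assms(2)] by simp
next
  case (Suc j)
  show ?thesis unfolding Suc
    by (rule Ck_on_SucI[where f' = "\<lambda>x. h"])
      (use assms in \<open>auto intro: Ck_on_const bounded_linear_imp_has_derivative\<close>)
qed

lemma Ck_on_add:
  assumes "open S" shows "Ck_on k f S \<Longrightarrow> Ck_on k g S \<Longrightarrow> Ck_on k (\<lambda>x. f x + g x) S"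
proof (induction k arbitrary: f g)
  case 0
  then show ?case by (auto intro: continuous_intros)
next
  case (Suc k)
  obtain f' where f': "\<And>x. x \<in> S \<Longrightarrow> (f has_derivative f' x) (at x)"
      "\<And>v. Ck_on k (\<lambda>x. f' x v) S"
    using Suc.prems(1) Ck_on_SucE by metis
  obtain g' where g': "\<And>x. x \<in> S \<Longrightarrow> (g has_derivative g' x) (at x)"
      "\<And>v. Ck_on k (\<lambda>x. g' x v) S"
    using Suc.prems(2) Ck_on_SucE by metis
  show ?case
    by (rule Ck_on_SucI[where f' = "\<lambda>x v. f' x v + g' x v", OF assms])
      (use f' g' Suc.IH in \<open>auto intro: has_derivative_add\<close>)
qed

lemma Ck_on_sum:
  assumes "open S" "finite I" "\<And>i. i \<in> I \<Longrightarrow> Ck_on k (f i) S"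
  shows "Ck_on k (\<lambda>x. \<Sum>i\<in>I. f i x) S"
  using assms(2,3)
  by (induction I rule: finite_induct) (auto intro: Ck_on_const Ck_on_add assms(1))

lemma Ck_on_bilinear:
  assumes "open S" and b: "bounded_bilinear b"
  shows "Ck_on k f S \<Longrightarrow> Ck_on k g S \<Longrightarrow> Ck_on k (\<lambda>x. b (f x) (g x)) S"
proof (induction k arbitrary: f g)
  case 0
  then show ?case using bounded_bilinear.continuous_on[OF b] by auto
next
  case (Suc k)
  obtain f' where f': "\<And>x. x \<in> S \<Longrightarrow> (f has_derivative f' x) (at x)"
      "\<And>v. Ck_on k (\<lambda>x. f' x v) S"
    using Suc.prems(1) Ck_on_SucE by metis
  obtain g' where g': "\<And>x. x \<in> S \<Longrightarrow> (g has_derivative g' x) (at x)"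
      "\<And>v. Ck_on k (\<lambda>x. g' x v) S"
    using Suc.prems(2) Ck_on_SucE by metis
  have 1: "Ck_on k f S" "Ck_on k g S" using Suc.prems Ck_on_mono by auto
  show ?case
    by (rule Ck_on_SucI[where f' = "\<lambda>x v. b (f x) (g' x v) + b (f' x v) (g x)", OF assms(1)])
      (use f' g' 1 Suc.IH in \<open>auto intro!: Ck_on_add assms bounded_bilinear.FDERIV[OF b]\<close>)
qed

lemma Ck_on_bounded_linear:
  assumes "open S" "bounded_linear h" shows "Ck_on k f S \<Longrightarrow> Ck_on k (\<lambda>x. h (f x)) S"
proof (induction k arbitrary: f)
  case 0
  then show ?case using bounded_linear.continuous_on[OF assms(2)] by auto
next
  case (Suc k)
  obtain f' where f': "\<And>x. x \<in> S \<Longrightarrow> (f has_derivative f' x) (at x)"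
      "\<And>v. Ck_on k (\<lambda>x. f' x v) S"
    using Suc.prems(1) Ck_on_SucE by metis
  show ?case
    by (rule Ck_on_SucI[where f' = "\<lambda>x v. h (f' x v)", OF assms(1)])
      (use f' Suc.IH in \<open>auto intro: bounded_linear.has_derivative[OF assms(2)]\<close>)
qed

lemma linear_basis_expand:
  fixes h :: "'a::euclidean_space \<Rightarrow> 'b::real_vector"
  assumes "linear h" shows "h v = (\<Sum>i\<in>Basis. (v \<bullet> i) *\<^sub>R h i)"
proof -
  have "h v = h (\<Sum>i\<in>Basis. (v \<bullet> i) *\<^sub>R i)" by (simp add: euclidean_representation)
  also have "\<dots> = (\<Sum>i\<in>Basis. (v \<bullet> i) *\<^sub>R h i)"
    by (simp add: linear_sum[OF assms] linear_cmul[OF assms])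
  finally show ?thesis .
qed

text \<open>In the chain rule \<open>g' (f x) (f' x v)\<close> the direction depends on \<open>x\<close>.  Expanding it in a basis leaves the
  functions \<open>\<lambda>x. g' (f x) i\<close> with a constant direction \<open>i\<close>, to which the induction hypothesis applies.\<close>

lemma Ck_on_compose:
  fixes f :: "'a::euclidean_space \<Rightarrow> 'b::euclidean_space" and g :: "'b \<Rightarrow> 'c::real_normed_vector"
  assumes "open S" "open T" "f ` S \<subseteq> T"
  shows "Ck_on k f S \<Longrightarrow> Ck_on k g T \<Longrightarrow> Ck_on k (\<lambda>x. g (f x)) S"
proof (induction k arbitrary: g)
  case 0
  then show ?case using assms(3) by (auto intro: continuous_on_compose2)
next
  case (Suc k)
  obtain f' where f': "\<And>x. x \<in> S \<Longrightarrow> (f has_derivative f' x) (at x)"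
      "\<And>v. Ck_on k (\<lambda>x. f' x v) S"
    using Suc.prems(1) Ck_on_SucE by metis
  obtain g' where g': "\<And>x. x \<in> T \<Longrightarrow> (g has_derivative g' x) (at x)"
      "\<And>v. Ck_on k (\<lambda>x. g' x v) T"
    using Suc.prems(2) Ck_on_SucE by metis
  have kf: "Ck_on k f S" using Suc.prems Ck_on_mono by blast
  have "Ck_on k (\<lambda>x. g' (f x) (f' x v)) S" for v
  proof (rule Ck_on_cong[OF assms(1)])
    show "Ck_on k (\<lambda>x. \<Sum>i\<in>Basis. (f' x v \<bullet> i) *\<^sub>R g' (f x) i) S"
      by (intro Ck_on_sum Ck_on_bilinear[OF _ bounded_bilinear_scaleR] assms(1) finite_Basis
          Ck_on_bounded_linear[OF _ bounded_linear_inner_left] f' Suc.IH[OF kf] g')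
  next
    fix x assume "x \<in> S"
    then have "linear (g' (f x))" using g'(1)[of "f x"] assms(3) has_derivative_linear by blast
    then show "(\<Sum>i\<in>Basis. (f' x v \<bullet> i) *\<^sub>R g' (f x) i) = g' (f x) (f' x v)"
      using linear_basis_expand by metis
  qed
  moreover have "((\<lambda>x. g (f x)) has_derivative (\<lambda>v. g' (f x) (f' x v))) (at x)" if "x \<in> S" for x
    using has_derivative_compose[OF f'(1) g'(1)] that assms(3) by blast
  ultimately show ?case by (intro Ck_on_SucI[OF assms(1)])
qed

lemma smooth_on_cong: "open S \<Longrightarrow> (\<And>x. x \<in> S \<Longrightarrow> f x = g x) \<Longrightarrow> smooth_on S f \<Longrightarrow> smooth_on S g"
  unfolding smooth_on_def using Ck_on_cong by blast

lemma smooth_on_subset: "smooth_on S f \<Longrightarrow> T \<subseteq> S \<Longrightarrow> smooth_on T f"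
  unfolding smooth_on_def using Ck_on_subset by blast

lemma smooth_on_local:
  "(\<And>x. x \<in> S \<Longrightarrow> \<exists>T. open T \<and> x \<in> T \<and> smooth_on T f) \<Longrightarrow> smooth_on S f"
  unfolding smooth_on_def using Ck_on_local by meson

lemma smooth_on_const: "open S \<Longrightarrow> smooth_on S (\<lambda>x. c)"
  unfolding smooth_on_def using Ck_on_const by blast

lemma smooth_on_linear: "open S \<Longrightarrow> bounded_linear h \<Longrightarrow> smooth_on S h"
  unfolding smooth_on_def using Ck_on_linear by blast

lemma smooth_on_add: "open S \<Longrightarrow> smooth_on S f \<Longrightarrow> smooth_on S g \<Longrightarrow> smooth_on S (\<lambda>x. f x + g x)"
  unfolding smooth_on_def using Ck_on_add by blast

lemma smooth_on_sum:
  "open S \<Longrightarrow> finite I \<Longrightarrow> (\<And>i. i \<in> I \<Longrightarrow> smooth_on S (f i)) \<Longrightarrow> smooth_on S (\<lambda>x. \<Sum>i\<in>I. f i x)"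
  unfolding smooth_on_def using Ck_on_sum by blast

lemma smooth_on_bilinear:
  "open S \<Longrightarrow> bounded_bilinear b \<Longrightarrow> smooth_on S f \<Longrightarrow> smooth_on S g \<Longrightarrow> smooth_on S (\<lambda>x. b (f x) (g x))"
  unfolding smooth_on_def using Ck_on_bilinear by blast

lemma smooth_on_bounded_linear:
  "open S \<Longrightarrow> bounded_linear h \<Longrightarrow> smooth_on S f \<Longrightarrow> smooth_on S (\<lambda>x. h (f x))"
  unfolding smooth_on_def using Ck_on_bounded_linear by blast

lemma smooth_on_compose:
  fixes f :: "'a::euclidean_space \<Rightarrow> 'b::euclidean_space"
  shows "open S \<Longrightarrow> open T \<Longrightarrow> f ` S \<subseteq> T \<Longrightarrow> smooth_on S f \<Longrightarrow> smooth_on T g \<Longrightarrow>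
    smooth_on S (\<lambda>x. g (f x))"
  unfolding smooth_on_def using Ck_on_compose by blast

lemma smooth_on_has_derivative:
  "smooth_on S f \<Longrightarrow> x \<in> S \<Longrightarrow> (f has_derivative frechet_derivative f (at x)) (at x)"
  unfolding smooth_on_def using Ck_on.simps(2) frechet_derivative_works by blast

lemma smooth_on_frechet_const: "smooth_on S f \<Longrightarrow> smooth_on S (\<lambda>x. frechet_derivative f (at x) v)"
  unfolding smooth_on_def using Ck_on.simps(2) by blast

lemma smooth_on_linear_frechet:
  "smooth_on S f \<Longrightarrow> x \<in> S \<Longrightarrow> linear (frechet_derivative f (at x))"
  using smooth_on_has_derivative has_derivative_linear by blast

lemma smooth_on_components:
  fixes f :: "'a::euclidean_space \<Rightarrow> 'b::euclidean_space"
  assumes "open S" "\<And>i. i \<in> Basis \<Longrightarrow> smooth_on S (\<lambda>x. f x \<bullet> i)"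
  shows "smooth_on S f"
proof -
  have "smooth_on S (\<lambda>x. \<Sum>i\<in>Basis. (f x \<bullet> i) *\<^sub>R i)"
    by (intro smooth_on_sum smooth_on_bilinear[OF _ bounded_bilinear_scaleR] smooth_on_const assms) auto
  then show ?thesis by (simp add: euclidean_representation)
qed

lemma smooth_on_frechet_compose:
  fixes h :: "'a::euclidean_space \<Rightarrow> 'b::real_normed_vector" and x :: "'c::euclidean_space \<Rightarrow> 'a"
  assumes "open S" "open T" "smooth_on S h" "smooth_on T x" "x ` T \<subseteq> S" "smooth_on T c"
  shows "smooth_on T (\<lambda>z. frechet_derivative h (at (x z)) (c z))"
proof (rule smooth_on_cong[OF assms(2)])
  show "smooth_on T (\<lambda>z. \<Sum>i\<in>Basis. (c z \<bullet> i) *\<^sub>R frechet_derivative h (at (x z)) i)"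
    by (intro smooth_on_sum smooth_on_bilinear[OF _ bounded_bilinear_scaleR] finite_Basis assms
        smooth_on_bounded_linear[OF _ bounded_linear_inner_left]
        smooth_on_compose[OF assms(2,1,5,4) smooth_on_frechet_const[OF assms(3)]])
next
  fix z assume "z \<in> T"
  then have "x z \<in> S" using assms(5) by blast
  then show "(\<Sum>i\<in>Basis. (c z \<bullet> i) *\<^sub>R frechet_derivative h (at (x z)) i) = frechet_derivative h (at (x z)) (c z)"
    using linear_basis_expand[OF smooth_on_linear_frechet[OF assms(3)]] by metis
qed

lemma smooth_on_frechet:
  fixes f :: "'a::euclidean_space \<Rightarrow> 'b::real_normed_vector"
  assumes "open S" "smooth_on S f" "smooth_on S v"
  shows "smooth_on S (\<lambda>x. frechet_derivative f (at x) (v x))"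
  using smooth_on_frechet_compose[OF assms(1,1,2) smooth_on_linear[OF assms(1) bounded_linear_ident] _ assms(3)]
  by simp

lemma smooth_on_Pair:
  fixes f :: "'a::euclidean_space \<Rightarrow> 'b::euclidean_space" and g :: "'a \<Rightarrow> 'c::euclidean_space"
  assumes "open S" "smooth_on S f" "smooth_on S g"
  shows "smooth_on S (\<lambda>x. (f x, g x))"
proof -
  have "smooth_on S (\<lambda>x. (f x, 0) + (0, g x))"
    by (intro smooth_on_add assms
        smooth_on_bounded_linear[where h = "\<lambda>y. (y, 0)"] smooth_on_bounded_linear[where h = "\<lambda>y. (0, y)"]
        bounded_linear_Pair bounded_linear_ident bounded_linear_zero)
  then show ?thesis by simp
qed

lemma smooth_on_mult:
  fixes f g :: "'a::euclidean_space \<Rightarrow> real"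
  shows "open S \<Longrightarrow> smooth_on S f \<Longrightarrow> smooth_on S g \<Longrightarrow> smooth_on S (\<lambda>x. f x * g x)"
  by (rule smooth_on_bilinear[OF _ bounded_bilinear_mult])

lemma frechet_derivative_eqI:
  "(f has_derivative f') (at x) \<Longrightarrow> frechet_derivative f (at x) = f'"
  by (metis frechet_derivative_at)

subsection \<open>The Hadamard lemma\<close>

lemma segment_in_ball:
  fixes a x :: "'a::real_normed_vector"
  assumes "x \<in> ball a r" "t \<in> {0..1}" shows "a + t *\<^sub>R (x - a) \<in> ball a r"
proof -
  have "norm (t *\<^sub>R (x - a)) \<le> norm (x - a)" using assms by (simp add: mult_left_le_one_le)
  then show ?thesis using assms by (simp add: dist_norm norm_minus_commute)
qed

text \<open>The weight \<open>t ^ m\<close> is what makes the induction work: differentiating under the integral in the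
  direction \<open>v\<close> gives an integral of the same form, with \<open>m + 1\<close> and the derivative of \<open>f\<close> along \<open>v\<close>.\<close>

lemma Ck_on_line_integral:
  fixes f :: "'a::euclidean_space \<Rightarrow> real"
  shows "Ck_on k f (ball a r) \<Longrightarrow>
    Ck_on k (\<lambda>x. integral {0..1} (\<lambda>t. t ^ m * f (a + t *\<^sub>R (x - a)))) (ball a r)"
proof (induction k arbitrary: f m)
  case (0 f m)
  have in_ball: "a + t *\<^sub>R (x - a) \<in> ball a r" if "x \<in> ball a r" "t \<in> {0..1}" for x t
    by (rule segment_in_ball[OF that])
  have "continuous_on (ball a r \<times> cbox 0 1) (\<lambda>(x, t::real). t ^ m * f (a + t *\<^sub>R (x - a)))"
    using 0 in_ball unfolding split_beta
    by (auto intro!: continuous_intros continuous_on_compose2[of "ball a r" f])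
  then show ?case using integral_continuous_on_param by fastforce
next
  case (Suc k f m)
  have in_ball: "a + t *\<^sub>R (x - a) \<in> ball a r" if "x \<in> ball a r" "t \<in> {0..1}" for x t
    by (rule segment_in_ball[OF that])
  obtain f' where f': "\<And>x. x \<in> ball a r \<Longrightarrow> (f has_derivative f' x) (at x)"
      "\<And>v. Ck_on k (\<lambda>x. f' x v) (ball a r)"
    using Suc.prems Ck_on_SucE by metis
  define F' where "F' x t = Blinfun (\<lambda>v. t ^ Suc m * f' (a + t *\<^sub>R (x - a)) v)" for x and t :: real
  have bl: "bounded_linear (\<lambda>v. t ^ Suc m * f' (a + t *\<^sub>R (x - a)) v)"
    if "x \<in> ball a r" "t \<in> {0..1}" for x t
    using f'(1)[OF in_ball[OF that]] by (intro bounded_linear_const_mult has_derivative_bounded_linear)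
  have F': "blinfun_apply (F' x t) v = t ^ Suc m * f' (a + t *\<^sub>R (x - a)) v"
    if "x \<in> ball a r" "t \<in> {0..1}" for x t v
    unfolding F'_def using bounded_linear_Blinfun_apply[OF bl[OF that]] by simp
  have cf: "continuous_on (ball a r) f" using f'(1)
    by (meson differentiable_at_imp_differentiable_on differentiable_def differentiable_imp_continuous_on)
  have cf': "continuous_on (ball a r) (\<lambda>x. f' x v)" for v
    using Ck_on_continuous[OF f'(2)] .
  have cF': "continuous_on (ball a r \<times> cbox 0 1) (\<lambda>(x, t). F' x t)"
  proof (rule continuous_on_blinfun_componentwise)
    fix i :: 'a
    have "continuous_on (ball a r \<times> cbox 0 1) (\<lambda>p. (snd p) ^ Suc m * f' (a + snd p *\<^sub>R (fst p - a)) i)"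
      using in_ball by (auto intro!: continuous_intros continuous_on_compose2[OF cf'])
    moreover have "(snd p) ^ Suc m * f' (a + snd p *\<^sub>R (fst p - a)) i =
        blinfun_apply (case p of (x, t) \<Rightarrow> F' x t) i" if "p \<in> ball a r \<times> cbox 0 1" for p
      using that F' by (auto simp: split_beta)
    ultimately show "continuous_on (ball a r \<times> cbox 0 1) (\<lambda>p. blinfun_apply (case p of (x, t) \<Rightarrow> F' x t) i)"
      by (rule continuous_on_eq)
  qed
  have der: "((\<lambda>x. integral {0..1} (\<lambda>t. t ^ m * f (a + t *\<^sub>R (x - a))))
      has_derivative (\<lambda>v. integral {0..1} (\<lambda>t. t ^ Suc m * f' (a + t *\<^sub>R (x - a)) v))) (at x)"
    if x: "x \<in> ball a r" for x
  proof -
    have "((\<lambda>x. integral (cbox 0 1) (\<lambda>t. t ^ m * f (a + t *\<^sub>R (x - a))))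
        has_derivative integral (cbox 0 1) (F' x)) (at x within ball a r)"
    proof (rule leibniz_rule[OF _ _ cF' x])
      fix y t assume y: "y \<in> ball a r" and t: "t \<in> cbox (0::real) 1"
      have *: "((\<lambda>x. f (a + t *\<^sub>R (x - a))) has_derivative (\<lambda>v. f' (a + t *\<^sub>R (y - a)) (t *\<^sub>R v))) (at y)"
        using in_ball[OF y] t by (intro has_derivative_compose[OF _ f'(1)]) (auto intro!: derivative_eq_intros)
      have lin: "linear (f' (a + t *\<^sub>R (y - a)))"
        using has_derivative_linear[OF f'(1)[OF in_ball[OF y]]] t by simp
      have "(\<lambda>v. t ^ m * f' (a + t *\<^sub>R (y - a)) (t *\<^sub>R v)) = blinfun_apply (F' y t)"
      proof
        fix v
        have "blinfun_apply (F' y t) v = t ^ Suc m * f' (a + t *\<^sub>R (y - a)) v" using F'[OF y] t by simp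
        then show "t ^ m * f' (a + t *\<^sub>R (y - a)) (t *\<^sub>R v) = blinfun_apply (F' y t) v"
          using linear_cmul[OF lin, of t v] by simp
      qed
      then have "((\<lambda>x. t ^ m * f (a + t *\<^sub>R (x - a))) has_derivative blinfun_apply (F' y t)) (at y)"
        using has_derivative_mult_right[OF *, of "t ^ m"] by (simp only:)
      then show "((\<lambda>x. t ^ m * f (a + t *\<^sub>R (x - a))) has_derivative blinfun_apply (F' y t)) (at y within ball a r)"
        by (rule has_derivative_at_withinI)
    next
      fix y assume y: "y \<in> ball a r"
      show "(\<lambda>t. t ^ m * f (a + t *\<^sub>R (y - a))) integrable_on cbox 0 1"
        by (rule integrable_continuous)
          (use in_ball[OF y] in \<open>auto intro!: continuous_intros continuous_on_compose2[OF cf]\<close>)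
    qed simp
    then have d: "((\<lambda>x. integral {0..1} (\<lambda>t. t ^ m * f (a + t *\<^sub>R (x - a))))
        has_derivative integral {0..1} (F' x)) (at x)"
      unfolding at_within_open[OF x open_ball] by (simp only: box_real)
    have int: "F' x integrable_on {0..1}"
    proof -
      have "continuous_on (cbox 0 1) (\<lambda>t. F' x t)"
        using continuous_on_compose2[OF cF', of "cbox 0 1" "\<lambda>t. (x, t)"] x
        by (force intro!: continuous_intros)
      then show ?thesis using integrable_continuous by fastforce
    qed
    have "blinfun_apply (integral {0..1} (F' x)) v = integral {0..1} (\<lambda>t. blinfun_apply (F' x t) v)" for v
      by (rule blinfun_apply_integral[OF int])
    also have "\<dots> v = integral {0..1} (\<lambda>t. t ^ Suc m * f' (a + t *\<^sub>R (x - a)) v)" for v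
      by (intro integral_cong) (use F'[OF x] in auto)
    finally have "blinfun_apply (integral {0..1} (F' x)) =
        (\<lambda>v. integral {0..1} (\<lambda>t. t ^ Suc m * f' (a + t *\<^sub>R (x - a)) v))" by blast
    then show ?thesis using d by simp
  qed
  show ?case by (rule Ck_on_SucI[OF open_ball der Suc.IH[OF f'(2)]])
qed

text \<open>The functions \<open>h i\<close> are the integrals of the partial derivatives over the segment from \<open>a\<close> to \<open>x\<close>; the
  formula for \<open>f\<close> is the fundamental theorem of calculus along that segment.\<close>

lemma Hadamard_lemma:
  fixes f :: "'a::euclidean_space \<Rightarrow> real"
  assumes "smooth_on (ball a r) f"
  obtains h where "\<And>i. smooth_on (ball a r) (h i)"
    and "\<And>x. x \<in> ball a r \<Longrightarrow> f x = f a + (\<Sum>i\<in>Basis. ((x - a) \<bullet> i) * h i x)"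
    and "\<And>i. 0 < r \<Longrightarrow> h i a = frechet_derivative f (at a) i"
proof
  define h where "h i x = integral {0..1} (\<lambda>t. t ^ 0 * frechet_derivative f (at (a + t *\<^sub>R (x - a))) i)" for i x
  show "smooth_on (ball a r) (h i)" for i
    unfolding smooth_on_def h_def
  proof
    fix k
    have "Ck_on k (\<lambda>x. frechet_derivative f (at x) i) (ball a r)"
      using smooth_on_frechet_const[OF assms] by (simp add: smooth_on_def)
    then show "Ck_on k (\<lambda>x. integral {0..1}
        (\<lambda>t. t ^ 0 * frechet_derivative f (at (a + t *\<^sub>R (x - a))) i)) (ball a r)"
      by (rule Ck_on_line_integral)
  qed
  show "h i a = frechet_derivative f (at a) i" for i by (simp add: h_def)
  fix x assume x: "x \<in> ball a r"
  note in_ball = segment_in_ball[OF x]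
  let ?D = "\<lambda>t. frechet_derivative f (at (a + t *\<^sub>R (x - a)))"
  have lin: "linear (?D t)" if "t \<in> {0..1}" for t
    using smooth_on_linear_frechet[OF assms in_ball[OF that]] .
  have int: "(\<lambda>t. ?D t i) integrable_on {0..1}" for i
  proof (rule integrable_continuous_real)
    have "Ck_on 0 (\<lambda>x. frechet_derivative f (at x) i) (ball a r)"
      using smooth_on_frechet_const[OF assms, of i] smooth_on_def by blast
    then have c: "continuous_on (ball a r) (\<lambda>x. frechet_derivative f (at x) i)" by simp
    show "continuous_on {0..1} (\<lambda>t. ?D t i)"
      by (rule continuous_on_compose2[OF c]) (use in_ball in \<open>auto intro!: continuous_intros\<close>)
  qed
  have "((\<lambda>t. ?D t (x - a)) has_integral (f (a + 1 *\<^sub>R (x - a)) - f (a + 0 *\<^sub>R (x - a)))) {0..1}"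
  proof (rule fundamental_theorem_of_calculus)
    fix t :: real assume t: "t \<in> {0..1}"
    have "((\<lambda>t. f (a + t *\<^sub>R (x - a))) has_derivative (\<lambda>s. ?D t (s *\<^sub>R (x - a)))) (at t)"
      by (rule has_derivative_compose[where f = "\<lambda>t. a + t *\<^sub>R (x - a)",
            OF _ smooth_on_has_derivative[OF assms in_ball[OF t]]])
        (auto intro!: derivative_eq_intros)
    then show "((\<lambda>t. f (a + t *\<^sub>R (x - a))) has_vector_derivative ?D t (x - a)) (at t within {0..1})"
      unfolding has_vector_derivative_def linear_cmul[OF lin[OF t], symmetric]
      by (rule has_derivative_at_withinI)
  qed simp
  then have "f x - f a = integral {0..1} (\<lambda>t. ?D t (x - a))"
    by (simp add: integral_unique)
  also have "\<dots> = integral {0..1} (\<lambda>t. \<Sum>i\<in>Basis. ((x - a) \<bullet> i) *\<^sub>R ?D t i)"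
    by (intro integral_cong linear_basis_expand[OF lin])
  also have "\<dots> = (\<Sum>i\<in>Basis. ((x - a) \<bullet> i) * h i x)"
    unfolding h_def using int by (subst integral_sum) (auto intro: integrable_on_mult_right)
  finally show "f x = f a + (\<Sum>i\<in>Basis. ((x - a) \<bullet> i) * h i x)" by simp
qed

subsection \<open>A smooth cut-off function\<close>

text \<open>The classical flat function \<open>exp (- 1 / t)\<close>.  Allowing the factors \<open>t\<close> to the power \<open>- m\<close> gives a family that is
  closed under differentiation.\<close>

definition flat :: "nat \<Rightarrow> real \<Rightarrow> real" where
  "flat m t = (if t > 0 then inverse t ^ m * exp (- inverse t) else 0)"

lemma tendsto_flat_0: "(flat m \<longlongrightarrow> 0) (at 0)"
proof (subst filterlim_at_split, safe)
  show "(flat m \<longlongrightarrow> 0) (at_left 0)"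
    by (rule tendsto_eventually) (auto simp: flat_def eventually_at_filter)
  have "((\<lambda>t. inverse t ^ m / exp (inverse t)) \<longlongrightarrow> (0::real)) (at_right 0)"
    by (rule filterlim_compose[OF tendsto_power_div_exp_0 filterlim_inverse_at_top_right])
  then show "(flat m \<longlongrightarrow> 0) (at_right 0)"
    by (rule tendsto_cong[THEN iffD1, rotated])
      (auto simp: flat_def eventually_at_filter exp_minus divide_inverse)
qed

lemma flat_deriv: "(flat m has_real_derivative flat (m + 2) t - real m * flat (m + 1) t) (at t)"
proof (cases "t = 0")
  case True
  \<comment> \<open>the difference quotient of \<open>flat m\<close> at \<open>0\<close> is \<open>flat (m + 1)\<close>\<close>
  have "((\<lambda>h. (flat m (0 + h) - flat m 0) / h) \<longlongrightarrow> 0) (at 0)"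
    by (rule tendsto_cong[THEN iffD1, OF _ tendsto_flat_0[of "Suc m"]])
      (auto simp: flat_def eventually_at_filter field_simps)
  then show ?thesis using True by (simp add: DERIV_def flat_def)
next
  case False
  show ?thesis
  proof (cases "t > 0")
    case True
    have "((\<lambda>t. inverse t ^ m * exp (- inverse t)) has_real_derivative
        (real m * (- (inverse t * inverse t) * inverse t ^ (m - Suc 0))) * exp (- inverse t) +
        (exp (- inverse t) * (inverse t * inverse t)) * inverse t ^ m) (at t)"
      using True by (intro DERIV_mult DERIV_power) (auto intro!: derivative_eq_intros)
    moreover have "real m * (- (inverse t * inverse t) * inverse t ^ (m - Suc 0)) = - (real m * inverse t ^ (m + 1))"
      by (cases m) auto
    moreover have "- (real m * inverse t ^ (m + 1)) * exp (- inverse t) +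
        (exp (- inverse t) * (inverse t * inverse t)) * inverse t ^ m = flat (m + 2) t - real m * flat (m + 1) t"
      using True by (simp add: flat_def)
    ultimately have "((\<lambda>t. inverse t ^ m * exp (- inverse t)) has_real_derivative
        flat (m + 2) t - real m * flat (m + 1) t) (at t)"
      by (simp only:)
    then show ?thesis
      by (rule DERIV_cong_ev[OF refl _ refl, THEN iffD1, rotated])
        (rule eventually_mono[OF eventually_nhds_in_open[of "{0<..}"]], use True in \<open>auto simp: flat_def\<close>)
  next
    case f2: False
    have "((\<lambda>t. 0) has_real_derivative flat (m + 2) t - real m * flat (m + 1) t) (at t)"
      using f2 by (simp add: flat_def)
    then show ?thesis
      by (rule DERIV_cong_ev[OF refl _ refl, THEN iffD1, rotated])
        (rule eventually_mono[OF eventually_nhds_in_open[of "{..<0}"]],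
          use f2 False in \<open>auto simp: flat_def\<close>)
  qed
qed

lemma smooth_on_flat: "smooth_on UNIV (flat m)"
proof -
  have "Ck_on k (flat m) UNIV" for k
  proof (induction k arbitrary: m)
    case 0
    have "isCont (flat m) t" for t using flat_deriv by (rule DERIV_isCont)
    then show ?case by (simp add: continuous_at_imp_continuous_on)
  next
    case (Suc k)
    have "Ck_on k (\<lambda>t. (flat (m + 2) t + (- real m) * flat (m + 1) t) * v) UNIV" for v
      by (intro Ck_on_bilinear[OF _ bounded_bilinear_mult] Ck_on_add Ck_on_const open_UNIV Suc)
    then show ?case
      by (intro Ck_on_SucI[where f' = "\<lambda>t v. (flat (m + 2) t - real m * flat (m + 1) t) * v"])
        (use flat_deriv in \<open>auto simp: has_field_derivative_def\<close>)
  qed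
  then show ?thesis by (simp add: smooth_on_def)
qed

lemma smooth_bump:
  fixes a :: "'a::euclidean_space"
  assumes "0 < r"
  obtains b :: "'a \<Rightarrow> real" where "smooth_on UNIV b" "b a \<noteq> 0" "\<And>x. x \<notin> cball a r \<Longrightarrow> b x = 0"
proof
  let ?b = "\<lambda>x. flat 0 (r\<^sup>2 + - ((x - a) \<bullet> (x - a)))"
  have id: "smooth_on UNIV (\<lambda>x. x + - a)"
    by (intro smooth_on_add smooth_on_const smooth_on_linear bounded_linear_ident) auto
  have sq: "smooth_on UNIV (\<lambda>x. r\<^sup>2 + (- 1) * ((x + - a) \<bullet> (x + - a)))"
    by (intro smooth_on_add smooth_on_mult smooth_on_const smooth_on_bilinear[OF _ bounded_bilinear_inner] id) auto
  show "smooth_on UNIV ?b"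
    using smooth_on_compose[OF open_UNIV open_UNIV _ sq smooth_on_flat[of 0]] by simp
  show "?b a \<noteq> 0" using assms by (simp add: flat_def)
  fix x assume "x \<notin> cball a r"
  then have "r \<le> norm (x - a)" by (simp add: dist_norm norm_minus_commute)
  then have "r\<^sup>2 \<le> (norm (x - a))\<^sup>2" using assms by (intro power_mono) auto
  then show "?b x = 0" by (simp add: flat_def power2_norm_eq_inner)
qed

section \<open>Functions and tangent vectors in charts\<close>

lemma tvec_components_inner: "j \<in> Basis \<Longrightarrow> tvec_components \<phi> v \<bullet> j = v (\<lambda>q. \<phi> q \<bullet> j)"
  unfolding tvec_components_def by (simp add: inner_sum_left_Basis)

lemma tvec_components_plus: "tvec_components \<phi> (v + w) = tvec_components \<phi> v + tvec_components \<phi> w"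
  by (rule euclidean_eqI) (simp add: tvec_components_inner inner_add_left)

lemma tvec_components_scal: "tvec_components \<phi> (scal a v) = a *\<^sub>R tvec_components \<phi> v"
  by (rule euclidean_eqI) (simp add: tvec_components_inner scal_def)

lemma tvec_components_0: "tvec_components \<phi> 0 = 0"
  by (rule euclidean_eqI) (simp add: tvec_components_inner)

text \<open>The tangent vector at \<open>p\<close> with coordinates \<open>w\<close> in the chart \<open>\<phi>\<close>, that is, the inverse of
  \<open>tvec_components \<phi>\<close> on the tangent space.\<close>

definition coord_vec :: "('a, 'e::euclidean_space) atlas \<Rightarrow> 'a set \<Rightarrow> ('a \<Rightarrow> 'e) \<Rightarrow> 'a \<Rightarrow> 'e \<Rightarrow> 'a tvec" where
  "coord_vec A U \<phi> p w = (\<lambda>f. if smooth_at A p f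
     then frechet_derivative (f \<circ> inv_into U \<phi>) (at (\<phi> p)) w else 0)"

locale atlas =
  fixes A :: "('a, 'e::euclidean_space) atlas"
  assumes atlas: "smooth_atlas A"
begin

lemma chart_inj: "(U, \<phi>) \<in> A \<Longrightarrow> inj_on \<phi> U"
  and chart_open: "(U, \<phi>) \<in> A \<Longrightarrow> open (\<phi> ` U)"
  using atlas unfolding smooth_atlas_def by blast+

lemma overlap_open: "(U, \<phi>) \<in> A \<Longrightarrow> (V, \<psi>) \<in> A \<Longrightarrow> open (\<phi> ` (U \<inter> V))"
  and transition_smooth: "(U, \<phi>) \<in> A \<Longrightarrow> (V, \<psi>) \<in> A \<Longrightarrow> smooth_on (\<phi> ` (U \<inter> V)) (\<psi> \<circ> inv_into U \<phi>)"
  using atlas unfolding smooth_atlas_def by blast+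

lemma chart_inv: "(U, \<phi>) \<in> A \<Longrightarrow> p \<in> U \<Longrightarrow> inv_into U \<phi> (\<phi> p) = p"
  using chart_inj by (rule inv_into_f_f)

lemma inv_in_chart: "x \<in> \<phi> ` U \<Longrightarrow> inv_into U \<phi> x \<in> U"
  by (rule inv_into_into)

lemma chart_of_inv: "x \<in> \<phi> ` U \<Longrightarrow> \<phi> (inv_into U \<phi> x) = x"
  by (rule f_inv_into_f)

lemma chart_subset_carrier: "(U, \<phi>) \<in> A \<Longrightarrow> U \<subseteq> carrier A"
  unfolding carrier_def by force

lemma carrier_chart: "p \<in> carrier A \<Longrightarrow> \<exists>U \<phi>. (U, \<phi>) \<in> A \<and> p \<in> U"
  unfolding carrier_def by force

lemma openin_iff: "openin (manifold_topology A) W \<longleftrightarrow>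
    W \<subseteq> carrier A \<and> (\<forall>(U, \<phi>)\<in>A. open (\<phi> ` (U \<inter> W)))"
proof -
  have "istopology (\<lambda>W. W \<subseteq> carrier A \<and> (\<forall>(U, \<phi>)\<in>A. open (\<phi> ` (U \<inter> W))))"
    unfolding istopology_def
  proof (intro conjI allI impI)
    fix S T assume S: "S \<subseteq> carrier A \<and> (\<forall>(U, \<phi>)\<in>A. open (\<phi> ` (U \<inter> S)))"
      and T: "T \<subseteq> carrier A \<and> (\<forall>(U, \<phi>)\<in>A. open (\<phi> ` (U \<inter> T)))"
    show "S \<inter> T \<subseteq> carrier A" using S by blast
    show "\<forall>(U, \<phi>)\<in>A. open (\<phi> ` (U \<inter> (S \<inter> T)))"
    proof clarify
      fix U \<phi> assume c: "(U, \<phi>) \<in> A"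
      \<comment> \<open>images commute with intersections because charts are injective\<close>
      have "\<phi> ` (U \<inter> (S \<inter> T)) = \<phi> ` (U \<inter> S) \<inter> \<phi> ` (U \<inter> T)"
        using chart_inj[OF c] unfolding inj_on_def by blast
      moreover have "open (\<phi> ` (U \<inter> S))" "open (\<phi> ` (U \<inter> T))" using S T c by blast+
      ultimately show "open (\<phi> ` (U \<inter> (S \<inter> T)))" by (simp add: open_Int)
    qed
  next
    fix K assume K: "\<forall>S\<in>K. S \<subseteq> carrier A \<and> (\<forall>(U, \<phi>)\<in>A. open (\<phi> ` (U \<inter> S)))"
    show "\<Union>K \<subseteq> carrier A" using K by blast
    show "\<forall>(U, \<phi>)\<in>A. open (\<phi> ` (U \<inter> \<Union>K))"
    proof clarify
      fix U \<phi> assume c: "(U, \<phi>) \<in> A"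
      have "\<phi> ` (U \<inter> \<Union>K) = (\<Union>S\<in>K. \<phi> ` (U \<inter> S))" by blast
      moreover have "\<forall>S\<in>K. open (\<phi> ` (U \<inter> S))" using K c by blast
      ultimately show "open (\<phi> ` (U \<inter> \<Union>K))" by (simp add: open_UN)
    qed
  qed
  then show ?thesis unfolding manifold_topology_def by (simp add: topology_inverse')
qed

lemma openin_chart: "(U, \<phi>) \<in> A \<Longrightarrow> openin (manifold_topology A) U"
  unfolding openin_iff using chart_subset_carrier overlap_open by blast

lemma openin_overlap: "(U, \<phi>) \<in> A \<Longrightarrow> (V, \<psi>) \<in> A \<Longrightarrow> openin (manifold_topology A) (U \<inter> V)"
  by (intro openin_Int openin_chart)

lemma openin_chart_image: "openin (manifold_topology A) W \<Longrightarrow> (U, \<phi>) \<in> A \<Longrightarrow> open (\<phi> ` (U \<inter> W))"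
  unfolding openin_iff by blast

lemma openin_inv_image:
  assumes c: "(U, \<phi>) \<in> A" and N: "open N" "N \<subseteq> \<phi> ` U"
  shows "openin (manifold_topology A) (inv_into U \<phi> ` N)"
  unfolding openin_iff
proof (intro conjI ballI)
  show "inv_into U \<phi> ` N \<subseteq> carrier A"
    using chart_subset_carrier[OF c] N(2) by (auto intro!: inv_in_chart[THEN subsetD[rotated]])
  fix Q assume "Q \<in> A"
  then obtain V \<psi> where Q: "Q = (V, \<psi>)" "(V, \<psi>) \<in> A" by (cases Q) auto
  have cont: "continuous_on (\<psi> ` (V \<inter> U)) (\<phi> \<circ> inv_into V \<psi>)"
    using transition_smooth[OF Q(2) c] Ck_on_continuous unfolding smooth_on_def by blast
  have "\<psi> ` (V \<inter> inv_into U \<phi> ` N) = (\<phi> \<circ> inv_into V \<psi>) -` N \<inter> \<psi> ` (V \<inter> U)" (is "?l = ?r")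
  proof
    show "?l \<subseteq> ?r"
    proof
      fix y assume "y \<in> ?l"
      then obtain x where x: "x \<in> N" "inv_into U \<phi> x \<in> V" "y = \<psi> (inv_into U \<phi> x)" by blast
      have "x \<in> \<phi> ` U" using x(1) N(2) by blast
      then have "\<phi> (inv_into U \<phi> x) = x" "inv_into U \<phi> x \<in> U" by (rule chart_of_inv, rule inv_in_chart)
      then show "y \<in> ?r" using x chart_inv[OF Q(2) x(2)] by auto
    qed
    show "?r \<subseteq> ?l"
    proof
      fix y assume y: "y \<in> ?r"
      then obtain q where q: "q \<in> V" "q \<in> U" "y = \<psi> q" by blast
      then have "\<phi> q \<in> N" using y chart_inv[OF Q(2)] by simp
      then have "q \<in> inv_into U \<phi> ` N" using chart_inv[OF c q(2)] by (metis imageI)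
      then show "y \<in> ?l" using q by blast
    qed
  qed
  moreover have "open \<dots>"
    using continuous_open_preimage[OF cont overlap_open[OF Q(2) c] N(1)] by (simp add: Int_commute)
  ultimately show "case Q of (V, \<psi>) \<Rightarrow> open (\<psi> ` (V \<inter> inv_into U \<phi> ` N))" using Q by simp
qed

subsection \<open>Smooth germs\<close>

lemma smooth_at_carrier: "smooth_at A p f \<Longrightarrow> p \<in> carrier A"
  unfolding smooth_at_def openin_iff by blast

lemma smooth_at_rep:
  assumes c: "(U, \<phi>) \<in> A" "p \<in> U" and "smooth_at A p f"
  obtains N where "open N" "\<phi> p \<in> N" "N \<subseteq> \<phi> ` U" "smooth_on N (f \<circ> inv_into U \<phi>)"
proof -
  obtain W where W: "openin (manifold_topology A) W" "p \<in> W" "smooth_fun A W f"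
    using assms(3) unfolding smooth_at_def by blast
  show ?thesis
    by (rule that[of "\<phi> ` (U \<inter> W)"])
      (use W c openin_chart_image[OF W(1) c(1)] in \<open>auto simp: smooth_fun_def\<close>)
qed

text \<open>One chart suffices to establish smoothness, because the transition maps are smooth.\<close>

lemma smooth_at_of_rep:
  assumes c: "(U, \<phi>) \<in> A" "p \<in> U" and N: "open N" "\<phi> p \<in> N" "N \<subseteq> \<phi> ` U"
    and h: "smooth_on N h" and eq: "\<And>q. q \<in> U \<Longrightarrow> \<phi> q \<in> N \<Longrightarrow> f q = h (\<phi> q)"
  shows "smooth_at A p f"
  unfolding smooth_at_def
proof (intro exI conjI)
  let ?W = "inv_into U \<phi> ` N"
  show W: "openin (manifold_topology A) ?W" using openin_inv_image c N by blast
  show "p \<in> ?W" using N(2) chart_inv[OF c] by (metis imageI)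
  have WU: "q \<in> U \<and> \<phi> q \<in> N" if "q \<in> ?W" for q
  proof -
    obtain x where x: "x \<in> N" "q = inv_into U \<phi> x" using \<open>q \<in> ?W\<close> by blast
    have "x \<in> \<phi> ` U" using x(1) N(3) by blast
    then have "\<phi> (inv_into U \<phi> x) = x" "inv_into U \<phi> x \<in> U" by (rule chart_of_inv, rule inv_in_chart)
    then show ?thesis using x by simp
  qed
  show "smooth_fun A ?W f" unfolding smooth_fun_def
  proof clarify
    fix V \<psi> assume d: "(V, \<psi>) \<in> A"
    have op: "open (\<psi> ` (V \<inter> ?W))" using openin_chart_image[OF W d] .
    show "smooth_on (\<psi> ` (V \<inter> ?W)) (f \<circ> inv_into V \<psi>)"
    proof (rule smooth_on_cong[OF op])
      show "smooth_on (\<psi> ` (V \<inter> ?W)) (\<lambda>x. h ((\<phi> \<circ> inv_into V \<psi>) x))"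
      proof (rule smooth_on_compose[OF op N(1) _ _ h])
        show "(\<phi> \<circ> inv_into V \<psi>) ` (\<psi> ` (V \<inter> ?W)) \<subseteq> N"
          using WU chart_inv[OF d] by auto
        show "smooth_on (\<psi> ` (V \<inter> ?W)) (\<phi> \<circ> inv_into V \<psi>)"
          by (rule smooth_on_subset[OF transition_smooth[OF d c(1)]]) (use WU in auto)
      qed
      fix x assume "x \<in> \<psi> ` (V \<inter> ?W)"
      then obtain q where q: "q \<in> V" "q \<in> ?W" "x = \<psi> q" by blast
      then show "h ((\<phi> \<circ> inv_into V \<psi>) x) = (f \<circ> inv_into V \<psi>) x"
        using WU[OF q(2)] eq[of q] chart_inv[OF d q(1)] by simp
    qed
  qed
qed

lemma smooth_at_nbhd:
  assumes "smooth_at A p f"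
  obtains W where "openin (manifold_topology A) W" "p \<in> W" "\<And>q. q \<in> W \<Longrightarrow> smooth_at A q f"
  using assms unfolding smooth_at_def by blast

lemma smooth_on_of_smooth_at:
  assumes c: "(U, \<phi>) \<in> A" and "W \<subseteq> U" "\<And>q. q \<in> W \<Longrightarrow> smooth_at A q f"
  shows "smooth_on (\<phi> ` W) (f \<circ> inv_into U \<phi>)"
proof (rule smooth_on_local)
  fix x assume "x \<in> \<phi> ` W"
  then obtain q where "q \<in> W" "x = \<phi> q" by blast
  then obtain N where "open N" "x \<in> N" "smooth_on N (f \<circ> inv_into U \<phi>)"
    using smooth_at_rep[OF c subsetD[OF assms(2)] assms(3)] by metis
  then show "\<exists>T. open T \<and> x \<in> T \<and> smooth_on T (f \<circ> inv_into U \<phi>)" by blast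
qed

lemma smooth_fun_iff:
  assumes "openin (manifold_topology A) W"
  shows "smooth_fun A W f \<longleftrightarrow> (\<forall>p\<in>W. smooth_at A p f)"
proof
  show "smooth_fun A W f \<Longrightarrow> \<forall>p\<in>W. smooth_at A p f" using assms unfolding smooth_at_def by blast
  assume "\<forall>p\<in>W. smooth_at A p f"
  then show "smooth_fun A W f" unfolding smooth_fun_def
    by (auto intro!: smooth_on_of_smooth_at)
qed

lemma openin_carrier: "openin (manifold_topology A) (carrier A)"
proof -
  have "carrier A = \<Union>(fst ` A)" by (simp add: carrier_def)
  then show ?thesis using openin_Union[of "fst ` A" "manifold_topology A"] openin_chart by auto
qed

lemma topspace_eq: "topspace (manifold_topology A) = carrier A"
  using openin_carrier openin_iff by (metis openin_subset openin_topspace subset_antisym)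

lemma smooth_fun_carrier: "smooth_fun A (carrier A) f \<longleftrightarrow> (\<forall>p\<in>carrier A. smooth_at A p f)"
  by (rule smooth_fun_iff[OF openin_carrier])

lemma smooth_at_const: "p \<in> carrier A \<Longrightarrow> smooth_at A p (\<lambda>q. c)"
proof -
  assume "p \<in> carrier A"
  then obtain U \<phi> where c: "(U, \<phi>) \<in> A" "p \<in> U" using carrier_chart by blast
  show ?thesis
    by (rule smooth_at_of_rep[OF c chart_open[OF c(1)] _ _ smooth_on_const[OF chart_open[OF c(1)]]])
      (use c in auto)
qed

lemma smooth_at_binop:
  assumes op: "\<And>S F G. open S \<Longrightarrow> smooth_on S F \<Longrightarrow> smooth_on S G \<Longrightarrow> smooth_on S (\<lambda>x::'e. b (F x) (G x))"
    and "smooth_at A p f" "smooth_at A p g"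
  shows "smooth_at A p (\<lambda>q. b (f q) (g q))"
proof -
  obtain U \<phi> where c: "(U, \<phi>) \<in> A" "p \<in> U" using carrier_chart smooth_at_carrier[OF assms(2)] by blast
  obtain N1 where N1: "open N1" "\<phi> p \<in> N1" "N1 \<subseteq> \<phi> ` U" "smooth_on N1 (f \<circ> inv_into U \<phi>)"
    using smooth_at_rep[OF c assms(2)] .
  obtain N2 where N2: "open N2" "\<phi> p \<in> N2" "N2 \<subseteq> \<phi> ` U" "smooth_on N2 (g \<circ> inv_into U \<phi>)"
    using smooth_at_rep[OF c assms(3)] .
  have "smooth_on (N1 \<inter> N2) (\<lambda>x. b ((f \<circ> inv_into U \<phi>) x) ((g \<circ> inv_into U \<phi>) x))"
    by (intro op open_Int N1 N2 smooth_on_subset[OF N1(4)] smooth_on_subset[OF N2(4)]) auto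
  then show ?thesis
    by (rule smooth_at_of_rep[OF c, rotated 3]) (use N1 N2 chart_inv[OF c(1)] in auto)
qed

lemma smooth_at_add: "smooth_at A p f \<Longrightarrow> smooth_at A p g \<Longrightarrow> smooth_at A p (\<lambda>q. f q + g q)"
  by (rule smooth_at_binop[where b = "(+)"]) (rule smooth_on_add)

lemma smooth_at_mult: "smooth_at A p f \<Longrightarrow> smooth_at A p g \<Longrightarrow> smooth_at A p (\<lambda>q. f q * g q)"
  by (rule smooth_at_binop[where b = "(*)"]) (rule smooth_on_mult)

lemma smooth_at_cmult: "smooth_at A p f \<Longrightarrow> smooth_at A p (\<lambda>q. c * f q)"
  using smooth_at_mult[OF smooth_at_const] smooth_at_carrier by blast

lemma smooth_at_diff: "smooth_at A p f \<Longrightarrow> smooth_at A p g \<Longrightarrow> smooth_at A p (\<lambda>q. f q - g q)"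
  using smooth_at_add[of p f "\<lambda>q. (-1) * g q"] smooth_at_cmult[of p g "-1"] by simp

lemma smooth_at_sum:
  assumes p: "p \<in> carrier A"
  shows "finite I \<Longrightarrow> (\<And>i. i \<in> I \<Longrightarrow> smooth_at A p (f i)) \<Longrightarrow> smooth_at A p (\<lambda>q. \<Sum>i\<in>I. f i q)"
proof (induction I rule: finite_induct)
  case empty
  then show ?case using smooth_at_const[OF p] by simp
next
  case (insert i I)
  then show ?case using smooth_at_add[of p "f i"] by simp
qed

lemma smooth_at_cong:
  assumes W: "openin (manifold_topology A) W" "p \<in> W" "\<And>q. q \<in> W \<Longrightarrow> f q = g q"
    and f: "smooth_at A p f"
  shows "smooth_at A p g"
proof -
  obtain U \<phi> where c: "(U, \<phi>) \<in> A" "p \<in> U" using carrier_chart smooth_at_carrier[OF f] by blast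
  obtain N where N: "open N" "\<phi> p \<in> N" "N \<subseteq> \<phi> ` U" "smooth_on N (f \<circ> inv_into U \<phi>)"
    using smooth_at_rep[OF c f] .
  let ?N = "N \<inter> \<phi> ` (U \<inter> W)"
  show ?thesis
  proof (rule smooth_at_of_rep[OF c])
    show "open ?N" using N openin_chart_image[OF W(1) c(1)] by blast
    show "smooth_on ?N (f \<circ> inv_into U \<phi>)" using smooth_on_subset[OF N(4)] by blast
    fix q assume q: "q \<in> U" "\<phi> q \<in> ?N"
    then have "q \<in> W" using chart_inj[OF c(1)] unfolding inj_on_def by blast
    then show "g q = (f \<circ> inv_into U \<phi>) (\<phi> q)" using W(3) chart_inv[OF c(1) q(1)] by simp
  qed (use N W c in auto)
qed

lemma smooth_at_chart_comp:
  assumes c: "(U, \<phi>) \<in> A" "p \<in> U" and N: "open N" "\<phi> p \<in> N" and h: "smooth_on N h"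
  shows "smooth_at A p (\<lambda>q. h (\<phi> q))"
proof (rule smooth_at_of_rep[OF c])
  show "open (N \<inter> \<phi> ` U)" using N chart_open[OF c(1)] by blast
  show "smooth_on (N \<inter> \<phi> ` U) h" using smooth_on_subset[OF h] by blast
qed (use N c in auto)

lemma smooth_at_coord: "(U, \<phi>) \<in> A \<Longrightarrow> p \<in> U \<Longrightarrow> smooth_at A p (\<lambda>q. \<phi> q \<bullet> i)"
  by (rule smooth_at_chart_comp[where N = UNIV and h = "\<lambda>x. x \<bullet> i"])
    (auto intro: smooth_on_linear bounded_linear_inner_left)

subsection \<open>Tangent vectors\<close>

lemma
  assumes "v \<in> tangent_space A p"
  shows tangent_space_lin: "\<forall>f g a b. smooth_at A p f \<and> smooth_at A p g \<longrightarrow>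
      v (\<lambda>q. a * f q + b * g q) = a * v f + b * v g"
    and tangent_space_mult: "\<forall>f g. smooth_at A p f \<and> smooth_at A p g \<longrightarrow>
      v (\<lambda>q. f q * g q) = v f * g p + f p * v g"
    and tangent_space_local: "\<forall>f g W. smooth_at A p f \<and> smooth_at A p g \<and>
      openin (manifold_topology A) W \<and> p \<in> W \<and> (\<forall>q\<in>W. f q = g q) \<longrightarrow> v f = v g"
    and tangent_space_notsmooth: "\<forall>f. \<not> smooth_at A p f \<longrightarrow> v f = 0"
  using assms unfolding tangent_space_def mem_Collect_eq by - ((elim conjE, assumption)+)

lemma tv_lin:
  "v \<in> tangent_space A p \<Longrightarrow> smooth_at A p f \<Longrightarrow> smooth_at A p g \<Longrightarrow>
    v (\<lambda>q. a * f q + b * g q) = a * v f + b * v g"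
  using tangent_space_lin by simp

lemma tv_mult:
  "v \<in> tangent_space A p \<Longrightarrow> smooth_at A p f \<Longrightarrow> smooth_at A p g \<Longrightarrow>
    v (\<lambda>q. f q * g q) = v f * g p + f p * v g"
  using tangent_space_mult by simp

lemma tv_notsmooth: "v \<in> tangent_space A p \<Longrightarrow> \<not> smooth_at A p f \<Longrightarrow> v f = 0"
  using tangent_space_notsmooth by simp

lemma tv_cong:
  assumes v: "v \<in> tangent_space A p"
    and W: "openin (manifold_topology A) W" "p \<in> W" "\<And>q. q \<in> W \<Longrightarrow> f q = g q"
  shows "v f = v g"
proof (cases "smooth_at A p f")
  case True
  then have "smooth_at A p g" by (rule smooth_at_cong[OF W, rotated])
  then show ?thesis
    by (intro tangent_space_local[OF v, rule_format, of f g W] conjI True W ballI)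
next
  case False
  moreover have "smooth_at A p f" if "smooth_at A p g"
    by (rule smooth_at_cong[OF W(1,2) _ that]) (simp add: W(3))
  ultimately have "\<not> smooth_at A p g" by blast
  then show ?thesis using False tv_notsmooth[OF v] by metis
qed

lemma tv_cong_carrier:
  "v \<in> tangent_space A p \<Longrightarrow> p \<in> carrier A \<Longrightarrow> (\<And>q. q \<in> carrier A \<Longrightarrow> f q = g q) \<Longrightarrow> v f = v g"
  using tv_cong[OF _ openin_carrier] by blast

lemma tv_add:
  "v \<in> tangent_space A p \<Longrightarrow> smooth_at A p f \<Longrightarrow> smooth_at A p g \<Longrightarrow> v (\<lambda>q. f q + g q) = v f + v g"
  using tv_lin[of v p f g 1 1] by simp

lemma tv_diff:
  "v \<in> tangent_space A p \<Longrightarrow> smooth_at A p f \<Longrightarrow> smooth_at A p g \<Longrightarrow> v (\<lambda>q. f q - g q) = v f - v g"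
  using tv_lin[of v p f g 1 "-1"] by simp

lemma tv_const: assumes v: "v \<in> tangent_space A p" shows "v (\<lambda>q. c) = 0"
proof (cases "p \<in> carrier A")
  case True
  have "v (\<lambda>q. 1) = 0" using tv_mult[OF v smooth_at_const smooth_at_const, of 1 1] True by simp
  then show ?thesis
    using tv_lin[where f = "\<lambda>q. 1" and g = "\<lambda>q. 1" and a = c and b = 0, OF v smooth_at_const smooth_at_const] True
    by simp
next
  case False
  then show ?thesis using smooth_at_carrier tv_notsmooth[OF v] by blast
qed

lemma tv_cmult:
  "v \<in> tangent_space A p \<Longrightarrow> smooth_at A p f \<Longrightarrow> v (\<lambda>q. c * f q) = c * v f"
  using tv_lin[of v p f f c 0] by simp

lemma tv_sum:
  assumes v: "v \<in> tangent_space A p" and p: "p \<in> carrier A"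
  shows "finite I \<Longrightarrow> (\<And>i. i \<in> I \<Longrightarrow> smooth_at A p (f i)) \<Longrightarrow> v (\<lambda>q. \<Sum>i\<in>I. f i q) = (\<Sum>i\<in>I. v (f i))"
proof (induction I rule: finite_induct)
  case empty
  then show ?case using tv_const[OF v] by simp
next
  case (insert i I)
  then show ?case using tv_add[OF v, of "f i" "\<lambda>q. \<Sum>i\<in>I. f i q"] smooth_at_sum[OF p, of I f] by simp
qed

lemma zero_tangent: "0 \<in> tangent_space A p"
  unfolding tangent_space_def by auto

lemma tangent_lincomb:
  assumes "v \<in> tangent_space A p" "w \<in> tangent_space A p"
  shows "scal a v + w \<in> tangent_space A p"
  unfolding tangent_space_def
proof (intro CollectI conjI allI impI)
  fix f g c d assume "smooth_at A p f \<and> smooth_at A p g"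
  then show "(scal a v + w) (\<lambda>q. c * f q + d * g q) = c * (scal a v + w) f + d * (scal a v + w) g"
    using assms by (simp add: scal_def tv_lin algebra_simps)
next
  fix f g assume "smooth_at A p f \<and> smooth_at A p g"
  then show "(scal a v + w) (\<lambda>q. f q * g q) = (scal a v + w) f * g p + f p * (scal a v + w) g"
    using assms by (simp add: scal_def tv_mult algebra_simps)
next
  fix f g W assume "smooth_at A p f \<and> smooth_at A p g \<and> openin (manifold_topology A) W \<and> p \<in> W \<and>
    (\<forall>q\<in>W. f q = g q)"
  then have "v f = v g" "w f = w g"
    using tangent_space_local[OF assms(1), rule_format, of f g W]
      tangent_space_local[OF assms(2), rule_format, of f g W] by simp_all
  then show "(scal a v + w) f = (scal a v + w) g" by (simp add: scal_def)
next
  fix f assume "\<not> smooth_at A p f"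
  then show "(scal a v + w) f = 0" using assms by (simp add: scal_def tv_notsmooth)
qed

lemma tangent_add: "v \<in> tangent_space A p \<Longrightarrow> w \<in> tangent_space A p \<Longrightarrow> v + w \<in> tangent_space A p"
  using tangent_lincomb[of v p w 1] by (simp add: scal_def)

lemma tangent_scal: "v \<in> tangent_space A p \<Longrightarrow> scal a v \<in> tangent_space A p"
  using tangent_lincomb[OF _ zero_tangent, of v p a] by simp

lemma tangent_diff: "v \<in> tangent_space A p \<Longrightarrow> w \<in> tangent_space A p \<Longrightarrow> v - w \<in> tangent_space A p"
  using tangent_lincomb[of w p v "-1"] by (simp add: scal_def fun_diff_def plus_fun_def)

text \<open>By the Hadamard lemma, \<open>f\<close> agrees near \<open>p\<close> with a constant plus the sum of the products of the coordinate
  functions, centred at \<open>p\<close>, with smooth functions \<open>h i\<close> of the coordinates.  By the product rule a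
  derivation at \<open>p\<close> only sees the values \<open>h i (\<phi> p)\<close>, which are the partial derivatives of \<open>f\<close>.\<close>

lemma tv_chart:
  assumes c: "(U, \<phi>) \<in> A" "p \<in> U" and v: "v \<in> tangent_space A p" and f: "smooth_at A p f"
  shows "v f = frechet_derivative (f \<circ> inv_into U \<phi>) (at (\<phi> p)) (tvec_components \<phi> v)"
proof -
  obtain N where N: "open N" "\<phi> p \<in> N" "N \<subseteq> \<phi> ` U" "smooth_on N (f \<circ> inv_into U \<phi>)"
    using smooth_at_rep[OF c f] .
  let ?F = "f \<circ> inv_into U \<phi>"
  obtain r where r: "r > 0" "ball (\<phi> p) r \<subseteq> N" using N open_contains_ball by metis
  obtain h where h: "\<And>i. smooth_on (ball (\<phi> p) r) (h i)"
    "\<And>x. x \<in> ball (\<phi> p) r \<Longrightarrow> ?F x = ?F (\<phi> p) + (\<Sum>i\<in>Basis. ((x - \<phi> p) \<bullet> i) * h i x)"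
    "\<And>i. 0 < r \<Longrightarrow> h i (\<phi> p) = frechet_derivative ?F (at (\<phi> p)) i"
    by (rule Hadamard_lemma[OF smooth_on_subset[OF N(4) r(2)]], rule that)
  have p: "p \<in> carrier A" using smooth_at_carrier[OF f] .
  have sh: "smooth_at A p (\<lambda>q. h i (\<phi> q))" for i
    by (rule smooth_at_chart_comp[OF c open_ball _ h(1)]) (use r in auto)
  have sc: "smooth_at A p (\<lambda>q. \<phi> q \<bullet> i - \<phi> p \<bullet> i)" for i
    by (intro smooth_at_diff smooth_at_coord[OF c] smooth_at_const p)
  have vc: "v (\<lambda>q. \<phi> q \<bullet> i - \<phi> p \<bullet> i) = v (\<lambda>q. \<phi> q \<bullet> i)" for i
    using tv_diff[OF v smooth_at_coord[OF c] smooth_at_const[OF p]] tv_const[OF v] by simp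
  have "v f = v (\<lambda>q. f p + (\<Sum>i\<in>Basis. (\<phi> q \<bullet> i - \<phi> p \<bullet> i) * h i (\<phi> q)))"
  proof (rule tv_cong[OF v])
    have rU: "ball (\<phi> p) r \<subseteq> \<phi> ` U" using r N by blast
    show "openin (manifold_topology A) (inv_into U \<phi> ` ball (\<phi> p) r)"
      by (rule openin_inv_image[OF c(1) open_ball rU])
    show "p \<in> inv_into U \<phi> ` ball (\<phi> p) r"
      using chart_inv[OF c] r(1) by (metis centre_in_ball imageI)
    fix q assume "q \<in> inv_into U \<phi> ` ball (\<phi> p) r"
    then obtain x where x: "x \<in> ball (\<phi> p) r" "q = inv_into U \<phi> x" by blast
    then have "\<phi> q = x" using chart_of_inv[OF subsetD[OF rU x(1)]] by simp
    then show "f q = f p + (\<Sum>i\<in>Basis. (\<phi> q \<bullet> i - \<phi> p \<bullet> i) * h i (\<phi> q))"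
      using h(2)[OF x(1)] x chart_inv[OF c] by (simp add: inner_diff_left)
  qed
  also have "\<dots> = v (\<lambda>q. \<Sum>i\<in>Basis. (\<phi> q \<bullet> i - \<phi> p \<bullet> i) * h i (\<phi> q))"
    using tv_add[OF v smooth_at_const[OF p] smooth_at_sum[OF p finite_Basis smooth_at_mult[OF sc sh]]]
      tv_const[OF v] by simp
  also have "\<dots> = (\<Sum>i\<in>Basis. v (\<lambda>q. (\<phi> q \<bullet> i - \<phi> p \<bullet> i) * h i (\<phi> q)))"
    by (rule tv_sum[OF v p finite_Basis smooth_at_mult[OF sc sh]])
  also have "\<dots> = (\<Sum>i\<in>Basis. v (\<lambda>q. \<phi> q \<bullet> i) * h i (\<phi> p))"
    using tv_mult[OF v sc sh] vc by simp
  also have "\<dots> = (\<Sum>i\<in>Basis. (tvec_components \<phi> v \<bullet> i) *\<^sub>R frechet_derivative ?F (at (\<phi> p)) i)"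
    using h(3)[OF r(1)] by (simp add: tvec_components_inner)
  also have "\<dots> = frechet_derivative ?F (at (\<phi> p)) (tvec_components \<phi> v)"
    using linear_basis_expand[OF smooth_on_linear_frechet[OF N(4,2)]] by metis
  finally show ?thesis .
qed

lemma coord_vec_components:
  assumes c: "(U, \<phi>) \<in> A" "p \<in> U" and v: "v \<in> tangent_space A p"
  shows "coord_vec A U \<phi> p (tvec_components \<phi> v) = v"
  using tv_chart[OF c v] tv_notsmooth[OF v] unfolding coord_vec_def by auto

lemma tvec_components_inject:
  "(U, \<phi>) \<in> A \<Longrightarrow> p \<in> U \<Longrightarrow> v \<in> tangent_space A p \<Longrightarrow> w \<in> tangent_space A p \<Longrightarrow>
    tvec_components \<phi> v = tvec_components \<phi> w \<Longrightarrow> v = w"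
  by (metis coord_vec_components)

lemma rep_has_derivative:
  assumes c: "(U, \<phi>) \<in> A" "p \<in> U" and f: "smooth_at A p f"
  shows "((f \<circ> inv_into U \<phi>) has_derivative frechet_derivative (f \<circ> inv_into U \<phi>) (at (\<phi> p))) (at (\<phi> p))"
  using smooth_at_rep[OF c f] smooth_on_has_derivative by metis

lemma coord_vec_tangent:
  assumes c: "(U, \<phi>) \<in> A" "p \<in> U"
  shows "coord_vec A U \<phi> p w \<in> tangent_space A p"
  unfolding tangent_space_def
proof (intro CollectI conjI allI impI)
  let ?i = "inv_into U \<phi>"
  note D = rep_has_derivative[OF c]
  fix f g assume fg: "smooth_at A p f \<and> smooth_at A p g"
  have ip: "?i (\<phi> p) = p" using chart_inv[OF c] .
  { fix a b
    have "((\<lambda>x. a * (f \<circ> ?i) x + b * (g \<circ> ?i) x) has_derivative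
      (\<lambda>w. a * frechet_derivative (f \<circ> ?i) (at (\<phi> p)) w + b * frechet_derivative (g \<circ> ?i) (at (\<phi> p)) w)) (at (\<phi> p))"
      using fg by (intro has_derivative_add has_derivative_mult_right D) auto
    moreover have "(\<lambda>x. a * (f \<circ> ?i) x + b * (g \<circ> ?i) x) = (\<lambda>q. a * f q + b * g q) \<circ> ?i" by auto
    moreover have "smooth_at A p (\<lambda>q. a * f q + b * g q)" using fg smooth_at_add smooth_at_cmult by blast
    ultimately show "coord_vec A U \<phi> p w (\<lambda>q. a * f q + b * g q)
        = a * coord_vec A U \<phi> p w f + b * coord_vec A U \<phi> p w g"
      using fg frechet_derivative_eqI unfolding coord_vec_def by fastforce }
  have "((\<lambda>x. (f \<circ> ?i) x * (g \<circ> ?i) x) has_derivative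
      (\<lambda>w. (f \<circ> ?i) (\<phi> p) * frechet_derivative (g \<circ> ?i) (at (\<phi> p)) w
         + frechet_derivative (f \<circ> ?i) (at (\<phi> p)) w * (g \<circ> ?i) (\<phi> p))) (at (\<phi> p))"
    using fg by (intro has_derivative_mult D) auto
  moreover have "(\<lambda>x. (f \<circ> ?i) x * (g \<circ> ?i) x) = (\<lambda>q. f q * g q) \<circ> ?i" by auto
  moreover have "smooth_at A p (\<lambda>q. f q * g q)" using fg smooth_at_mult by blast
  ultimately show "coord_vec A U \<phi> p w (\<lambda>q. f q * g q) = coord_vec A U \<phi> p w f * g p + f p * coord_vec A U \<phi> p w g"
    using fg frechet_derivative_eqI ip unfolding coord_vec_def by fastforce
next
  let ?i = "inv_into U \<phi>"
  fix f g W assume a: "smooth_at A p f \<and> smooth_at A p g \<and> openin (manifold_topology A) W \<and> p \<in> W \<and>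
    (\<forall>q\<in>W. f q = g q)"
  have "((g \<circ> ?i) has_derivative frechet_derivative (f \<circ> ?i) (at (\<phi> p))) (at (\<phi> p))"
  proof (rule has_derivative_transform_within_open[OF rep_has_derivative[OF c]])
    show "smooth_at A p f" using a by blast
    show "open (\<phi> ` (U \<inter> W))" using a openin_chart_image c by blast
    show "\<phi> p \<in> \<phi> ` (U \<inter> W)" using a c by blast
    fix x assume "x \<in> \<phi> ` (U \<inter> W)"
    then show "(f \<circ> ?i) x = (g \<circ> ?i) x" using a chart_inv[OF c(1)] by auto
  qed
  then show "coord_vec A U \<phi> p w f = coord_vec A U \<phi> p w g"
    using a frechet_derivative_eqI unfolding coord_vec_def by fastforce
next
  fix f assume "\<not> smooth_at A p f"
  then show "coord_vec A U \<phi> p w f = 0" unfolding coord_vec_def by simp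
qed

lemma components_coord_vec:
  assumes c: "(U, \<phi>) \<in> A" "p \<in> U"
  shows "tvec_components \<phi> (coord_vec A U \<phi> p w) = w"
proof (rule euclidean_eqI)
  fix i :: 'e assume i: "i \<in> Basis"
  have "(((\<lambda>q. \<phi> q \<bullet> i) \<circ> inv_into U \<phi>) has_derivative (\<lambda>w. w \<bullet> i)) (at (\<phi> p))"
    by (rule has_derivative_transform_within_open[where f = "\<lambda>x. x \<bullet> i", OF _ chart_open[OF c(1)]])
      (use c in \<open>auto intro!: derivative_eq_intros simp: chart_inv\<close>)
  then show "tvec_components \<phi> (coord_vec A U \<phi> p w) \<bullet> i = w \<bullet> i"
    using smooth_at_coord[OF c] frechet_derivative_eqI
    unfolding tvec_components_inner[OF i] coord_vec_def by fastforce
qed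

lemma coord_vec_add:
  "(U, \<phi>) \<in> A \<Longrightarrow> p \<in> U \<Longrightarrow> coord_vec A U \<phi> p (v + w) = coord_vec A U \<phi> p v + coord_vec A U \<phi> p w"
  by (rule tvec_components_inject)
    (auto simp: tvec_components_plus components_coord_vec intro: coord_vec_tangent tangent_add)

lemma coord_vec_scale:
  "(U, \<phi>) \<in> A \<Longrightarrow> p \<in> U \<Longrightarrow> coord_vec A U \<phi> p (a *\<^sub>R v) = scal a (coord_vec A U \<phi> p v)"
  by (rule tvec_components_inject)
    (auto simp: tvec_components_scal components_coord_vec intro: coord_vec_tangent tangent_scal)

lemma components_eq_0_iff:
  "(U, \<phi>) \<in> A \<Longrightarrow> p \<in> U \<Longrightarrow> v \<in> tangent_space A p \<Longrightarrow> tvec_components \<phi> v = 0 \<longleftrightarrow> v = 0"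
  using tvec_components_inject[OF _ _ _ zero_tangent] tvec_components_0 by metis

subsection \<open>Vector fields\<close>

text \<open>This characterisation by the action on smooth germs is how vector fields are handled from here on:
  it makes brackets of vector fields, and later \<open>\<rho>\<close> and \<open>\<gamma>\<close> of fields, accessible without components.\<close>

lemma vector_fields_iff:
  "X \<in> vector_fields A \<longleftrightarrow> (\<forall>p\<in>carrier A. X p \<in> tangent_space A p) \<and>
     (\<forall>p f. smooth_at A p f \<longrightarrow> smooth_at A p (\<lambda>q. X q f))"
proof
  let ?F = "\<lambda>p. (p, X p)"
  assume "X \<in> vector_fields A"
  then have sm: "smooth_map A (tangent_bundle A) ?F" by (simp add: vector_fields_def)
  have T: "X p \<in> tangent_space A p" if "p \<in> carrier A" for p
  proof -
    have "?F p \<in> carrier (tangent_bundle A)" using sm that unfolding smooth_map_def by blast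
    then show ?thesis unfolding carrier_def tangent_bundle_def by auto
  qed
  have "smooth_at A p (\<lambda>q. X q f)" if f: "smooth_at A p f" for p f
  proof -
    obtain U \<phi> where c: "(U, \<phi>) \<in> A" "p \<in> U" using carrier_chart smooth_at_carrier[OF f] by blast
    let ?V = "{(p, v). p \<in> U \<and> v \<in> tangent_space A p}"
    let ?\<Phi> = "\<lambda>(p, v). (\<phi> p, tvec_components \<phi> v)"
    have "(?V, ?\<Phi>) \<in> tangent_bundle A" using c(1) unfolding tangent_bundle_def by force
    then have "smooth_on (\<phi> ` (U \<inter> ?F -` ?V)) (?\<Phi> \<circ> ?F \<circ> inv_into U \<phi>)"
      using sm c(1) unfolding smooth_map_def by blast
    moreover have "U \<inter> ?F -` ?V = U" using T chart_subset_carrier[OF c(1)] by auto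
    ultimately have "smooth_on (\<phi> ` U) (?\<Phi> \<circ> ?F \<circ> inv_into U \<phi>)" by simp
    then have "smooth_on (\<phi> ` U) (\<lambda>x. snd ((?\<Phi> \<circ> ?F \<circ> inv_into U \<phi>) x))"
      by (rule smooth_on_bounded_linear[OF chart_open[OF c(1)] bounded_linear_snd])
    then have sX: "smooth_on (\<phi> ` U) (\<lambda>x. tvec_components \<phi> (X (inv_into U \<phi> x)))" by simp
    obtain N where N: "open N" "\<phi> p \<in> N" "N \<subseteq> \<phi> ` U" "smooth_on N (f \<circ> inv_into U \<phi>)"
      using smooth_at_rep[OF c f] .
    show ?thesis
    proof (rule smooth_at_of_rep[OF c N(1-3)])
      show "smooth_on N (\<lambda>x. frechet_derivative (f \<circ> inv_into U \<phi>) (at x) (tvec_components \<phi> (X (inv_into U \<phi> x))))"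
        by (intro smooth_on_frechet N smooth_on_subset[OF sX])
      fix q assume q: "q \<in> U" "\<phi> q \<in> N"
      have "smooth_at A q f"
        by (rule smooth_at_of_rep[OF c(1) q(1) N(1) q(2) N(3,4)]) (simp add: chart_inv[OF c(1)])
      then show "X q f = frechet_derivative (f \<circ> inv_into U \<phi>) (at (\<phi> q)) (tvec_components \<phi> (X (inv_into U \<phi> (\<phi> q))))"
        using tv_chart[OF c(1) q(1) T] chart_inv[OF c(1) q(1)] chart_subset_carrier[OF c(1)] q(1) by auto
    qed
  qed
  then show "(\<forall>p\<in>carrier A. X p \<in> tangent_space A p) \<and>
     (\<forall>p f. smooth_at A p f \<longrightarrow> smooth_at A p (\<lambda>q. X q f))" using T by blast
next
  let ?F = "\<lambda>p. (p, X p)"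
  assume X: "(\<forall>p\<in>carrier A. X p \<in> tangent_space A p) \<and>
     (\<forall>p f. smooth_at A p f \<longrightarrow> smooth_at A p (\<lambda>q. X q f))"
  have "smooth_map A (tangent_bundle A) ?F" unfolding smooth_map_def
  proof (intro conjI funcsetI)
    fix p assume p: "p \<in> carrier A"
    obtain U \<phi> where c: "(U, \<phi>) \<in> A" "p \<in> U" using carrier_chart p by blast
    then show "?F p \<in> carrier (tangent_bundle A)" using X p
      unfolding carrier_def tangent_bundle_def by force
  next
    show "\<forall>(U, \<phi>)\<in>A. \<forall>(V, \<psi>)\<in>tangent_bundle A.
        openin (manifold_topology A) (U \<inter> ?F -` V) \<and> smooth_on (\<phi> ` (U \<inter> ?F -` V)) (\<psi> \<circ> ?F \<circ> inv_into U \<phi>)"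
    proof (intro ballI, unfold split_beta, intro ballI)
      fix P Q assume P: "P \<in> A" and Q: "Q \<in> tangent_bundle A"
      obtain U \<phi> where c: "P = (U, \<phi>)" "(U, \<phi>) \<in> A" using P by (cases P) auto
      obtain V \<psi> where d: "Q = ({(p, v). p \<in> V \<and> v \<in> tangent_space A p}, \<lambda>(p, v). (\<psi> p, tvec_components \<psi> v))"
        "(V, \<psi>) \<in> A" using Q unfolding tangent_bundle_def by auto
      have eq: "U \<inter> ?F -` fst Q = U \<inter> V" using X chart_subset_carrier[OF c(2)] d by auto
      have op: "open (\<phi> ` (U \<inter> V))" using overlap_open c d by blast
      have "smooth_on (\<phi> ` (U \<inter> V)) (\<lambda>x. tvec_components \<psi> (X (inv_into U \<phi> x)))"
      proof (rule smooth_on_components[OF op])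
        fix i :: 'e assume i: "i \<in> Basis"
        have "smooth_on (\<phi> ` (U \<inter> V)) ((\<lambda>q. X q (\<lambda>q. \<psi> q \<bullet> i)) \<circ> inv_into U \<phi>)"
          by (rule smooth_on_of_smooth_at[OF c(2)]) (use X smooth_at_coord[OF d(2)] in auto)
        then show "smooth_on (\<phi> ` (U \<inter> V)) (\<lambda>x. tvec_components \<psi> (X (inv_into U \<phi> x)) \<bullet> i)"
          by (simp add: tvec_components_inner[OF i] o_def)
      qed
      from smooth_on_Pair[OF op transition_smooth[OF c(2) d(2)] this]
      have "smooth_on (\<phi> ` (U \<inter> V)) (snd Q \<circ> ?F \<circ> inv_into U \<phi>)" using d by (simp add: o_def)
      then show "openin (manifold_topology A) (fst P \<inter> ?F -` fst Q) \<and>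
          smooth_on (snd P ` (fst P \<inter> ?F -` fst Q)) (snd Q \<circ> ?F \<circ> inv_into (fst P) (snd P))"
        using openin_overlap[OF c(2) d(2)] eq c(1) by simp
    qed
  qed
  then show "X \<in> vector_fields A" by (simp add: vector_fields_def)
qed

lemma vf_tangent: "X \<in> vector_fields A \<Longrightarrow> p \<in> carrier A \<Longrightarrow> X p \<in> tangent_space A p"
  unfolding vector_fields_iff by simp

lemma vf_smooth: "X \<in> vector_fields A \<Longrightarrow> smooth_at A p f \<Longrightarrow> smooth_at A p (\<lambda>q. X q f)"
  unfolding vector_fields_iff by simp

lemma vf_cong:
  assumes X: "X \<in> vector_fields A" and eq: "\<And>p. p \<in> carrier A \<Longrightarrow> Y p = X p"
  shows "Y \<in> vector_fields A"
  unfolding vector_fields_iff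
proof (intro conjI ballI allI impI)
  show "Y p \<in> tangent_space A p" if "p \<in> carrier A" for p
    using vf_tangent[OF X that] eq[OF that] by simp
  fix p f assume f: "smooth_at A p f"
  show "smooth_at A p (\<lambda>q. Y q f)"
    by (rule smooth_at_cong[OF openin_carrier smooth_at_carrier[OF f] _ vf_smooth[OF X f]]) (simp add: eq)
qed

lemma vf_lincomb:
  assumes X: "X \<in> vector_fields A" and Y: "Y \<in> vector_fields A"
  shows "(\<lambda>p. scal a (X p) + Y p) \<in> vector_fields A"
  unfolding vector_fields_iff
proof (intro conjI ballI allI impI)
  show "scal a (X p) + Y p \<in> tangent_space A p" if "p \<in> carrier A" for p
    using tangent_lincomb vf_tangent[OF X that] vf_tangent[OF Y that] by simp
  fix p f assume f: "smooth_at A p f"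
  show "smooth_at A p (\<lambda>q. (scal a (X q) + Y q) f)"
    using smooth_at_add[OF smooth_at_cmult[OF vf_smooth[OF X f]] vf_smooth[OF Y f]] by (simp add: scal_def)
qed

lemma vf_diff: "X \<in> vector_fields A \<Longrightarrow> Y \<in> vector_fields A \<Longrightarrow> (\<lambda>p. X p - Y p) \<in> vector_fields A"
  using vf_lincomb[of Y X "-1"] by (simp add: scal_def fun_diff_def plus_fun_def)

lemma bracket_apply:
  "smooth_at A p f \<Longrightarrow> lie_bracket A X Y p f = X p (\<lambda>q. Y q f) - Y p (\<lambda>q. X q f)"
  by (simp add: lie_bracket_def)

lemma vf_comp_lin:
  assumes X: "X \<in> vector_fields A" and Y: "Y \<in> vector_fields A" and f: "smooth_at A p f" and g: "smooth_at A p g"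
  shows "X p (\<lambda>q. Y q (\<lambda>q. a * f q + b * g q)) = a * X p (\<lambda>q. Y q f) + b * X p (\<lambda>q. Y q g)"
proof -
  have p: "p \<in> carrier A" using smooth_at_carrier[OF f] .
  obtain W1 where W1: "openin (manifold_topology A) W1" "p \<in> W1" "\<And>q. q \<in> W1 \<Longrightarrow> smooth_at A q f"
    by (rule smooth_at_nbhd[OF f], rule that)
  obtain W2 where W2: "openin (manifold_topology A) W2" "p \<in> W2" "\<And>q. q \<in> W2 \<Longrightarrow> smooth_at A q g"
    by (rule smooth_at_nbhd[OF g], rule that)
  have "X p (\<lambda>q. Y q (\<lambda>q. a * f q + b * g q)) = X p (\<lambda>q. a * Y q f + b * Y q g)"
  proof (rule tv_cong[OF vf_tangent[OF X p] openin_Int[OF W1(1) W2(1)]])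
    fix q assume q: "q \<in> W1 \<inter> W2"
    have fg: "smooth_at A q f" "smooth_at A q g" using q W1(3) W2(3) by simp_all
    show "Y q (\<lambda>q. a * f q + b * g q) = a * Y q f + b * Y q g"
      by (rule tv_lin[OF vf_tangent[OF Y smooth_at_carrier[OF fg(1)]] fg])
  qed (use W1 W2 in auto)
  also have "\<dots> = a * X p (\<lambda>q. Y q f) + b * X p (\<lambda>q. Y q g)"
    by (rule tv_lin[OF vf_tangent[OF X p] vf_smooth[OF Y f] vf_smooth[OF Y g]])
  finally show ?thesis .
qed

lemma vf_comp_mult:
  assumes X: "X \<in> vector_fields A" and Y: "Y \<in> vector_fields A" and f: "smooth_at A p f" and g: "smooth_at A p g"
  shows "X p (\<lambda>q. Y q (\<lambda>q. f q * g q)) =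
    X p (\<lambda>q. Y q f) * g p + Y p f * X p g + X p f * Y p g + f p * X p (\<lambda>q. Y q g)"
proof -
  have p: "p \<in> carrier A" using smooth_at_carrier[OF f] .
  note Xp = vf_tangent[OF X p]
  obtain W1 where W1: "openin (manifold_topology A) W1" "p \<in> W1" "\<And>q. q \<in> W1 \<Longrightarrow> smooth_at A q f"
    by (rule smooth_at_nbhd[OF f], rule that)
  obtain W2 where W2: "openin (manifold_topology A) W2" "p \<in> W2" "\<And>q. q \<in> W2 \<Longrightarrow> smooth_at A q g"
    by (rule smooth_at_nbhd[OF g], rule that)
  have "X p (\<lambda>q. Y q (\<lambda>q. f q * g q)) = X p (\<lambda>q. Y q f * g q + f q * Y q g)"
  proof (rule tv_cong[OF Xp openin_Int[OF W1(1) W2(1)]])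
    fix q assume q: "q \<in> W1 \<inter> W2"
    have fg: "smooth_at A q f" "smooth_at A q g" using q W1(3) W2(3) by simp_all
    show "Y q (\<lambda>q. f q * g q) = Y q f * g q + f q * Y q g"
      by (rule tv_mult[OF vf_tangent[OF Y smooth_at_carrier[OF fg(1)]] fg])
  qed (use W1 W2 in auto)
  also have "\<dots> = X p (\<lambda>q. Y q f * g q) + X p (\<lambda>q. f q * Y q g)"
    by (rule tv_add[OF Xp smooth_at_mult[OF vf_smooth[OF Y f] g] smooth_at_mult[OF f vf_smooth[OF Y g]]])
  also have "X p (\<lambda>q. Y q f * g q) = X p (\<lambda>q. Y q f) * g p + Y p f * X p g"
    by (rule tv_mult[OF Xp vf_smooth[OF Y f] g])
  also have "X p (\<lambda>q. f q * Y q g) = X p f * Y p g + f p * X p (\<lambda>q. Y q g)"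
    by (rule tv_mult[OF Xp f vf_smooth[OF Y g]])
  finally show ?thesis by simp
qed

lemma bracket_vf:
  assumes X: "X \<in> vector_fields A" and Y: "Y \<in> vector_fields A"
  shows "lie_bracket A X Y \<in> vector_fields A"
  unfolding vector_fields_iff
proof (intro conjI ballI allI impI)
  fix p assume p: "p \<in> carrier A"
  show "lie_bracket A X Y p \<in> tangent_space A p"
    unfolding tangent_space_def
  proof (intro CollectI conjI allI impI)
    fix f g a b assume fg: "smooth_at A p f \<and> smooth_at A p g"
    then have "smooth_at A p (\<lambda>q. a * f q + b * g q)" by (intro smooth_at_add smooth_at_cmult) auto
    then show "lie_bracket A X Y p (\<lambda>q. a * f q + b * g q) = a * lie_bracket A X Y p f + b * lie_bracket A X Y p g"
      using fg vf_comp_lin[OF X Y, of p f g a b] vf_comp_lin[OF Y X, of p f g a b]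
      by (simp add: bracket_apply algebra_simps)
  next
    fix f g assume fg: "smooth_at A p f \<and> smooth_at A p g"
    then have "smooth_at A p (\<lambda>q. f q * g q)" by (intro smooth_at_mult) auto
    then show "lie_bracket A X Y p (\<lambda>q. f q * g q) = lie_bracket A X Y p f * g p + f p * lie_bracket A X Y p g"
      using fg vf_comp_mult[OF X Y, of p f g] vf_comp_mult[OF Y X, of p f g]
      by (simp add: bracket_apply algebra_simps)
  next
    fix f g W assume a: "smooth_at A p f \<and> smooth_at A p g \<and> openin (manifold_topology A) W \<and> p \<in> W \<and>
      (\<forall>q\<in>W. f q = g q)"
    then have W: "openin (manifold_topology A) W" "p \<in> W" by auto
    have "Z q f = Z q g" if "Z \<in> vector_fields A" "q \<in> W" for Z q
    proof (rule tv_cong[OF vf_tangent[OF that(1)] W(1) that(2)])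
      show "q \<in> carrier A" using W(1) that(2) openin_iff by auto
    qed (use a in auto)
    then have "X p (\<lambda>q. Y q f) = X p (\<lambda>q. Y q g)" "Y p (\<lambda>q. X q f) = Y p (\<lambda>q. X q g)"
      using tv_cong[OF vf_tangent[OF X p] W, of "\<lambda>q. Y q f" "\<lambda>q. Y q g"]
        tv_cong[OF vf_tangent[OF Y p] W, of "\<lambda>q. X q f" "\<lambda>q. X q g"] X Y by simp_all
    then show "lie_bracket A X Y p f = lie_bracket A X Y p g" using a by (simp add: bracket_apply)
  next
    fix f assume "\<not> smooth_at A p f"
    then show "lie_bracket A X Y p f = 0" by (simp add: lie_bracket_def)
  qed
next
  fix p f assume f: "smooth_at A p f"
  obtain W where W: "openin (manifold_topology A) W" "p \<in> W" "\<And>q. q \<in> W \<Longrightarrow> smooth_at A q f"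
    by (rule smooth_at_nbhd[OF f], rule that)
  have "smooth_at A p (\<lambda>q. X q (\<lambda>q. Y q f) - Y q (\<lambda>q. X q f))"
    by (rule smooth_at_diff[OF vf_smooth[OF X vf_smooth[OF Y f]] vf_smooth[OF Y vf_smooth[OF X f]]])
  then show "smooth_at A p (\<lambda>q. lie_bracket A X Y q f)"
    by (rule smooth_at_cong[OF W(1,2), rotated]) (simp add: bracket_apply W(3))
qed

lemma Jacobi_identity:
  assumes X: "X \<in> vector_fields A" and Y: "Y \<in> vector_fields A" and Z: "Z \<in> vector_fields A"
  shows "lie_bracket A X (lie_bracket A Y Z) p + lie_bracket A Y (lie_bracket A Z X) p
    + lie_bracket A Z (lie_bracket A X Y) p = 0"
proof
  fix f
  show "(lie_bracket A X (lie_bracket A Y Z) p + lie_bracket A Y (lie_bracket A Z X) p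
    + lie_bracket A Z (lie_bracket A X Y) p) f = 0 f"
  proof (cases "smooth_at A p f")
    case True
    have p: "p \<in> carrier A" using smooth_at_carrier[OF True] .
    obtain W where W: "openin (manifold_topology A) W" "p \<in> W" "\<And>q. q \<in> W \<Longrightarrow> smooth_at A q f"
      by (rule smooth_at_nbhd[OF True], rule that)
    have *: "lie_bracket A S (lie_bracket A T V) p f =
       S p (\<lambda>q. T q (\<lambda>q. V q f)) - S p (\<lambda>q. V q (\<lambda>q. T q f))
       - (T p (\<lambda>q. V q (\<lambda>q. S q f)) - V p (\<lambda>q. T q (\<lambda>q. S q f)))"
      if S: "S \<in> vector_fields A" and T: "T \<in> vector_fields A" and V: "V \<in> vector_fields A" for S T V
    proof -
      have "S p (\<lambda>q. lie_bracket A T V q f) = S p (\<lambda>q. T q (\<lambda>q. V q f) - V q (\<lambda>q. T q f))"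
        by (rule tv_cong[OF vf_tangent[OF S p] W(1,2)]) (simp add: bracket_apply W(3))
      also have "\<dots> = S p (\<lambda>q. T q (\<lambda>q. V q f)) - S p (\<lambda>q. V q (\<lambda>q. T q f))"
        by (rule tv_diff[OF vf_tangent[OF S p] vf_smooth[OF T vf_smooth[OF V True]] vf_smooth[OF V vf_smooth[OF T True]]])
      finally show ?thesis using bracket_apply[OF True, of S] bracket_apply[OF vf_smooth[OF S True], of T V] by simp
    qed
    show ?thesis using *[OF X Y Z] *[OF Y Z X] *[OF Z X Y] by simp
  next
    case False
    then show ?thesis by (simp add: lie_bracket_def)
  qed
qed

end

section \<open>The slit tangent bundle\<close>

text \<open>A chart \<open>(U, \<phi>)\<close> of the base induces the chart \<open>(sdom M U, schart \<phi>)\<close> of the slit tangent bundle.\<close>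

definition sdom :: "('m, 'e::euclidean_space) atlas \<Rightarrow> 'm set \<Rightarrow> 'm tpoint set" where
  "sdom M U = {(p, v). p \<in> U \<and> v \<in> tangent_space M p \<and> v \<noteq> 0}"

definition schart :: "('m \<Rightarrow> 'e::euclidean_space) \<Rightarrow> 'm tpoint \<Rightarrow> 'e \<times> 'e" where
  "schart \<phi> u = (\<phi> (fst u), tvec_components \<phi> (snd u))"

lemma slit_eq: "slit M = (\<lambda>(U, \<phi>). (sdom M U, schart \<phi>)) ` M"
proof -
  have "{(p, v). p \<in> U \<and> v \<in> tangent_space M p} \<inter> {(p, v). v \<noteq> 0} = sdom M U" for U
    by (auto simp: sdom_def)
  moreover have "(\<lambda>(p, v). (\<phi> p, tvec_components \<phi> v)) = schart \<phi>" for \<phi> :: "'a \<Rightarrow> 'b"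
    by (auto simp: schart_def)
  ultimately show ?thesis unfolding slit_def open_submanifold_def tangent_bundle_def image_image
    by (intro image_cong) auto
qed

lemma sdom_iff: "u \<in> sdom M U \<longleftrightarrow> fst u \<in> U \<and> snd u \<in> tangent_space M (fst u) \<and> snd u \<noteq> 0"
  by (cases u) (simp add: sdom_def)

lemma carrier_slit_iff:
  "u \<in> carrier (slit M) \<longleftrightarrow> fst u \<in> carrier M \<and> snd u \<in> tangent_space M (fst u) \<and> snd u \<noteq> 0"
  unfolding carrier_def slit_eq by (force simp: sdom_iff)

locale base_manifold = atlas M for M :: "('m, 'e::euclidean_space) atlas"
begin

abbreviation "TM0 \<equiv> carrier (slit M)"
abbreviation "T \<equiv> tangent_space M"
abbreviation "TT \<equiv> tangent_space (slit M)"
abbreviation "VF \<equiv> vector_fields (slit M)"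
abbreviation "Sec \<equiv> psections M"
abbreviation "lie \<equiv> lie_bracket (slit M)"
abbreviation "sinv U \<phi> \<equiv> inv_into (sdom M U) (schart \<phi>)"

lemma slit_chart: "(U, \<phi>) \<in> M \<Longrightarrow> (sdom M U, schart \<phi>) \<in> slit M"
  unfolding slit_eq by force

lemma schart_image:
  assumes c: "(U, \<phi>) \<in> M" and W: "W \<subseteq> U"
  shows "schart \<phi> ` sdom M W = (\<phi> ` W) \<times> (- {0})"
proof
  show "schart \<phi> ` sdom M W \<subseteq> (\<phi> ` W) \<times> (- {0})"
    using W components_eq_0_iff[OF c] by (auto simp: schart_def sdom_iff)
  show "(\<phi> ` W) \<times> (- {0}) \<subseteq> schart \<phi> ` sdom M W"
  proof
    fix z assume "z \<in> (\<phi> ` W) \<times> (- {0::'e})"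
    then obtain p w where z: "z = (\<phi> p, w)" and p: "p \<in> W" and w: "w \<noteq> 0" by auto
    then have pU: "p \<in> U" using W by blast
    have "(p, coord_vec M U \<phi> p w) \<in> sdom M W"
      using coord_vec_tangent[OF c pU, of w] components_eq_0_iff[OF c pU, of "coord_vec M U \<phi> p w"] p w
      by (simp add: sdom_iff components_coord_vec[OF c pU])
    moreover have "schart \<phi> (p, coord_vec M U \<phi> p w) = (\<phi> p, w)"
      by (simp add: schart_def components_coord_vec[OF c pU])
    ultimately show "z \<in> schart \<phi> ` sdom M W" unfolding z by (metis imageI)
  qed
qed

lemma schart_inj: "(U, \<phi>) \<in> M \<Longrightarrow> inj_on (schart \<phi>) (sdom M U)"
proof (rule inj_onI)
  fix u u' assume c: "(U, \<phi>) \<in> M" and u: "u \<in> sdom M U" "u' \<in> sdom M U" "schart \<phi> u = schart \<phi> u'"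
  have "fst u = fst u'" using u chart_inj[OF c] by (auto simp: schart_def sdom_iff inj_on_def)
  moreover have "snd u = snd u'"
    by (rule tvec_components_inject[OF c, of "fst u"])
      (use u \<open>fst u = fst u'\<close> in \<open>auto simp: schart_def sdom_iff\<close>)
  ultimately show "u = u'" by (rule prod_eqI)
qed

lemma schart_inv:
  assumes c: "(U, \<phi>) \<in> M" and x: "x \<in> \<phi> ` U" and w: "w \<noteq> 0"
  shows "sinv U \<phi> (x, w) = (inv_into U \<phi> x, coord_vec M U \<phi> (inv_into U \<phi> x) w)"
proof (rule inv_into_f_eq[OF schart_inj[OF c]])
  have U: "inv_into U \<phi> x \<in> U" and e: "\<phi> (inv_into U \<phi> x) = x" using inv_in_chart[OF x] chart_of_inv[OF x] .
  show "schart \<phi> (inv_into U \<phi> x, coord_vec M U \<phi> (inv_into U \<phi> x) w) = (x, w)"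
    by (simp add: schart_def e components_coord_vec[OF c U])
  show "(inv_into U \<phi> x, coord_vec M U \<phi> (inv_into U \<phi> x) w) \<in> sdom M U"
    using coord_vec_tangent[OF c U, of w] components_eq_0_iff[OF c U, of "coord_vec M U \<phi> (inv_into U \<phi> x) w"] w U
    by (simp add: sdom_iff components_coord_vec[OF c U])
qed

lemma sdom_Int: "sdom M U \<inter> sdom M V = sdom M (U \<inter> V)"
  by (auto simp: sdom_iff)

lemma open_slit_fibre: "open (- {0::'e})"
  by (simp add: open_Compl)

text \<open>In the fibre coordinates the transition maps are given by the derivative of the transition map of the
  base.\<close>

lemma slit_atlas: "smooth_atlas (slit M)"
proof -
  have tr: "open (schart \<phi> ` (sdom M U \<inter> sdom M V)) \<and>
      smooth_on (schart \<phi> ` (sdom M U \<inter> sdom M V)) (schart \<psi> \<circ> sinv U \<phi>)"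
    if c: "(U, \<phi>) \<in> M" and d: "(V, \<psi>) \<in> M" for U \<phi> V \<psi>
  proof
    let ?S = "\<phi> ` (U \<inter> V)"
    have im: "schart \<phi> ` (sdom M U \<inter> sdom M V) = ?S \<times> - {0}"
      unfolding sdom_Int by (rule schart_image[OF c]) simp
    have oS: "open ?S" using overlap_open[OF c d] .
    have op: "open (?S \<times> - {0::'e})" by (intro open_Times oS open_slit_fibre)
    then show "open (schart \<phi> ` (sdom M U \<inter> sdom M V))" unfolding im .
    have fs: "smooth_on (?S \<times> - {0::'e}) fst" "smooth_on (?S \<times> - {0::'e}) snd"
      by (intro smooth_on_linear op bounded_linear_fst bounded_linear_snd)+
    have "smooth_on (?S \<times> - {0::'e}) (\<lambda>z. (\<psi> \<circ> inv_into U \<phi>) (fst z))"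
      by (rule smooth_on_compose[OF op oS _ fs(1) transition_smooth[OF c d]]) auto
    moreover have "smooth_on (?S \<times> - {0::'e})
      (\<lambda>z. tvec_components \<psi> (coord_vec M U \<phi> (inv_into U \<phi> (fst z)) (snd z)))"
    proof (rule smooth_on_components[OF op])
      fix i :: 'e assume i: "i \<in> Basis"
      have "smooth_on ?S (\<lambda>x. (\<psi> \<circ> inv_into U \<phi>) x \<bullet> i)"
        by (rule smooth_on_bounded_linear[OF oS bounded_linear_inner_left transition_smooth[OF c d]])
      then have *: "smooth_on ?S ((\<lambda>q. \<psi> q \<bullet> i) \<circ> inv_into U \<phi>)" by (simp add: o_def)
      show "smooth_on (?S \<times> - {0::'e}) (\<lambda>z. tvec_components \<psi> (coord_vec M U \<phi> (inv_into U \<phi> (fst z)) (snd z)) \<bullet> i)"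
      proof (rule smooth_on_cong[OF op _ smooth_on_frechet_compose[OF oS op * fs(1) _ fs(2)]])
        show "fst ` (?S \<times> - {0}) \<subseteq> ?S" by auto
        fix z assume "z \<in> ?S \<times> - {0::'e}"
        then have "fst z \<in> ?S" by auto
        then obtain q where q: "q \<in> U" "q \<in> V" "fst z = \<phi> q" by blast
        then show "frechet_derivative ((\<lambda>q. \<psi> q \<bullet> i) \<circ> inv_into U \<phi>) (at (fst z)) (snd z) =
            tvec_components \<psi> (coord_vec M U \<phi> (inv_into U \<phi> (fst z)) (snd z)) \<bullet> i"
          using smooth_at_coord[OF d q(2), of i] chart_inv[OF c q(1)]
          by (simp add: tvec_components_inner[OF i] coord_vec_def)
      qed
    qed
    ultimately have "smooth_on (?S \<times> - {0::'e})
        (\<lambda>z. ((\<psi> \<circ> inv_into U \<phi>) (fst z), tvec_components \<psi> (coord_vec M U \<phi> (inv_into U \<phi> (fst z)) (snd z))))"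
      by (rule smooth_on_Pair[OF op])
    then show "smooth_on (schart \<phi> ` (sdom M U \<inter> sdom M V)) (schart \<psi> \<circ> sinv U \<phi>)"
      unfolding im
    proof (rule smooth_on_cong[OF op, rotated])
      fix z assume "z \<in> ?S \<times> - {0::'e}"
      then have z: "fst z \<in> \<phi> ` U" "snd z \<noteq> 0" by auto
      show "((\<psi> \<circ> inv_into U \<phi>) (fst z), tvec_components \<psi> (coord_vec M U \<phi> (inv_into U \<phi> (fst z)) (snd z)))
          = (schart \<psi> \<circ> sinv U \<phi>) z"
        using schart_inv[OF c z] by (simp add: schart_def)
    qed
  qed
  have "inj_on (schart \<phi>) (sdom M U) \<and> open (schart \<phi> ` sdom M U)" if "(U, \<phi>) \<in> M" for U \<phi>
    using schart_inj[OF that] tr[OF that that] by simp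
  then show ?thesis unfolding smooth_atlas_def slit_eq using tr by fastforce
qed

sublocale slit: atlas "slit M"
  by unfold_locales (rule slit_atlas)

lemma slit_carrierD:
  "u \<in> TM0 \<Longrightarrow> fst u \<in> carrier M" "u \<in> TM0 \<Longrightarrow> snd u \<in> T (fst u)" "u \<in> TM0 \<Longrightarrow> snd u \<noteq> 0"
  by (auto simp: carrier_slit_iff)

lemma slit_obtain_chart:
  assumes "u \<in> TM0"
  obtains U \<phi> where "(U, \<phi>) \<in> M" "fst u \<in> U" "u \<in> sdom M U"
  using assms carrier_chart[of "fst u"] by (auto simp: carrier_slit_iff sdom_iff)

lemma sdom_subset: "(U, \<phi>) \<in> M \<Longrightarrow> u \<in> sdom M U \<Longrightarrow> u \<in> TM0"
  using chart_subset_carrier[of U \<phi>] by (auto simp: carrier_slit_iff sdom_iff)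

lemma slit_smooth_at_of_rep:
  assumes c: "(U, \<phi>) \<in> M" "u \<in> sdom M U" and N: "open N" "\<phi> (fst u) \<in> N" "N \<subseteq> \<phi> ` U"
    and h: "smooth_on (N \<times> - {0}) h" and eq: "\<And>q. q \<in> sdom M U \<Longrightarrow> \<phi> (fst q) \<in> N \<Longrightarrow> f q = h (schart \<phi> q)"
  shows "smooth_at (slit M) u f"
proof (rule slit.smooth_at_of_rep[OF slit_chart[OF c(1)] c(2) _ _ _ h])
  have im: "schart \<phi> ` sdom M U = \<phi> ` U \<times> - {0}" by (rule schart_image[OF c(1)]) simp
  show "open (N \<times> - {0::'e})" by (intro open_Times N(1) open_slit_fibre)
  show "N \<times> - {0} \<subseteq> schart \<phi> ` sdom M U" unfolding im using N(3) by auto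
  have "schart \<phi> u \<in> \<phi> ` U \<times> - {0}" unfolding im[symmetric] using c(2) by (rule imageI)
  then show "schart \<phi> u \<in> N \<times> - {0}" using N(2) by (auto simp: schart_def)
  show "f q = h (schart \<phi> q)" if "q \<in> sdom M U" "schart \<phi> q \<in> N \<times> - {0}" for q
    using eq[OF that(1)] that(2) by (simp add: schart_def)
qed

lemma smooth_at_base:
  assumes u: "u \<in> TM0" and f: "smooth_at M (fst u) f"
  shows "smooth_at (slit M) u (f \<circ> fst)"
proof -
  obtain U \<phi> where c: "(U, \<phi>) \<in> M" "fst u \<in> U" "u \<in> sdom M U" using slit_obtain_chart[OF u] .
  obtain N where N: "open N" "\<phi> (fst u) \<in> N" "N \<subseteq> \<phi> ` U" "smooth_on N (f \<circ> inv_into U \<phi>)"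
    using smooth_at_rep[OF c(1,2) f] .
  have op: "open (N \<times> - {0::'e})" by (intro open_Times N(1) open_slit_fibre)
  have "smooth_on (N \<times> - {0::'e}) (\<lambda>z. (f \<circ> inv_into U \<phi>) (fst z))"
    by (rule smooth_on_compose[OF op N(1) _ smooth_on_linear[OF op bounded_linear_fst] N(4)]) auto
  then show ?thesis
    by (rule slit_smooth_at_of_rep[OF c(1,3) N(1-3)]) (simp add: schart_def sdom_iff chart_inv[OF c(1)])
qed

lemma openin_base_preimage:
  assumes "openin (manifold_topology M) W"
  shows "openin (manifold_topology (slit M)) {u \<in> TM0. fst u \<in> W}"
  unfolding slit.openin_iff
proof (intro conjI ballI)
  fix Q assume "Q \<in> slit M"
  then obtain U \<phi> where Q: "Q = (sdom M U, schart \<phi>)" and c: "(U, \<phi>) \<in> M" unfolding slit_eq by auto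
  have "sdom M U \<inter> {u \<in> TM0. fst u \<in> W} = sdom M (U \<inter> W)"
    using sdom_subset[OF c] by (auto simp: sdom_iff)
  moreover have "open (schart \<phi> ` sdom M (U \<inter> W))"
    using schart_image[OF c, of "U \<inter> W"] openin_chart_image[OF assms c] by (simp add: open_Times open_slit_fibre)
  ultimately show "case Q of (U, \<phi>) \<Rightarrow> open (\<phi> ` (U \<inter> {u \<in> TM0. fst u \<in> W}))" using Q by simp
qed auto

lemma base_nbhd:
  assumes u: "u \<in> TM0" and f: "smooth_at M (fst u) f"
  obtains W where "openin (manifold_topology (slit M)) W" "u \<in> W" "\<And>q. q \<in> W \<Longrightarrow> q \<in> TM0 \<and> smooth_at M (fst q) f"
proof -
  obtain W where W: "openin (manifold_topology M) W" "fst u \<in> W" "\<And>q. q \<in> W \<Longrightarrow> smooth_at M q f"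
    by (rule smooth_at_nbhd[OF f], rule that)
  show ?thesis by (rule that[OF openin_base_preimage[OF W(1)]]) (use u W in auto)
qed

subsection \<open>Sections of the pullback bundle\<close>

text \<open>The analogue of \<open>vector_fields_iff\<close>: a section \<open>Y\<close> is smooth iff \<open>u \<mapsto> Y\<^sub>u f\<close> is smooth for every smooth germ \<open>f\<close> on
  the base.\<close>

lemma psections_iff:
  "Y \<in> Sec \<longleftrightarrow> (\<forall>u\<in>TM0. Y u \<in> T (fst u)) \<and>
     (\<forall>u\<in>TM0. \<forall>f. smooth_at M (fst u) f \<longrightarrow> smooth_at (slit M) u (\<lambda>w. Y w f))"
proof
  let ?F = "\<lambda>u. (u, Y u)"
  assume "Y \<in> Sec"
  then have sm: "smooth_map (slit M) (pullback_bundle M) ?F" by (simp add: psections_def)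
  have Tu: "Y u \<in> T (fst u)" if "u \<in> TM0" for u
  proof -
    have "?F u \<in> carrier (pullback_bundle M)" using sm that unfolding smooth_map_def by blast
    then show ?thesis unfolding carrier_def pullback_bundle_def by auto
  qed
  have "smooth_at (slit M) u (\<lambda>w. Y w f)" if u: "u \<in> TM0" and f: "smooth_at M (fst u) f" for u f
  proof -
    obtain U \<phi> where c: "(U, \<phi>) \<in> M" "fst u \<in> U" "u \<in> sdom M U" using slit_obtain_chart[OF u] .
    let ?V = "{(u, v). u \<in> TM0 \<and> fst u \<in> U \<and> v \<in> T (fst u)}"
    let ?\<Phi> = "\<lambda>((p, y), v). ((\<phi> p, tvec_components \<phi> y), tvec_components \<phi> v)"
    have cU: "(sdom M U, schart \<phi>) \<in> slit M" using slit_chart[OF c(1)] .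
    have "(?V, ?\<Phi>) \<in> pullback_bundle M" using c(1) unfolding pullback_bundle_def by force
    then have "smooth_on (schart \<phi> ` (sdom M U \<inter> ?F -` ?V)) (?\<Phi> \<circ> ?F \<circ> sinv U \<phi>)"
      using sm cU unfolding smooth_map_def by blast
    moreover have "sdom M U \<inter> ?F -` ?V = sdom M U"
      using Tu sdom_subset[OF c(1)] by (auto simp: sdom_iff)
    ultimately have "smooth_on (schart \<phi> ` sdom M U) (?\<Phi> \<circ> ?F \<circ> sinv U \<phi>)" by simp
    then have "smooth_on (schart \<phi> ` sdom M U) (\<lambda>x. snd ((?\<Phi> \<circ> ?F \<circ> sinv U \<phi>) x))"
      by (rule smooth_on_bounded_linear[OF slit.chart_open[OF cU] bounded_linear_snd])
    moreover have "(\<lambda>x. snd ((?\<Phi> \<circ> ?F \<circ> sinv U \<phi>) x)) =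
        (\<lambda>x. tvec_components \<phi> (Y (sinv U \<phi> x)))"
      by (auto simp: split_beta)
    ultimately have sY: "smooth_on (schart \<phi> ` sdom M U) (\<lambda>x. tvec_components \<phi> (Y (sinv U \<phi> x)))"
      by simp
    obtain N where N: "open N" "\<phi> (fst u) \<in> N" "N \<subseteq> \<phi> ` U" "smooth_on N (f \<circ> inv_into U \<phi>)"
      using smooth_at_rep[OF c(1,2) f] .
    have op: "open (N \<times> - {0::'e})" by (intro open_Times N(1) open_slit_fibre)
    have im: "schart \<phi> ` sdom M U = \<phi> ` U \<times> - {0}" by (rule schart_image[OF c(1)]) simp
    show ?thesis
    proof (rule slit_smooth_at_of_rep[OF c(1,3) N(1-3)])
      show "smooth_on (N \<times> - {0}) (\<lambda>z. frechet_derivative (f \<circ> inv_into U \<phi>) (at (fst z))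
          (tvec_components \<phi> (Y (sinv U \<phi> z))))"
        by (rule smooth_on_frechet_compose[OF N(1) op N(4) smooth_on_linear[OF op bounded_linear_fst]])
          (use N(3) in \<open>auto intro!: smooth_on_subset[OF sY] simp: im\<close>)
      fix q assume q: "q \<in> sdom M U" "\<phi> (fst q) \<in> N"
      have qU: "fst q \<in> U" using q(1) by (simp add: sdom_iff)
      have "smooth_at M (fst q) f"
        by (rule smooth_at_of_rep[OF c(1) qU N(1) q(2) N(3,4)]) (simp add: chart_inv[OF c(1)])
      then show "Y q f = frechet_derivative (f \<circ> inv_into U \<phi>) (at (fst (schart \<phi> q)))
          (tvec_components \<phi> (Y (sinv U \<phi> (schart \<phi> q))))"
        using tv_chart[OF c(1) qU Tu[OF sdom_subset[OF c(1) q(1)]]] slit.chart_inv[OF cU q(1)]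
        by (simp add: schart_def)
    qed
  qed
  then show "(\<forall>u\<in>TM0. Y u \<in> T (fst u)) \<and>
     (\<forall>u\<in>TM0. \<forall>f. smooth_at M (fst u) f \<longrightarrow> smooth_at (slit M) u (\<lambda>w. Y w f))" using Tu by simp
next
  let ?F = "\<lambda>u. (u, Y u)"
  assume Y: "(\<forall>u\<in>TM0. Y u \<in> T (fst u)) \<and>
     (\<forall>u\<in>TM0. \<forall>f. smooth_at M (fst u) f \<longrightarrow> smooth_at (slit M) u (\<lambda>w. Y w f))"
  have "smooth_map (slit M) (pullback_bundle M) ?F" unfolding smooth_map_def
  proof (intro conjI funcsetI)
    fix u assume u: "u \<in> TM0"
    obtain U \<phi> where c: "(U, \<phi>) \<in> M" "fst u \<in> U" using slit_obtain_chart[OF u] .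
    then show "?F u \<in> carrier (pullback_bundle M)" using Y u
      unfolding carrier_def pullback_bundle_def by force
  next
    show "\<forall>(U, \<phi>)\<in>slit M. \<forall>(V, \<psi>)\<in>pullback_bundle M.
        openin (manifold_topology (slit M)) (U \<inter> ?F -` V) \<and> smooth_on (\<phi> ` (U \<inter> ?F -` V)) (\<psi> \<circ> ?F \<circ> inv_into U \<phi>)"
    proof (intro ballI, unfold split_beta, intro ballI)
      fix P Q assume P: "P \<in> slit M" and Q: "Q \<in> pullback_bundle M"
      obtain U \<phi> where c: "P = (sdom M U, schart \<phi>)" "(U, \<phi>) \<in> M" using P unfolding slit_eq by auto
      obtain V \<psi> where d: "Q = ({(u, v). u \<in> TM0 \<and> fst u \<in> V \<and> v \<in> T (fst u)},
          \<lambda>((p, y), v). ((\<psi> p, tvec_components \<psi> y), tvec_components \<psi> v))" "(V, \<psi>) \<in> M"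
        using Q unfolding pullback_bundle_def by auto
      note sc = slit_chart[OF c(2)] and sd = slit_chart[OF d(2)]
      let ?i = "sinv U \<phi>"
      let ?D = "sdom M U \<inter> sdom M V"
      have eq: "sdom M U \<inter> ?F -` fst Q = ?D" using Y sdom_subset[OF c(2)] d by (auto simp: sdom_iff)
      have op: "open (schart \<phi> ` ?D)" using slit.overlap_open[OF sc sd] .
      have "smooth_on (schart \<phi> ` ?D) (\<lambda>x. tvec_components \<psi> (Y (?i x)))"
      proof (rule smooth_on_components[OF op])
        fix i :: 'e assume i: "i \<in> Basis"
        have "smooth_on (schart \<phi> ` ?D) ((\<lambda>q. Y q (\<lambda>q. \<psi> q \<bullet> i)) \<circ> ?i)"
        proof (rule slit.smooth_on_of_smooth_at[OF sc])
          show "smooth_at (slit M) q (\<lambda>q. Y q (\<lambda>q. \<psi> q \<bullet> i))" if "q \<in> ?D" for q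
            using Y smooth_at_coord[OF d(2), of "fst q" i] sdom_subset[OF c(2), of q] that by (simp add: sdom_iff)
        qed simp
        then show "smooth_on (schart \<phi> ` ?D) (\<lambda>x. tvec_components \<psi> (Y (?i x)) \<bullet> i)"
          by (simp add: tvec_components_inner[OF i] o_def)
      qed
      from smooth_on_Pair[OF op slit.transition_smooth[OF sc sd] this]
      have "smooth_on (schart \<phi> ` ?D) (snd Q \<circ> ?F \<circ> ?i)" using d by (simp add: o_def split_beta schart_def[abs_def])
      then show "openin (manifold_topology (slit M)) (fst P \<inter> ?F -` fst Q) \<and>
          smooth_on (snd P ` (fst P \<inter> ?F -` fst Q)) (snd Q \<circ> ?F \<circ> inv_into (fst P) (snd P))"
        using slit.openin_overlap[OF sc sd] eq c(1) by simp
    qed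
  qed
  then show "Y \<in> Sec" by (simp add: psections_def)
qed

lemma psec_tangent: "Y \<in> Sec \<Longrightarrow> u \<in> TM0 \<Longrightarrow> Y u \<in> T (fst u)"
  unfolding psections_iff by simp

lemma psec_smooth:
  "Y \<in> Sec \<Longrightarrow> u \<in> TM0 \<Longrightarrow> smooth_at M (fst u) f \<Longrightarrow> smooth_at (slit M) u (\<lambda>w. Y w f)"
  unfolding psections_iff by simp

lemma psec_cong:
  assumes Y: "Y \<in> Sec" and eq: "\<And>u. u \<in> TM0 \<Longrightarrow> Z u = Y u"
  shows "Z \<in> Sec"
  unfolding psections_iff
proof (intro conjI ballI allI impI)
  show "Z u \<in> T (fst u)" if "u \<in> TM0" for u using psec_tangent[OF Y that] eq[OF that] by simp
  fix u f assume u: "u \<in> TM0" and f: "smooth_at M (fst u) f"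
  show "smooth_at (slit M) u (\<lambda>w. Z w f)"
    by (rule slit.smooth_at_cong[OF slit.openin_carrier u _ psec_smooth[OF Y u f]]) (simp add: eq)
qed

lemma psec_lincomb:
  assumes Y: "Y \<in> Sec" and Z: "Z \<in> Sec"
  shows "(\<lambda>u. scal a (Y u) + Z u) \<in> Sec"
  unfolding psections_iff
proof (intro conjI ballI allI impI)
  show "scal a (Y u) + Z u \<in> T (fst u)" if "u \<in> TM0" for u
    by (intro tangent_lincomb psec_tangent Y Z that)
  fix u f assume u: "u \<in> TM0" and f: "smooth_at M (fst u) f"
  show "smooth_at (slit M) u (\<lambda>w. (scal a (Y w) + Z w) f)"
    using slit.smooth_at_add[OF slit.smooth_at_cmult[OF psec_smooth[OF Y u f]] psec_smooth[OF Z u f]]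
    by (simp add: scal_def)
qed

lemma psec_zero: "(\<lambda>u. 0) \<in> Sec"
  unfolding psections_iff by (simp add: zero_tangent slit.smooth_at_const)

lemma psec_diff: "Y \<in> Sec \<Longrightarrow> Z \<in> Sec \<Longrightarrow> (\<lambda>u. Y u - Z u) \<in> Sec"
  using psec_lincomb[of Z Y "-1"] by (simp add: scal_def fun_diff_def plus_fun_def)

lemma eta_psec: "eta \<in> Sec"
  unfolding psections_iff
proof (intro conjI ballI allI impI)
  show "eta u \<in> T (fst u)" if "u \<in> TM0" for u using slit_carrierD(2)[OF that] by (simp add: eta_def)
  fix u f assume u: "u \<in> TM0" and f: "smooth_at M (fst u) f"
  obtain U \<phi> where c: "(U, \<phi>) \<in> M" "fst u \<in> U" "u \<in> sdom M U" using slit_obtain_chart[OF u] .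
  obtain N where N: "open N" "\<phi> (fst u) \<in> N" "N \<subseteq> \<phi> ` U" "smooth_on N (f \<circ> inv_into U \<phi>)"
    using smooth_at_rep[OF c(1,2) f] .
  have op: "open (N \<times> - {0::'e})" by (intro open_Times N(1) open_slit_fibre)
  show "smooth_at (slit M) u (\<lambda>w. eta w f)"
  proof (rule slit_smooth_at_of_rep[OF c(1,3) N(1-3)])
    show "smooth_on (N \<times> - {0}) (\<lambda>z. frechet_derivative (f \<circ> inv_into U \<phi>) (at (fst z)) (snd z))"
      by (rule smooth_on_frechet_compose[OF N(1) op N(4) smooth_on_linear[OF op bounded_linear_fst] _
          smooth_on_linear[OF op bounded_linear_snd]]) auto
    fix q assume q: "q \<in> sdom M U" "\<phi> (fst q) \<in> N"
    have qU: "fst q \<in> U" "snd q \<in> T (fst q)" using q(1) by (auto simp: sdom_iff)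
    have "smooth_at M (fst q) f"
      by (rule smooth_at_of_rep[OF c(1) qU(1) N(1) q(2) N(3,4)]) (simp add: chart_inv[OF c(1)])
    then show "eta q f = frechet_derivative (f \<circ> inv_into U \<phi>) (at (fst (schart \<phi> q))) (snd (schart \<phi> q))"
      using tv_chart[OF c(1) qU] by (simp add: schart_def eta_def)
  qed
qed

subsection \<open>The morphism rho\<close>

lemma rho_apply: "smooth_at M (fst u) f \<Longrightarrow> rho M u X f = X (f \<circ> fst)"
  by (simp add: rho_def differential_def)

lemma rho_nonsmooth: "\<not> smooth_at M (fst u) f \<Longrightarrow> rho M u X f = 0"
  by (simp add: rho_def differential_def)

lemma rho_add: "rho M u (X + Y) = rho M u X + rho M u Y"
  by (auto simp: rho_def differential_def)

lemma rho_diff: "rho M u (X - Y) = rho M u X - rho M u Y"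
  by (auto simp: rho_def differential_def)

lemma rho_zero: "rho M u 0 = 0"
  by (auto simp: rho_def differential_def)

lemma rho_tangent:
  assumes u: "u \<in> TM0" and X: "X \<in> TT u"
  shows "rho M u X \<in> T (fst u)"
  unfolding tangent_space_def
proof (intro CollectI conjI allI impI)
  fix f g a b assume fg: "smooth_at M (fst u) f \<and> smooth_at M (fst u) g"
  then have "smooth_at M (fst u) (\<lambda>q. a * f q + b * g q)" by (intro smooth_at_add smooth_at_cmult) auto
  then show "rho M u X (\<lambda>q. a * f q + b * g q) = a * rho M u X f + b * rho M u X g"
    using slit.tv_lin[OF X smooth_at_base[OF u, of f] smooth_at_base[OF u, of g], of a b] fg
    by (simp add: rho_apply o_def)
next
  fix f g assume fg: "smooth_at M (fst u) f \<and> smooth_at M (fst u) g"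
  then have "smooth_at M (fst u) (\<lambda>q. f q * g q)" by (intro smooth_at_mult) auto
  then show "rho M u X (\<lambda>q. f q * g q) = rho M u X f * g (fst u) + f (fst u) * rho M u X g"
    using slit.tv_mult[OF X smooth_at_base[OF u, of f] smooth_at_base[OF u, of g]] fg
    by (simp add: rho_apply o_def)
next
  fix f g W assume a: "smooth_at M (fst u) f \<and> smooth_at M (fst u) g \<and>
    openin (manifold_topology M) W \<and> fst u \<in> W \<and> (\<forall>q\<in>W. f q = g q)"
  then have "X (f \<circ> fst) = X (g \<circ> fst)"
    by (intro slit.tv_cong[OF X openin_base_preimage[of W]]) (use u in auto)
  then show "rho M u X f = rho M u X g" using a by (simp add: rho_apply)
next
  fix f assume "\<not> smooth_at M (fst u) f"
  then show "rho M u X f = 0" by (rule rho_nonsmooth)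
qed

lemma rho_psec:
  assumes X: "X \<in> VF"
  shows "(\<lambda>u. rho M u (X u)) \<in> Sec"
  unfolding psections_iff
proof (intro conjI ballI allI impI)
  show "rho M u (X u) \<in> T (fst u)" if "u \<in> TM0" for u by (rule rho_tangent[OF that slit.vf_tangent[OF X that]])
  fix u f assume u: "u \<in> TM0" and f: "smooth_at M (fst u) f"
  obtain W where W: "openin (manifold_topology (slit M)) W" "u \<in> W" "\<And>q. q \<in> W \<Longrightarrow> q \<in> TM0 \<and> smooth_at M (fst q) f"
    by (rule base_nbhd[OF u f], rule that)
  show "smooth_at (slit M) u (\<lambda>w. rho M w (X w) f)"
    by (rule slit.smooth_at_cong[OF W(1,2) _ slit.vf_smooth[OF X smooth_at_base[OF u f]]])
      (simp add: W(3) rho_apply)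
qed

subsection \<open>The morphism gamma\<close>

lemma schart_line:
  assumes "(U, \<phi>) \<in> M" "u \<in> sdom M U"
  shows "schart \<phi> (fst u, snd u + scal s v) = schart \<phi> u + s *\<^sub>R (0, tvec_components \<phi> v)"
  by (simp add: schart_def tvec_components_plus tvec_components_scal)

lemma eventually_line_slit:
  assumes u: "u \<in> TM0" and v: "v \<in> T (fst u)"
  shows "\<forall>\<^sub>F s in nhds 0. (fst u, snd u + scal s v) \<in> TM0"
proof -
  obtain U \<phi> where c: "(U, \<phi>) \<in> M" "fst u \<in> U" "u \<in> sdom M U" using slit_obtain_chart[OF u] .
  let ?y = "\<lambda>s. tvec_components \<phi> (snd u) + s *\<^sub>R tvec_components \<phi> v"
  have y0: "?y 0 \<noteq> 0" using components_eq_0_iff[OF c(1,2)] c(3) by (simp add: sdom_iff)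
  have "(?y \<longlongrightarrow> ?y 0) (nhds 0)" by (intro tendsto_intros filterlim_ident)
  then have "\<forall>\<^sub>F s in nhds 0. ?y s \<noteq> 0" using tendsto_imp_eventually_ne y0 by blast
  then show ?thesis
  proof (rule eventually_mono)
    fix s assume s: "?y s \<noteq> 0"
    have Ts: "snd u + scal s v \<in> T (fst u)"
      using tangent_add[OF _ tangent_scal[OF v]] c(3) by (simp add: sdom_iff)
    have "tvec_components \<phi> (snd u + scal s v) \<noteq> 0"
      using s by (simp add: tvec_components_plus tvec_components_scal)
    then have "snd u + scal s v \<noteq> 0" using tvec_components_0 by metis
    then show "(fst u, snd u + scal s v) \<in> TM0" using Ts slit_carrierD(1)[OF u] by (simp add: carrier_slit_iff)
  qed
qed

text \<open>All derivatives along a fibre are computed with this rule: in the chart, the line \<open>u + s v\<close> is straight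
  and moves in the direction \<open>(0, v)\<close> only.\<close>

lemma line_has_derivative:
  assumes c: "(U, \<phi>) \<in> M" "u \<in> sdom M U" and v: "v \<in> T (fst u)"
    and h: "(h has_derivative h') (at (schart \<phi> u))"
    and eq: "\<forall>\<^sub>F s in nhds 0. (fst u, snd u + scal s v) \<in> TM0 \<longrightarrow> F s = h (schart \<phi> (fst u, snd u + scal s v))"
  shows "(F has_real_derivative h' (0, tvec_components \<phi> v)) (at 0)"
proof -
  let ?l = "\<lambda>s. schart \<phi> u + s *\<^sub>R (0, tvec_components \<phi> v)"
  have "(h has_derivative h') (at (?l 0))" using h by (simp add: zero_prod_def[symmetric])
  then have "((\<lambda>s. h (?l s)) has_derivative (\<lambda>s. h' (s *\<^sub>R (0, tvec_components \<phi> v)))) (at 0)"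
    by (rule has_derivative_compose[rotated]) (auto intro!: derivative_eq_intros)
  moreover have "h' (s *\<^sub>R (0, tvec_components \<phi> v)) = h' (0, tvec_components \<phi> v) * s" for s
    using linear_cmul[OF has_derivative_linear[OF h], of s "(0, tvec_components \<phi> v)"] by simp
  ultimately have "((\<lambda>s. h (?l s)) has_real_derivative h' (0, tvec_components \<phi> v)) (at 0)"
    unfolding has_field_derivative_def by simp
  moreover have "\<forall>\<^sub>F s in nhds 0. h (?l s) = F s"
    using eventually_line_slit[OF sdom_subset[OF c] v] eq
    by eventually_elim (simp add: schart_line[OF c])
  ultimately show ?thesis by (simp only: DERIV_cong_ev[OF refl _ refl])
qed

lemma smooth_rep_slit:
  assumes c: "(U, \<phi>) \<in> M" "u \<in> sdom M U" and F: "smooth_at (slit M) u F"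
  shows "((F \<circ> sinv U \<phi>) has_derivative
    frechet_derivative (F \<circ> sinv U \<phi>) (at (schart \<phi> u))) (at (schart \<phi> u))"
  by (rule slit.rep_has_derivative[OF slit_chart[OF c(1)] c(2) F])

lemma eventually_line_sdom:
  assumes c: "(U, \<phi>) \<in> M" "u \<in> sdom M U" and v: "v \<in> T (fst u)"
  shows "\<forall>\<^sub>F s in nhds 0. (fst u, snd u + scal s v) \<in> sdom M U"
  using eventually_line_slit[OF sdom_subset[OF c] v]
  by (rule eventually_mono) (use c(2) in \<open>auto simp: sdom_iff carrier_slit_iff\<close>)

lemma line_deriv_chart:
  assumes c: "(U, \<phi>) \<in> M" "u \<in> sdom M U" and v: "v \<in> T (fst u)" and F: "smooth_at (slit M) u F"
  shows "((\<lambda>s. F (fst u, snd u + scal s v)) has_real_derivative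
    frechet_derivative (F \<circ> sinv U \<phi>) (at (schart \<phi> u)) (0, tvec_components \<phi> v)) (at 0)"
proof (rule line_has_derivative[OF c v smooth_rep_slit[OF c F]])
  show "\<forall>\<^sub>F s in nhds 0. (fst u, snd u + scal s v) \<in> TM0 \<longrightarrow> F (fst u, snd u + scal s v) =
      (F \<circ> sinv U \<phi>) (schart \<phi> (fst u, snd u + scal s v))"
    using eventually_line_sdom[OF c v]
    by (rule eventually_mono) (simp add: slit.chart_inv[OF slit_chart[OF c(1)]])
qed

lemma gamma_chart:
  assumes c: "(U, \<phi>) \<in> M" "u \<in> sdom M U" and v: "v \<in> T (fst u)"
  shows "gamma M u v = coord_vec (slit M) (sdom M U) (schart \<phi>) u (0, tvec_components \<phi> v)"
proof
  fix F
  have "(fst u, snd u + scal 0 v) = u" by (simp add: scal_def plus_fun_def)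
  then show "gamma M u v F = coord_vec (slit M) (sdom M U) (schart \<phi>) u (0, tvec_components \<phi> v) F"
    using DERIV_imp_deriv[OF line_deriv_chart[OF c v, of F]]
    by (simp add: gamma_def velocity_def coord_vec_def)
qed

lemma gamma_deriv:
  assumes u: "u \<in> TM0" and v: "v \<in> T (fst u)" and F: "smooth_at (slit M) u F"
  shows "((\<lambda>s. F (fst u, snd u + scal s v)) has_real_derivative gamma M u v F) (at 0)"
proof -
  obtain U \<phi> where c: "(U, \<phi>) \<in> M" "fst u \<in> U" "u \<in> sdom M U" using slit_obtain_chart[OF u] .
  show ?thesis using line_deriv_chart[OF c(1,3) v F] F unfolding gamma_chart[OF c(1,3) v] coord_vec_def by simp
qed

lemma gamma_eqI:
  "u \<in> TM0 \<Longrightarrow> v \<in> T (fst u) \<Longrightarrow> smooth_at (slit M) u F \<Longrightarrow>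
    ((\<lambda>s. F (fst u, snd u + scal s v)) has_real_derivative d) (at 0) \<Longrightarrow> gamma M u v F = d"
  using DERIV_unique[OF gamma_deriv] .

lemma gamma_tangent:
  assumes u: "u \<in> TM0" and v: "v \<in> T (fst u)"
  shows "gamma M u v \<in> TT u"
proof -
  obtain U \<phi> where c: "(U, \<phi>) \<in> M" "fst u \<in> U" "u \<in> sdom M U" using slit_obtain_chart[OF u] .
  show ?thesis unfolding gamma_chart[OF c(1,3) v] by (rule slit.coord_vec_tangent[OF slit_chart[OF c(1)] c(3)])
qed

lemma gamma_lincomb:
  assumes u: "u \<in> TM0" and v: "v \<in> T (fst u)" and w: "w \<in> T (fst u)"
  shows "gamma M u (scal a v + w) = scal a (gamma M u v) + gamma M u w"
proof -
  obtain U \<phi> where c: "(U, \<phi>) \<in> M" "fst u \<in> U" "u \<in> sdom M U" using slit_obtain_chart[OF u] .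
  note sc = slit_chart[OF c(1)]
  have "(0::'e, tvec_components \<phi> (scal a v + w)) = a *\<^sub>R (0, tvec_components \<phi> v) + (0, tvec_components \<phi> w)"
    by (simp add: tvec_components_plus tvec_components_scal)
  then have "gamma M u (scal a v + w) = coord_vec (slit M) (sdom M U) (schart \<phi>) u
      (a *\<^sub>R (0, tvec_components \<phi> v) + (0, tvec_components \<phi> w))"
    using gamma_chart[OF c(1,3) tangent_lincomb[OF v w, of a]] by (simp only:)
  then show ?thesis
    unfolding slit.coord_vec_add[OF sc c(3)] slit.coord_vec_scale[OF sc c(3)]
      gamma_chart[OF c(1,3) v] gamma_chart[OF c(1,3) w] .
qed

lemma gamma_add:
  "u \<in> TM0 \<Longrightarrow> v \<in> T (fst u) \<Longrightarrow> w \<in> T (fst u) \<Longrightarrow> gamma M u (v + w) = gamma M u v + gamma M u w"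
  using gamma_lincomb[of u v w 1] by (simp add: scal_def)

lemma gamma_diff:
  "u \<in> TM0 \<Longrightarrow> v \<in> T (fst u) \<Longrightarrow> w \<in> T (fst u) \<Longrightarrow> gamma M u (v - w) = gamma M u v - gamma M u w"
  using gamma_lincomb[of u w v "-1"] by (simp add: scal_def fun_diff_def plus_fun_def)

lemma gamma_zero: "u \<in> TM0 \<Longrightarrow> gamma M u 0 = 0"
  using gamma_lincomb[OF _ zero_tangent zero_tangent, of u "-1"] by (simp add: scal_def zero_fun_def plus_fun_def)

text \<open>Functions pulled back from the base are constant on the fibres.\<close>

lemma gamma_base:
  assumes u: "u \<in> TM0" and v: "v \<in> T (fst u)"
  shows "gamma M u v (f \<circ> fst) = 0"
proof (cases "smooth_at (slit M) u (f \<circ> fst)")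
  case True
  show ?thesis by (rule gamma_eqI[OF u v True]) simp
next
  case False
  then show ?thesis by (rule slit.tv_notsmooth[OF gamma_tangent[OF u v]])
qed

lemma rho_gamma: "u \<in> TM0 \<Longrightarrow> v \<in> T (fst u) \<Longrightarrow> rho M u (gamma M u v) = 0"
  by (auto simp: rho_def differential_def gamma_base)

text \<open>The function \<open>u \<mapsto> \<eta>\<^sub>u f\<close> is linear on the fibres.\<close>

lemma gamma_eta:
  assumes u: "u \<in> TM0" and v: "v \<in> T (fst u)" and f: "smooth_at M (fst u) f"
  shows "gamma M u v (\<lambda>w. eta w f) = v f"
  by (rule gamma_eqI[OF u v psec_smooth[OF eta_psec u f]])
    (auto simp: eta_def scal_def intro!: derivative_eq_intros)

lemma psec_components_smooth:
  assumes c: "(U, \<phi>) \<in> M" and X: "X \<in> Sec"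
  shows "smooth_on (schart \<phi> ` sdom M U) (\<lambda>z. tvec_components \<phi> (X (sinv U \<phi> z)))"
proof (rule smooth_on_components[OF slit.chart_open[OF slit_chart[OF c]]])
  fix i :: 'e assume i: "i \<in> Basis"
  have "smooth_on (schart \<phi> ` sdom M U) ((\<lambda>q. X q (\<lambda>q. \<phi> q \<bullet> i)) \<circ> sinv U \<phi>)"
  proof (rule slit.smooth_on_of_smooth_at[OF slit_chart[OF c]])
    show "smooth_at (slit M) q (\<lambda>q. X q (\<lambda>q. \<phi> q \<bullet> i))" if "q \<in> sdom M U" for q
      using psec_smooth[OF X sdom_subset[OF c that] smooth_at_coord[OF c]] that by (simp add: sdom_iff)
  qed simp
  then show "smooth_on (schart \<phi> ` sdom M U) (\<lambda>x. tvec_components \<phi> (X (sinv U \<phi> x)) \<bullet> i)"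
    by (simp add: tvec_components_inner[OF i] o_def)
qed

lemma gamma_vf:
  assumes X: "X \<in> Sec"
  shows "(\<lambda>u. gamma M u (X u)) \<in> VF"
  unfolding slit.vector_fields_iff
proof (intro conjI ballI allI impI)
  show "gamma M u (X u) \<in> TT u" if "u \<in> TM0" for u
    by (rule gamma_tangent[OF that psec_tangent[OF X that]])
  fix u F assume F: "smooth_at (slit M) u F"
  have u: "u \<in> TM0" using slit.smooth_at_carrier[OF F] .
  obtain U \<phi> where c: "(U, \<phi>) \<in> M" "fst u \<in> U" "u \<in> sdom M U" using slit_obtain_chart[OF u] .
  note sc = slit_chart[OF c(1)]
  let ?i = "sinv U \<phi>"
  obtain N where N: "open N" "schart \<phi> u \<in> N" "N \<subseteq> schart \<phi> ` sdom M U" "smooth_on N (F \<circ> ?i)"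
    using slit.smooth_at_rep[OF sc c(3) F] .
  have "smooth_on (schart \<phi> ` sdom M U) (\<lambda>z. tvec_components \<phi> (X (?i z)))"
    by (rule psec_components_smooth[OF c(1) X])
  then have cN: "smooth_on N (\<lambda>z. (0::'e, tvec_components \<phi> (X (?i z))))"
    by (intro smooth_on_Pair N(1) smooth_on_const) (rule smooth_on_subset[OF _ N(3)])
  show "smooth_at (slit M) u (\<lambda>q. gamma M q (X q) F)"
  proof (rule slit.smooth_at_of_rep[OF sc c(3) N(1-3) smooth_on_frechet[OF N(1,4) cN]])
    fix q assume q: "q \<in> sdom M U" "schart \<phi> q \<in> N"
    have "smooth_at (slit M) q F"
      by (rule slit.smooth_at_of_rep[OF sc q(1) N(1) q(2) N(3,4)]) (simp add: slit.chart_inv[OF sc])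
    then show "gamma M q (X q) F = frechet_derivative (F \<circ> ?i) (at (schart \<phi> q)) (0, tvec_components \<phi> (X (?i (schart \<phi> q))))"
      using gamma_chart[OF c(1) q(1) psec_tangent[OF X sdom_subset[OF c(1) q(1)]]] slit.chart_inv[OF sc q(1)]
      by (simp add: coord_vec_def)
  qed
qed

end

text \<open>The derivative of the section \<open>Z\<close> along the fibre in the direction \<open>y\<close>.  It exists without a connection,
  because the fibres of the pullback bundle over one point of the base are all the same vector space.\<close>

definition fibre_deriv :: "('m, 'e::euclidean_space) atlas \<Rightarrow> 'm tpoint \<Rightarrow> 'm tvec \<Rightarrow> 'm psection \<Rightarrow> 'm tvec" where
  "fibre_deriv M u y Z = (\<lambda>f. if smooth_at M (fst u) f then gamma M u y (\<lambda>q. Z q f) else 0)"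

text \<open>The product rule for \<open>x \<mapsto> DF\<^sub>x(c\<^sub>x)\<close>.  The first term differentiates \<open>DF\<close> with \<open>c\<close> frozen at \<open>z\<close>; for the energy this
  term will be the Hessian.\<close>

lemma frechet_derivative_section:
  fixes F :: "'a::euclidean_space \<Rightarrow> real"
  assumes S: "open S" "z \<in> S" and F: "smooth_on S F" and c: "(c has_derivative c') (at z)"
  shows "((\<lambda>x. frechet_derivative F (at x) (c x)) has_derivative
    (\<lambda>v. frechet_derivative (\<lambda>x. frechet_derivative F (at x) (c z)) (at z) v
       + frechet_derivative F (at z) (c' v))) (at z)"
proof -
  let ?D = "\<lambda>x. frechet_derivative F (at x)"
  let ?H = "\<lambda>b. frechet_derivative (\<lambda>x. ?D x b) (at z)"
  have H: "((\<lambda>x. ?D x b) has_derivative ?H b) (at z)" for b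
    by (rule smooth_on_has_derivative[OF smooth_on_frechet_const[OF F] S(2)])
  have ex: "?D x b = (\<Sum>i\<in>Basis. (b \<bullet> i) * ?D x i)" if "x \<in> S" for x b
    using linear_basis_expand[OF smooth_on_linear_frechet[OF F that], of b] by simp
  have "((\<lambda>x. \<Sum>i\<in>Basis. (c z \<bullet> i) * ?D x i) has_derivative (\<lambda>v. \<Sum>i\<in>Basis. (c z \<bullet> i) * ?H i v)) (at z)"
    by (intro has_derivative_sum has_derivative_mult_right H)
  then have "((\<lambda>x. ?D x (c z)) has_derivative (\<lambda>v. \<Sum>i\<in>Basis. (c z \<bullet> i) * ?H i v)) (at z)"
    by (rule has_derivative_transform_within_open[OF _ S]) (simp add: ex[of _ "c z"])
  then have Hc: "?H (c z) v = (\<Sum>i\<in>Basis. (c z \<bullet> i) * ?H i v)" for v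
    by (simp add: frechet_derivative_eqI)
  have "((\<lambda>x. \<Sum>i\<in>Basis. (c x \<bullet> i) * ?D x i) has_derivative
      (\<lambda>v. \<Sum>i\<in>Basis. (c z \<bullet> i) * ?H i v + (c' v \<bullet> i) * ?D z i)) (at z)"
    by (intro has_derivative_sum has_derivative_mult has_derivative_inner_left c H)
  then have "((\<lambda>x. ?D x (c x)) has_derivative
      (\<lambda>v. \<Sum>i\<in>Basis. (c z \<bullet> i) * ?H i v + (c' v \<bullet> i) * ?D z i)) (at z)"
    by (rule has_derivative_transform_within_open[OF _ S]) (simp add: ex[symmetric])
  moreover have "(\<Sum>i\<in>Basis. (c z \<bullet> i) * ?H i v + (c' v \<bullet> i) * ?D z i) = ?H (c z) v + ?D z (c' v)" for v
    unfolding Hc ex[OF S(2), of "c' v"] by (rule sum.distrib)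
  ultimately show ?thesis by simp
qed

lemma (in atlas) bracket_antisym: "lie_bracket A X Y p = - lie_bracket A Y X p"
  by (auto simp: lie_bracket_def fun_eq_iff)

lemma (in atlas) bracket_cong:
  assumes p: "p \<in> carrier A" and X: "X p \<in> tangent_space A p" and Y: "Y p \<in> tangent_space A p"
    and eX: "\<And>q. q \<in> carrier A \<Longrightarrow> X' q = X q" and eY: "\<And>q. q \<in> carrier A \<Longrightarrow> Y' q = Y q"
  shows "lie_bracket A X' Y' p = lie_bracket A X Y p"
proof
  fix f
  have "X p (\<lambda>q. Y' q f) = X p (\<lambda>q. Y q f)" by (rule tv_cong_carrier[OF X p]) (simp add: eY)
  moreover have "Y p (\<lambda>q. X' q f) = Y p (\<lambda>q. X q f)" by (rule tv_cong_carrier[OF Y p]) (simp add: eX)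
  ultimately show "lie_bracket A X' Y' p f = lie_bracket A X Y p f"
    by (simp add: lie_bracket_def eX[OF p] eY[OF p])
qed

context base_manifold
begin

subsection \<open>The fibre derivative\<close>

lemma fibre_deriv_apply: "smooth_at M (fst u) f \<Longrightarrow> fibre_deriv M u y Z f = gamma M u y (\<lambda>q. Z q f)"
  by (simp add: fibre_deriv_def)

lemma fibre_deriv_tangent:
  assumes u: "u \<in> TM0" and y: "y \<in> T (fst u)" and Z: "Z \<in> Sec"
  shows "fibre_deriv M u y Z \<in> T (fst u)"
  unfolding tangent_space_def
proof (intro CollectI conjI allI impI)
  note g = gamma_tangent[OF u y]
  fix f h assume fh: "smooth_at M (fst u) f \<and> smooth_at M (fst u) h"
  then have f: "smooth_at M (fst u) f" and h: "smooth_at M (fst u) h" by auto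
  obtain W1 where W1: "openin (manifold_topology (slit M)) W1" "u \<in> W1" "\<And>q. q \<in> W1 \<Longrightarrow> q \<in> TM0 \<and> smooth_at M (fst q) f"
    by (rule base_nbhd[OF u f], rule that)
  obtain W2 where W2: "openin (manifold_topology (slit M)) W2" "u \<in> W2" "\<And>q. q \<in> W2 \<Longrightarrow> q \<in> TM0 \<and> smooth_at M (fst q) h"
    by (rule base_nbhd[OF u h], rule that)
  note W = openin_Int[OF W1(1) W2(1)]
  have uW: "u \<in> W1 \<inter> W2" using W1 W2 by simp
  have Zs: "smooth_at (slit M) u (\<lambda>q. Z q f)" "smooth_at (slit M) u (\<lambda>q. Z q h)"
    using psec_smooth[OF Z u f] psec_smooth[OF Z u h] .
  { fix a b
    have "gamma M u y (\<lambda>q. Z q (\<lambda>q. a * f q + b * h q)) = gamma M u y (\<lambda>q. a * Z q f + b * Z q h)"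
    proof (rule slit.tv_cong[OF g W uW])
      fix q assume "q \<in> W1 \<inter> W2"
      then have q: "q \<in> TM0" "smooth_at M (fst q) f" "smooth_at M (fst q) h" using W1(3) W2(3) by auto
      show "Z q (\<lambda>q. a * f q + b * h q) = a * Z q f + b * Z q h"
        by (rule tv_lin[OF psec_tangent[OF Z q(1)] q(2,3)])
    qed
    also have "\<dots> = a * gamma M u y (\<lambda>q. Z q f) + b * gamma M u y (\<lambda>q. Z q h)"
      by (rule slit.tv_lin[OF g Zs])
    finally show "fibre_deriv M u y Z (\<lambda>q. a * f q + b * h q) = a * fibre_deriv M u y Z f + b * fibre_deriv M u y Z h"
      using f h smooth_at_add[OF smooth_at_cmult[OF f] smooth_at_cmult[OF h]] by (simp add: fibre_deriv_apply) }
  have "gamma M u y (\<lambda>q. Z q (\<lambda>q. f q * h q)) = gamma M u y (\<lambda>q. Z q f * (h \<circ> fst) q + (f \<circ> fst) q * Z q h)"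
  proof (rule slit.tv_cong[OF g W uW])
    fix q assume "q \<in> W1 \<inter> W2"
    then have q: "q \<in> TM0" "smooth_at M (fst q) f" "smooth_at M (fst q) h" using W1(3) W2(3) by auto
    show "Z q (\<lambda>q. f q * h q) = Z q f * (h \<circ> fst) q + (f \<circ> fst) q * Z q h"
      using tv_mult[OF psec_tangent[OF Z q(1)] q(2,3)] by simp
  qed
  also have "\<dots> = gamma M u y (\<lambda>q. Z q f * (h \<circ> fst) q) + gamma M u y (\<lambda>q. (f \<circ> fst) q * Z q h)"
    by (rule slit.tv_add[OF g slit.smooth_at_mult[OF Zs(1) smooth_at_base[OF u h]]
        slit.smooth_at_mult[OF smooth_at_base[OF u f] Zs(2)]])
  also have "\<dots> = gamma M u y (\<lambda>q. Z q f) * h (fst u) + f (fst u) * gamma M u y (\<lambda>q. Z q h)"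
    using slit.tv_mult[OF g Zs(1) smooth_at_base[OF u h]] slit.tv_mult[OF g smooth_at_base[OF u f] Zs(2)]
      gamma_base[OF u y] by simp
  finally show "fibre_deriv M u y Z (\<lambda>q. f q * h q) = fibre_deriv M u y Z f * h (fst u) + f (fst u) * fibre_deriv M u y Z h"
    using f h smooth_at_mult[OF f h] by (simp add: fibre_deriv_apply)
next
  note g = gamma_tangent[OF u y]
  fix f h W assume a: "smooth_at M (fst u) f \<and> smooth_at M (fst u) h \<and>
    openin (manifold_topology M) W \<and> fst u \<in> W \<and> (\<forall>q\<in>W. f q = h q)"
  then have W: "openin (manifold_topology M) W" by simp
  have "gamma M u y (\<lambda>q. Z q f) = gamma M u y (\<lambda>q. Z q h)"
  proof (rule slit.tv_cong[OF g openin_base_preimage[OF W]])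
    show "u \<in> {u \<in> TM0. fst u \<in> W}" using a u by simp
    fix q assume q: "q \<in> {u \<in> TM0. fst u \<in> W}"
    then have q1: "q \<in> TM0" "fst q \<in> W" by simp_all
    show "Z q f = Z q h" by (rule tv_cong[OF psec_tangent[OF Z q1(1)] W q1(2)]) (use a in simp)
  qed
  then show "fibre_deriv M u y Z f = fibre_deriv M u y Z h" using a by (simp add: fibre_deriv_apply)
next
  fix f assume "\<not> smooth_at M (fst u) f"
  then show "fibre_deriv M u y Z f = 0" by (simp add: fibre_deriv_def)
qed

lemma fibre_deriv_psec:
  assumes Y: "Y \<in> Sec" and Z: "Z \<in> Sec"
  shows "(\<lambda>u. fibre_deriv M u (Y u) Z) \<in> Sec"
  unfolding psections_iff
proof (intro conjI ballI allI impI)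
  show "fibre_deriv M u (Y u) Z \<in> T (fst u)" if "u \<in> TM0" for u
    by (rule fibre_deriv_tangent[OF that psec_tangent[OF Y that] Z])
  fix u f assume u: "u \<in> TM0" and f: "smooth_at M (fst u) f"
  obtain W where W: "openin (manifold_topology (slit M)) W" "u \<in> W" "\<And>q. q \<in> W \<Longrightarrow> q \<in> TM0 \<and> smooth_at M (fst q) f"
    by (rule base_nbhd[OF u f], rule that)
  show "smooth_at (slit M) u (\<lambda>w. fibre_deriv M w (Y w) Z f)"
    by (rule slit.smooth_at_cong[OF W(1,2) _ slit.vf_smooth[OF gamma_vf[OF Y] psec_smooth[OF Z u f]]])
      (simp add: W(3) fibre_deriv_apply)
qed

lemma fibre_deriv_cong:
  assumes u: "u \<in> TM0" and y: "y \<in> T (fst u)" and eq: "\<And>q. q \<in> TM0 \<Longrightarrow> Z q = Z' q"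
  shows "fibre_deriv M u y Z = fibre_deriv M u y Z'"
  unfolding fibre_deriv_def using slit.tv_cong_carrier[OF gamma_tangent[OF u y] u] eq by (metis (no_types, lifting))

lemma fibre_deriv_eta:
  assumes u: "u \<in> TM0" and y: "y \<in> T (fst u)"
  shows "fibre_deriv M u y eta = y"
  using gamma_eta[OF u y] tv_notsmooth[OF y] by (auto simp: fibre_deriv_def)

text \<open>Apply \<open>[\<gamma>X, W]\<close> to a function \<open>f\<close> pulled back from the base: \<open>W \<cdot> (\<gamma>X \<cdot> f)\<close> vanishes since \<open>\<gamma>X\<close> annihilates \<open>f\<close>, and
  \<open>W \<cdot> f\<close> is determined by \<open>\<rho>W\<close>.  Only the value of \<open>W\<close> at \<open>u\<close> is required to be a tangent vector, so that the
  lemma applies to horizontal lifts whose smoothness has not been established yet.\<close>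

lemma rho_bracket:
  assumes u: "u \<in> TM0" and X: "X \<in> Sec" and W: "W u \<in> TT u"
  shows "rho M u (lie (\<lambda>w. gamma M w (X w)) W u) = fibre_deriv M u (X u) (\<lambda>q. rho M q (W q))"
proof
  fix f
  note Xu = psec_tangent[OF X u]
  show "rho M u (lie (\<lambda>w. gamma M w (X w)) W u) f = fibre_deriv M u (X u) (\<lambda>q. rho M q (W q)) f"
  proof (cases "smooth_at M (fst u) f")
    case True
    obtain N where N: "openin (manifold_topology (slit M)) N" "u \<in> N" "\<And>q. q \<in> N \<Longrightarrow> q \<in> TM0 \<and> smooth_at M (fst q) f"
      by (rule base_nbhd[OF u True], rule that)
    have "W u (\<lambda>q. gamma M q (X q) (f \<circ> fst)) = W u (\<lambda>q. 0)"
      by (rule slit.tv_cong_carrier[OF W u]) (simp add: gamma_base psec_tangent[OF X])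
    then have "W u (\<lambda>q. gamma M q (X q) (f \<circ> fst)) = 0" using slit.tv_const[OF W] by simp
    moreover have "gamma M u (X u) (\<lambda>q. W q (f \<circ> fst)) = gamma M u (X u) (\<lambda>q. rho M q (W q) f)"
      by (rule slit.tv_cong[OF gamma_tangent[OF u Xu] N(1,2)]) (simp add: N(3) rho_apply)
    ultimately show ?thesis
      using slit.bracket_apply[OF smooth_at_base[OF u True]] by (simp add: rho_apply[OF True] fibre_deriv_apply[OF True])
  next
    case False
    then show ?thesis by (simp add: rho_nonsmooth fibre_deriv_def)
  qed
qed

end

section \<open>The Finsler metric\<close>

locale finsler = base_manifold M for M :: "('m, 'e::euclidean_space) atlas" +
  fixes L :: "'m tpoint \<Rightarrow> real"
  assumes finsler: "finsler_manifold M L"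
begin

abbreviation "E \<equiv> energy L"
abbreviation "g \<equiv> finsler_metric L"
abbreviation "dE u y \<equiv> gamma M u y E"

lemma L_smooth: "u \<in> TM0 \<Longrightarrow> smooth_at (slit M) u L"
  using finsler slit.smooth_fun_carrier[of L] unfolding finsler_manifold_def by blast

lemma E_smooth: "u \<in> TM0 \<Longrightarrow> smooth_at (slit M) u E"
  using slit.smooth_at_cmult[OF slit.smooth_at_mult[OF L_smooth L_smooth], of u "1/2"]
  by (simp add: energy_def[abs_def] power2_eq_square)

lemma tangent_bundle_carrier:
  assumes "p \<in> carrier M" "v \<in> T p" shows "(p, v) \<in> carrier (tangent_bundle M)"
proof -
  obtain U \<phi> where c: "(U, \<phi>) \<in> M" "p \<in> U" using carrier_chart[OF assms(1)] by metis
  have "({(p, v). p \<in> U \<and> v \<in> T p}, \<lambda>(p, v). (\<phi> p, tvec_components \<phi> v)) \<in> tangent_bundle M"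
    unfolding tangent_bundle_def using c(1) by (rule rev_image_eqI) simp
  then show ?thesis unfolding carrier_def by (rule UnionI[OF imageI]) (use c(2) assms in simp)
qed

lemma L_scale:
  assumes u: "u \<in> TM0" and "c > 0" shows "L (fst u, scal c (snd u)) = c * L u"
proof -
  have "\<forall>(p, v)\<in>carrier (tangent_bundle M). \<forall>c>0. L (p, scal c v) = c * L (p, v)"
    using finsler unfolding finsler_manifold_def by simp
  moreover have "(fst u, snd u) \<in> carrier (tangent_bundle M)"
    by (rule tangent_bundle_carrier[OF slit_carrierD(1)[OF u] slit_carrierD(2)[OF u]])
  ultimately show ?thesis using \<open>c > 0\<close> by fastforce
qed

lemma g_pos: "u \<in> TM0 \<Longrightarrow> v \<in> T (fst u) \<Longrightarrow> v \<noteq> 0 \<Longrightarrow> g u v v > 0"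
  using finsler unfolding finsler_manifold_def by simp

lemma E_rep_smooth:
  "(U, \<phi>) \<in> M \<Longrightarrow> smooth_on (schart \<phi> ` sdom M U) (E \<circ> sinv U \<phi>)"
  by (rule slit.smooth_on_of_smooth_at[OF slit_chart]) (auto intro: E_smooth sdom_subset)

lemma dE_chart:
  assumes c: "(U, \<phi>) \<in> M" "u \<in> sdom M U" and y: "y \<in> T (fst u)"
  shows "dE u y = frechet_derivative (E \<circ> sinv U \<phi>) (at (schart \<phi> u)) (0, tvec_components \<phi> y)"
  using E_smooth[OF sdom_subset[OF c]] unfolding gamma_chart[OF c y] coord_vec_def by simp

lemma dE_line_deriv:
  assumes c: "(U, \<phi>) \<in> M" "u \<in> sdom M U" and v: "v \<in> T (fst u)" and w: "w \<in> T (fst u)"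
  shows "((\<lambda>s. dE (fst u, snd u + scal s v) w) has_real_derivative
    frechet_derivative (\<lambda>z. frechet_derivative (E \<circ> sinv U \<phi>) (at z) (0, tvec_components \<phi> w))
      (at (schart \<phi> u)) (0, tvec_components \<phi> v)) (at 0)"
proof (rule line_has_derivative[OF c v])
  show "((\<lambda>z. frechet_derivative (E \<circ> sinv U \<phi>) (at z) (0, tvec_components \<phi> w)) has_derivative
    frechet_derivative (\<lambda>z. frechet_derivative (E \<circ> sinv U \<phi>) (at z) (0, tvec_components \<phi> w))
      (at (schart \<phi> u))) (at (schart \<phi> u))"
    by (rule smooth_on_has_derivative[OF smooth_on_frechet_const[OF E_rep_smooth[OF c(1)]]]) (use c in simp)
  show "\<forall>\<^sub>F s in nhds 0. (fst u, snd u + scal s v) \<in> TM0 \<longrightarrow> dE (fst u, snd u + scal s v) w =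
    frechet_derivative (E \<circ> sinv U \<phi>) (at (schart \<phi> (fst u, snd u + scal s v))) (0, tvec_components \<phi> w)"
    using eventually_line_sdom[OF c v]
    by (rule eventually_mono) (simp add: dE_chart[OF c(1)] w)
qed

lemma g_inner:
  assumes u: "u \<in> TM0" and v: "v \<in> T (fst u)" and w: "w \<in> T (fst u)"
  shows "\<forall>\<^sub>F s in nhds 0. deriv (\<lambda>t. E (fst u, snd u + scal s v + scal t w)) 0 = dE (fst u, snd u + scal s v) w"
  using eventually_line_slit[OF u v]
proof (rule eventually_mono)
  fix s assume "(fst u, snd u + scal s v) \<in> TM0"
  from gamma_deriv[OF this _ E_smooth[OF this], of w] w
  show "deriv (\<lambda>t. E (fst u, snd u + scal s v + scal t w)) 0 = dE (fst u, snd u + scal s v) w"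
    by (intro DERIV_imp_deriv) simp
qed

lemma g_deriv_chart:
  assumes c: "(U, \<phi>) \<in> M" "u \<in> sdom M U" and v: "v \<in> T (fst u)" and w: "w \<in> T (fst u)"
  shows "g u v w = frechet_derivative (\<lambda>z. frechet_derivative (E \<circ> sinv U \<phi>) (at z) (0, tvec_components \<phi> w))
      (at (schart \<phi> u)) (0, tvec_components \<phi> v)"
  unfolding finsler_metric_def
proof (rule DERIV_imp_deriv)
  have "\<forall>\<^sub>F s in nhds 0. dE (fst u, snd u + scal s v) w = deriv (\<lambda>t. E (fst u, snd u + scal s v + scal t w)) 0"
    using g_inner[OF sdom_subset[OF c] v w] by (rule eventually_mono) simp
  then show "((\<lambda>s. deriv (\<lambda>t. E (fst u, snd u + scal s v + scal t w)) 0) has_real_derivative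
    frechet_derivative (\<lambda>z. frechet_derivative (E \<circ> sinv U \<phi>) (at z) (0, tvec_components \<phi> w))
      (at (schart \<phi> u)) (0, tvec_components \<phi> v)) (at 0)"
    using dE_line_deriv[OF c v w] by (simp only: DERIV_cong_ev[OF refl _ refl])
qed

text \<open>The Hessian as one derivative of the fibre differential of \<open>E\<close>; unlike the iterated derivative in the
  definition of \<open>g\<close>, this form shows linearity in the second argument.\<close>

lemma g_deriv:
  assumes u: "u \<in> TM0" and v: "v \<in> T (fst u)" and w: "w \<in> T (fst u)"
  shows "((\<lambda>s. dE (fst u, snd u + scal s v) w) has_real_derivative g u v w) (at 0)"
proof -
  obtain U \<phi> where c: "(U, \<phi>) \<in> M" "fst u \<in> U" "u \<in> sdom M U" using slit_obtain_chart[OF u] .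
  show ?thesis unfolding g_deriv_chart[OF c(1,3) v w] by (rule dE_line_deriv[OF c(1,3) v w])
qed

lemma dE_lincomb:
  "u \<in> TM0 \<Longrightarrow> v \<in> T (fst u) \<Longrightarrow> w \<in> T (fst u) \<Longrightarrow> dE u (scal a v + w) = a * dE u v + dE u w"
  using gamma_lincomb[of u v w a] by (simp add: scal_def)

lemma dE_add: "u \<in> TM0 \<Longrightarrow> v \<in> T (fst u) \<Longrightarrow> w \<in> T (fst u) \<Longrightarrow> dE u (v + w) = dE u v + dE u w"
  by (simp add: gamma_add)

lemma dE_diff: "u \<in> TM0 \<Longrightarrow> v \<in> T (fst u) \<Longrightarrow> w \<in> T (fst u) \<Longrightarrow> dE u (v - w) = dE u v - dE u w"
  by (simp add: gamma_diff)

lemma g_lincomb_right: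
  assumes u: "u \<in> TM0" and v: "v \<in> T (fst u)" and w: "w \<in> T (fst u)" and w': "w' \<in> T (fst u)"
  shows "g u v (scal a w + w') = a * g u v w + g u v w'"
proof (rule DERIV_unique[OF g_deriv[OF u v tangent_lincomb[OF w w']]])
  have "((\<lambda>s. a * dE (fst u, snd u + scal s v) w + dE (fst u, snd u + scal s v) w')
    has_real_derivative a * g u v w + g u v w') (at 0)"
    by (intro DERIV_add DERIV_cmult g_deriv u v w w')
  moreover have "\<forall>\<^sub>F s in nhds 0. a * dE (fst u, snd u + scal s v) w + dE (fst u, snd u + scal s v) w' =
      dE (fst u, snd u + scal s v) (scal a w + w')"
    using eventually_line_slit[OF u v] by (rule eventually_mono) (simp add: dE_lincomb w w')
  ultimately show "((\<lambda>s. dE (fst u, snd u + scal s v) (scal a w + w'))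
    has_real_derivative a * g u v w + g u v w') (at 0)"
    by (simp only: DERIV_cong_ev[OF refl _ refl])
qed

lemma g_lincomb_left:
  assumes u: "u \<in> TM0" and v: "v \<in> T (fst u)" and v': "v' \<in> T (fst u)" and w: "w \<in> T (fst u)"
  shows "g u (scal a v + v') w = a * g u v w + g u v' w"
proof -
  obtain U \<phi> where c: "(U, \<phi>) \<in> M" "fst u \<in> U" "u \<in> sdom M U" using slit_obtain_chart[OF u] .
  let ?F = "\<lambda>z. frechet_derivative (E \<circ> sinv U \<phi>) (at z) (0, tvec_components \<phi> w)"
  let ?D = "frechet_derivative ?F (at (schart \<phi> u))"
  have lin: "linear ?D"
    by (rule smooth_on_linear_frechet[OF smooth_on_frechet_const[OF E_rep_smooth[OF c(1)]]]) (use c in simp)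
  have "(0::'e, tvec_components \<phi> (scal a v + v')) = a *\<^sub>R (0, tvec_components \<phi> v) + (0, tvec_components \<phi> v')"
    by (simp add: tvec_components_plus tvec_components_scal)
  then have "?D (0, tvec_components \<phi> (scal a v + v')) = a * ?D (0, tvec_components \<phi> v) + ?D (0, tvec_components \<phi> v')"
    by (simp only: linear_add[OF lin] linear_cmul[OF lin] real_scaleR_def)
  then show ?thesis
    unfolding g_deriv_chart[OF c(1,3) tangent_lincomb[OF v v'] w] g_deriv_chart[OF c(1,3) v w] g_deriv_chart[OF c(1,3) v' w] .
qed

lemma g_zero: "u \<in> TM0 \<Longrightarrow> w \<in> T (fst u) \<Longrightarrow> g u 0 w = 0" "u \<in> TM0 \<Longrightarrow> w \<in> T (fst u) \<Longrightarrow> g u w 0 = 0"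
  using g_lincomb_left[OF _ zero_tangent zero_tangent, of u w 1] g_lincomb_right[OF _ _ zero_tangent zero_tangent, of u w 1]
  by (simp_all add: scal_def zero_fun_def plus_fun_def)

lemma g_diff:
  assumes "u \<in> TM0" "v \<in> T (fst u)" "w \<in> T (fst u)" "x \<in> T (fst u)"
  shows "g u (v - w) x = g u v x - g u w x" "g u x (v - w) = g u x v - g u x w"
  using g_lincomb_left[OF assms(1,3,2,4), of "-1"] g_lincomb_right[OF assms(1,4,3,2), of "-1"]
  by (simp_all add: scal_def fun_diff_def plus_fun_def)

lemma g_add:
  assumes "u \<in> TM0" "v \<in> T (fst u)" "w \<in> T (fst u)" "x \<in> T (fst u)"
  shows "g u (v + w) x = g u v x + g u w x" "g u x (v + w) = g u x v + g u x w"
  using g_lincomb_left[OF assms, of 1] g_lincomb_right[OF assms(1,4,2,3), of 1]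
  by (simp_all add: scal_def)

lemma g_nondegenerate: "u \<in> TM0 \<Longrightarrow> v \<in> T (fst u) \<Longrightarrow> g u v v = 0 \<Longrightarrow> v = 0"
  using g_pos[of u v] by fastforce

lemma dE_smooth: "Z \<in> Sec \<Longrightarrow> u \<in> TM0 \<Longrightarrow> smooth_at (slit M) u (\<lambda>q. dE q (Z q))"
  using slit.vf_smooth[OF gamma_vf E_smooth] .

text \<open>The second derivative of \<open>E\<close> along the fibre in the directions of \<open>y\<close> and of a section \<open>Z\<close> splits into the
  Hessian and a term for the variation of \<open>Z\<close>.  Apart from bilinearity and positivity this formula is all that
  the comparison of the connections needs to know about \<open>g\<close>.\<close>

lemma gamma_dE:
  assumes u: "u \<in> TM0" and y: "y \<in> T (fst u)" and Z: "Z \<in> Sec"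
  shows "gamma M u y (\<lambda>q. dE q (Z q)) = g u y (Z u) + dE u (fibre_deriv M u y Z)"
proof -
  obtain U \<phi> where c: "(U, \<phi>) \<in> M" "fst u \<in> U" "u \<in> sdom M U" using slit_obtain_chart[OF u] .
  let ?i = "sinv U \<phi>"
  let ?S = "schart \<phi> ` sdom M U"
  let ?z = "schart \<phi> u"
  let ?E = "E \<circ> ?i"
  note sc = slit_chart[OF c(1)]
  have S: "open ?S" "?z \<in> ?S" using slit.chart_open[OF sc] c(3) by auto
  define k where "k z = tvec_components \<phi> (Z (?i z))" for z
  define k' where "k' = frechet_derivative k (at ?z)"
  have "smooth_on ?S k" unfolding k_def by (rule psec_components_smooth[OF c(1) Z])
  then have k: "(k has_derivative k') (at ?z)" unfolding k'_def using S(2) by (rule smooth_on_has_derivative)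
  have kq: "k (schart \<phi> q) = tvec_components \<phi> (Z q)" if "q \<in> sdom M U" for q
    unfolding k_def slit.chart_inv[OF sc that] by (rule refl)
  let ?h = "\<lambda>z. frechet_derivative ?E (at z) (0, k z)"
  have h: "(?h has_derivative (\<lambda>v. frechet_derivative (\<lambda>x. frechet_derivative ?E (at x) (0, k ?z)) (at ?z) v
       + frechet_derivative ?E (at ?z) (0, k' v))) (at ?z)"
    by (rule frechet_derivative_section[OF S E_rep_smooth[OF c(1)]]) (intro has_derivative_Pair has_derivative_const k)
  have d1: "gamma M u y (\<lambda>q. dE q (Z q)) =
      frechet_derivative (\<lambda>x. frechet_derivative ?E (at x) (0, k ?z)) (at ?z) (0, tvec_components \<phi> y)
       + frechet_derivative ?E (at ?z) (0, k' (0, tvec_components \<phi> y))"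
  proof (rule gamma_eqI[OF u y dE_smooth[OF Z u] line_has_derivative[OF c(1,3) y h]])
    show "\<forall>\<^sub>F s in nhds 0. (fst u, snd u + scal s y) \<in> TM0 \<longrightarrow>
        dE (fst u, snd u + scal s y) (Z (fst u, snd u + scal s y)) = ?h (schart \<phi> (fst u, snd u + scal s y))"
      using eventually_line_sdom[OF c(1,3) y]
    proof (rule eventually_mono, intro impI)
      fix s assume q: "(fst u, snd u + scal s y) \<in> sdom M U" "(fst u, snd u + scal s y) \<in> TM0"
      show "dE (fst u, snd u + scal s y) (Z (fst u, snd u + scal s y)) = ?h (schart \<phi> (fst u, snd u + scal s y))"
        using dE_chart[OF c(1) q(1) psec_tangent[OF Z q(2)]] kq[OF q(1)] by simp
    qed
  qed
  have "tvec_components \<phi> (fibre_deriv M u y Z) = k' (0, tvec_components \<phi> y)"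
  proof (rule euclidean_eqI)
    fix i :: 'e assume i: "i \<in> Basis"
    have si: "smooth_at M (fst u) (\<lambda>q. \<phi> q \<bullet> i)" by (rule smooth_at_coord[OF c(1,2)])
    have ki: "((\<lambda>z. k z \<bullet> i) has_derivative (\<lambda>v. k' v \<bullet> i)) (at ?z)" by (intro has_derivative_inner_left k)
    have "((\<lambda>s. Z (fst u, snd u + scal s y) (\<lambda>q. \<phi> q \<bullet> i)) has_real_derivative k' (0, tvec_components \<phi> y) \<bullet> i) (at 0)"
    proof (rule line_has_derivative[OF c(1,3) y ki])
      show "\<forall>\<^sub>F s in nhds 0. (fst u, snd u + scal s y) \<in> TM0 \<longrightarrow>
         Z (fst u, snd u + scal s y) (\<lambda>q. \<phi> q \<bullet> i) = k (schart \<phi> (fst u, snd u + scal s y)) \<bullet> i"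
        using eventually_line_sdom[OF c(1,3) y]
        by (rule eventually_mono) (simp add: kq tvec_components_inner[OF i])
    qed
    from gamma_eqI[OF u y psec_smooth[OF Z u si] this]
    show "tvec_components \<phi> (fibre_deriv M u y Z) \<bullet> i = k' (0, tvec_components \<phi> y) \<bullet> i"
      by (simp add: tvec_components_inner[OF i] fibre_deriv_apply[OF si])
  qed
  then have "dE u (fibre_deriv M u y Z) = frechet_derivative ?E (at ?z) (0, k' (0, tvec_components \<phi> y))"
    using dE_chart[OF c(1,3) fibre_deriv_tangent[OF u y Z]] by simp
  moreover have "g u y (Z u) = frechet_derivative (\<lambda>x. frechet_derivative ?E (at x) (0, k ?z)) (at ?z) (0, tvec_components \<phi> y)"
    unfolding kq[OF c(3)] by (rule g_deriv_chart[OF c(1,3) y psec_tangent[OF Z u]])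
  ultimately show ?thesis using d1 by simp
qed

lemma g_section_smooth:
  assumes Y: "Y \<in> Sec" and Z: "Z \<in> Sec" and u: "u \<in> TM0"
  shows "smooth_at (slit M) u (\<lambda>q. g q (Y q) (Z q))"
proof (rule slit.smooth_at_cong[OF slit.openin_carrier u])
  show "smooth_at (slit M) u (\<lambda>q. gamma M q (Y q) (\<lambda>q. dE q (Z q)) - dE q (fibre_deriv M q (Y q) Z))"
    by (rule slit.smooth_at_diff[OF slit.vf_smooth[OF gamma_vf[OF Y] dE_smooth[OF Z u]] dE_smooth[OF fibre_deriv_psec[OF Y Z] u]])
  show "gamma M q (Y q) (\<lambda>q. dE q (Z q)) - dE q (fibre_deriv M q (Y q) Z) = g q (Y q) (Z q)" if "q \<in> TM0" for q
    using gamma_dE[OF that psec_tangent[OF Y that] Z] by simp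
qed

text \<open>Euler's relation: \<open>E\<close> is homogeneous of degree two on the fibres.\<close>

lemma dE_eta: assumes u: "u \<in> TM0" shows "dE u (eta u) = 2 * E u"
proof (rule gamma_eqI[OF u psec_tangent[OF eta_psec u] E_smooth[OF u]])
  have "((\<lambda>s. (1 + s)\<^sup>2 * E u) has_real_derivative 2 * E u) (at 0)"
    by (auto intro!: derivative_eq_intros)
  moreover have "\<forall>\<^sub>F s in nhds 0. (1 + s)\<^sup>2 * E u = E (fst u, snd u + scal s (eta u))"
  proof (rule eventually_mono[OF eventually_nhds_in_open[of "{-1<..}"]])
    fix s :: real assume "s \<in> {-1<..}"
    then have "L (fst u, scal (1 + s) (snd u)) = (1 + s) * L u" using L_scale[OF u] by simp
    moreover have "snd u + scal s (eta u) = scal (1 + s) (snd u)"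
      by (auto simp: scal_def eta_def algebra_simps fun_eq_iff)
    ultimately show "(1 + s)\<^sup>2 * E u = E (fst u, snd u + scal s (eta u))"
      by (simp add: energy_def power_mult_distrib)
  qed auto
  ultimately show "((\<lambda>s. E (fst u, snd u + scal s (eta u))) has_real_derivative 2 * E u) (at 0)"
    by (simp only: DERIV_cong_ev[OF refl _ refl])
qed

lemma g_eta_right:
  assumes u: "u \<in> TM0" and y: "y \<in> T (fst u)"
  shows "g u y (eta u) = dE u y"
proof -
  have "gamma M u y (\<lambda>q. dE q (eta q)) = gamma M u y (\<lambda>q. 2 * E q)"
    by (rule slit.tv_cong_carrier[OF gamma_tangent[OF u y] u]) (rule dE_eta)
  also have "\<dots> = 2 * dE u y" by (rule slit.tv_cmult[OF gamma_tangent[OF u y] E_smooth[OF u]])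
  finally show ?thesis using gamma_dE[OF u y eta_psec] fibre_deriv_eta[OF u y] by simp
qed

end

locale finsler_spray = finsler M L for M :: "('m, 'e::euclidean_space) atlas" and L +
  fixes G :: "'m vfield"
  assumes spray: "canonical_spray M L G"
begin

lemma G_vf: "G \<in> VF"
  using spray by (simp add: canonical_spray_def)

text \<open>Evaluate \<open>i\<^sub>G\<Omega> = -dE\<close> on a vertical field \<open>\<gamma>Y\<close>.  The form \<open>d\<^sub>JE\<close> vanishes on \<open>\<gamma>Y\<close>, and by \<open>gamma_dE\<close> what remains
  of the left side is \<open>- g(Y, \<rho>G)\<close>, while the right side is \<open>- g(Y, \<eta>)\<close>.\<close>

lemma rho_spray:
  assumes u: "u \<in> TM0" shows "rho M u (G u) = eta u"
proof -
  have R: "(\<lambda>q. rho M q (G q)) \<in> Sec" by (rule rho_psec[OF G_vf])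
  have Gu: "G u \<in> TT u" by (rule slit.vf_tangent[OF G_vf u])
  have *: "g u (Y u) (rho M u (G u)) = g u (Y u) (eta u)" if Y: "Y \<in> Sec" for Y
  proof -
    let ?Y = "\<lambda>w. gamma M w (Y w)"
    note Yu = psec_tangent[OF Y u]
    have "Omega M L G ?Y u = - ?Y u E"
      using spray gamma_vf[OF Y] u by (simp add: canonical_spray_def)
    moreover have "Omega M L G ?Y u = G u (\<lambda>q. J M q (?Y q) E) - ?Y u (\<lambda>q. J M q (G q) E)
        - J M u (lie G ?Y u) E"
      by (simp add: Omega_def exterior_derivative_def)
    moreover have "G u (\<lambda>q. J M q (?Y q) E) = G u (\<lambda>q. 0)"
      by (rule slit.tv_cong_carrier[OF Gu u]) (simp add: J_def rho_gamma gamma_zero psec_tangent[OF Y])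
    moreover have "rho M u (lie G ?Y u) = 0 - fibre_deriv M u (Y u) (\<lambda>q. rho M q (G q))"
      using rho_bracket[where W = G, OF u Y Gu] slit.bracket_antisym[of G ?Y u] rho_diff[of u 0] by (simp add: rho_zero)
    then have "J M u (lie G ?Y u) E = - dE u (fibre_deriv M u (Y u) (\<lambda>q. rho M q (G q)))"
      using dE_diff[OF u zero_tangent fibre_deriv_tangent[OF u Yu R]] gamma_zero[OF u] by (simp add: J_def)
    ultimately have "?Y u (\<lambda>q. dE q (rho M q (G q))) = dE u (Y u) + dE u (fibre_deriv M u (Y u) (\<lambda>q. rho M q (G q)))"
      using slit.tv_const[OF Gu] by (simp add: J_def)
    then show ?thesis using gamma_dE[OF u Yu R] g_eta_right[OF u Yu] by simp
  qed
  let ?V = "\<lambda>q. rho M q (G q) - eta q"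
  have V: "?V \<in> Sec" by (rule psec_diff[OF R eta_psec])
  have "g u (?V u) (?V u) = 0"
    using *[OF V] g_diff(2)[OF u psec_tangent[OF R u] psec_tangent[OF eta_psec u] psec_tangent[OF V u]] by simp
  then have "?V u = 0" by (rule g_nondegenerate[OF u psec_tangent[OF V u]])
  then show ?thesis by simp
qed

text \<open>By \<open>rho_bracket\<close> and \<open>rho_spray\<close> this is a vector field over \<open>Y\<close>, defined globally.\<close>

definition lift :: "'m psection \<Rightarrow> 'm vfield" where
  "lift Y = lie (\<lambda>w. gamma M w (Y w)) G"

lemma lift_vf: "Y \<in> Sec \<Longrightarrow> lift Y \<in> VF"
  unfolding lift_def by (intro slit.bracket_vf gamma_vf G_vf)

lemma rho_lift:
  assumes Y: "Y \<in> Sec" and u: "u \<in> TM0"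
  shows "rho M u (lift Y u) = Y u"
proof -
  note Yu = psec_tangent[OF Y u]
  have "rho M u (lift Y u) = fibre_deriv M u (Y u) (\<lambda>q. rho M q (G q))"
    unfolding lift_def by (rule rho_bracket[where W = G, OF u Y slit.vf_tangent[OF G_vf u]])
  also have "\<dots> = fibre_deriv M u (Y u) eta" by (rule fibre_deriv_cong[OF u Yu rho_spray])
  also have "\<dots> = Y u" by (rule fibre_deriv_eta[OF u Yu])
  finally show ?thesis .
qed

end

section \<open>Regular connections\<close>

locale pullback_connection = finsler_spray M L G
  for M :: "('m, 'e::euclidean_space) atlas" and L and G :: "'m vfield" +
  fixes D :: "'m conn"
  assumes regular: "regular_connection M D"
begin

lemma
  shows D_tangent: "u \<in> TM0 \<Longrightarrow> X \<in> TT u \<Longrightarrow> Y \<in> Sec \<Longrightarrow> D u X Y \<in> T (fst u)"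
    and D_lincomb: "u \<in> TM0 \<Longrightarrow> X \<in> TT u \<Longrightarrow> X' \<in> TT u \<Longrightarrow>
      Y \<in> Sec \<Longrightarrow> D u (scal a X + X') Y = scal a (D u X Y) + D u X' Y"
    and D_section_add: "u \<in> TM0 \<Longrightarrow> X \<in> TT u \<Longrightarrow> Y \<in> Sec \<Longrightarrow>
      Z \<in> Sec \<Longrightarrow> D u X (\<lambda>w. Y w + Z w) = D u X Y + D u X Z"
    and D_cong: "u \<in> TM0 \<Longrightarrow> X \<in> TT u \<Longrightarrow> Y \<in> Sec \<Longrightarrow>
      Z \<in> Sec \<Longrightarrow> (\<And>w. w \<in> TM0 \<Longrightarrow> Y w = Z w) \<Longrightarrow> D u X Y = D u X Z"
    and D_psec: "F \<in> VF \<Longrightarrow> Y \<in> Sec \<Longrightarrow> (\<lambda>u. D u (F u) Y) \<in> Sec"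
proof -
  have lin: "linear_connection M D" using regular unfolding regular_connection_def by (rule conjunct1)
  note L = lin[unfolded linear_connection_def]
  show "u \<in> TM0 \<Longrightarrow> X \<in> TT u \<Longrightarrow> Y \<in> Sec \<Longrightarrow> D u X Y \<in> T (fst u)"
    using L[THEN conjunct1] by simp
  show "u \<in> TM0 \<Longrightarrow> X \<in> TT u \<Longrightarrow> X' \<in> TT u \<Longrightarrow>
      Y \<in> Sec \<Longrightarrow> D u (scal a X + X') Y = scal a (D u X Y) + D u X' Y"
    using L[THEN conjunct2, THEN conjunct1] by simp
  show "u \<in> TM0 \<Longrightarrow> X \<in> TT u \<Longrightarrow> Y \<in> Sec \<Longrightarrow>
      Z \<in> Sec \<Longrightarrow> D u X (\<lambda>w. Y w + Z w) = D u X Y + D u X Z"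
    using L[THEN conjunct2, THEN conjunct2, THEN conjunct1] by simp
  show "u \<in> TM0 \<Longrightarrow> X \<in> TT u \<Longrightarrow> Y \<in> Sec \<Longrightarrow>
      Z \<in> Sec \<Longrightarrow> (\<And>w. w \<in> TM0 \<Longrightarrow> Y w = Z w) \<Longrightarrow> D u X Y = D u X Z"
    by (rule L[THEN conjunct2, THEN conjunct2, THEN conjunct2, THEN conjunct2, THEN conjunct1,
          THEN bspec, THEN bspec, THEN bspec, THEN bspec, THEN mp]) (assumption+, blast)
  show "F \<in> VF \<Longrightarrow> Y \<in> Sec \<Longrightarrow> (\<lambda>u. D u (F u) Y) \<in> Sec"
    using L[THEN conjunct2, THEN conjunct2, THEN conjunct2, THEN conjunct2, THEN conjunct2] by simp
qed

lemma D_add: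
  "u \<in> TM0 \<Longrightarrow> X \<in> TT u \<Longrightarrow> X' \<in> TT u \<Longrightarrow>
    Y \<in> Sec \<Longrightarrow> D u (X + X') Y = D u X Y + D u X' Y"
  using D_lincomb[of u X X' Y 1] by (simp add: scal_def)

lemma D_diff:
  "u \<in> TM0 \<Longrightarrow> X \<in> TT u \<Longrightarrow> X' \<in> TT u \<Longrightarrow>
    Y \<in> Sec \<Longrightarrow> D u (X - X') Y = D u X Y - D u X' Y"
  using D_lincomb[of u X' X Y "-1"] by (simp add: scal_def fun_diff_def plus_fun_def)

lemma D_zero: "u \<in> TM0 \<Longrightarrow> Y \<in> Sec \<Longrightarrow> D u 0 Y = 0"
  using D_diff[OF _ slit.zero_tangent slit.zero_tangent, of u Y] by simp

lemma D_section_zero: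
  assumes u: "u \<in> TM0" and X: "X \<in> TT u" and Z: "\<And>w. w \<in> TM0 \<Longrightarrow> Z w = 0"
  shows "D u X Z = 0"
proof -
  have Zp: "Z \<in> Sec" by (rule psec_cong[OF psec_zero]) (rule Z)
  have "D u X Z = D u X (\<lambda>w. 0)" by (rule D_cong[OF u X Zp psec_zero]) (rule Z)
  moreover have "D u X (\<lambda>w. 0) = 0" using D_section_add[OF u X psec_zero psec_zero] by simp
  ultimately show ?thesis by simp
qed

lemma D_section_diff:
  assumes u: "u \<in> TM0" and X: "X \<in> TT u" and Y: "Y \<in> Sec" and Z: "Z \<in> Sec"
  shows "D u X (\<lambda>w. Y w - Z w) = D u X Y - D u X Z"
  using D_section_add[OF u X psec_diff[OF Y Z] Z] by (simp add: eq_diff_eq)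

abbreviation "ver X \<equiv> (\<lambda>w. gamma M w (X w))"
abbreviation "hor X \<equiv> (\<lambda>w. beta M D w (X w))"

lemma vertical_horizontal_zero:
  assumes u: "u \<in> TM0" and X: "X \<in> TT u" and "rho M u X = 0" "D u X eta = 0"
  shows "X = 0"
proof -
  have "vertical_space M u \<inter> horizontal_space M D u = {0}"
    using regular u unfolding regular_connection_def by simp
  then show ?thesis using assms unfolding vertical_space_def horizontal_space_def by auto
qed

lemma beta_unique:
  assumes u: "u \<in> TM0" and X: "X \<in> TT u" and K: "D u X eta = 0" and r: "rho M u X = v"
  shows "beta M D u v = X"
  unfolding beta_def
proof (rule the_equality)
  show "X \<in> horizontal_space M D u \<and> rho M u X = v" using X K r by (simp add: horizontal_space_def)
  fix X' assume a: "X' \<in> horizontal_space M D u \<and> rho M u X' = v"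
  then have X': "X' \<in> TT u" "D u X' eta = 0" by (auto simp: horizontal_space_def)
  have "X' - X = 0"
    by (rule vertical_horizontal_zero[OF u slit.tangent_diff[OF X'(1) X]])
      (use a r K X' D_diff[OF u X'(1) X eta_psec] in \<open>simp_all add: rho_diff\<close>)
  then show "X' = X" by simp
qed

text \<open>The lift \<open>lift Y\<close> shows that \<open>\<rho>\<close> attains the value \<open>Y\<^sub>u\<close>; its horizontal part is the horizontal lift.\<close>

lemma
  assumes Y: "Y \<in> Sec" and u: "u \<in> TM0"
  shows beta_tangent: "hor Y u \<in> TT u"
    and beta_horizontal: "D u (hor Y u) eta = 0"
    and rho_beta: "rho M u (hor Y u) = Y u"
proof -
  have l: "lift Y u \<in> TT u" by (rule slit.vf_tangent[OF lift_vf[OF Y] u])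
  then obtain V H where VH: "V \<in> vertical_space M u" "H \<in> horizontal_space M D u" "lift Y u = V + H"
    using regular u unfolding regular_connection_def by blast
  have H: "H \<in> TT u" "D u H eta = 0" using VH(2) by (auto simp: horizontal_space_def)
  have r: "rho M u H = Y u" using rho_lift[OF Y u] VH(1,3) by (simp add: rho_add vertical_space_def)
  have "hor Y u = H" by (rule beta_unique[OF u H r])
  then show "hor Y u \<in> TT u" "D u (hor Y u) eta = 0" "rho M u (hor Y u) = Y u"
    using H r by simp_all
qed

lemma beta_zero: "u \<in> TM0 \<Longrightarrow> beta M D u 0 = 0"
  by (rule beta_unique[OF _ slit.zero_tangent]) (simp_all add: D_zero eta_psec rho_zero)

lemma curvature_section_zero:
  assumes u: "u \<in> TM0" and A: "A \<in> VF" and B: "B \<in> VF"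
    and Z: "\<And>w. w \<in> TM0 \<Longrightarrow> Z w = 0"
  shows "curvature M D A B Z u = 0"
proof -
  have "D u (A u) (\<lambda>w. D w (B w) Z) = 0" "D u (B u) (\<lambda>w. D w (A w) Z) = 0" "D u (lie A B u) Z = 0"
    by (rule D_section_zero[OF u slit.vf_tangent[OF A u]], rule D_section_zero[OF _ slit.vf_tangent[OF B]], assumption+, rule Z, assumption)
      (rule D_section_zero[OF u slit.vf_tangent[OF B u]], rule D_section_zero[OF _ slit.vf_tangent[OF A]], assumption+, rule Z, assumption,
       rule D_section_zero[OF u slit.vf_tangent[OF slit.bracket_vf[OF A B] u] Z])
  then show ?thesis by (simp add: curvature_def)
qed

lemma curvature_antisym:
  assumes u: "u \<in> TM0" and A: "A \<in> VF" and B: "B \<in> VF" and Z: "Z \<in> Sec"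
  shows "curvature M D A B Z u = - curvature M D B A Z u"
proof -
  have "lie A B u = 0 - lie B A u"
    using slit.bracket_antisym[of A B u] by simp
  then have "D u (lie A B u) Z = - D u (lie B A u) Z"
    using D_diff[OF u slit.zero_tangent slit.vf_tangent[OF slit.bracket_vf[OF B A] u] Z] D_zero[OF u Z] by simp
  then show ?thesis by (simp add: curvature_def)
qed

end

text \<open>The connection map \<open>K\<close> of a regular connection is injective on vertical vectors.  In this locale it is
  inverse to \<open>\<gamma>\<close>, which both connections of the theorem are shown to satisfy.\<close>

locale normal_connection = pullback_connection M L G D
  for M :: "('m, 'e::euclidean_space) atlas" and L and G and D +
  assumes D_ver_eta: "X \<in> Sec \<Longrightarrow> u \<in> TM0 \<Longrightarrow> D u (gamma M u (X u)) eta = X u"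
begin

text \<open>Remove from the global lift its vertical part; as all the ingredients are smooth, so are horizontal lifts.\<close>

lemma beta_eq:
  assumes Y: "Y \<in> Sec" and u: "u \<in> TM0"
  shows "hor Y u = lift Y u - gamma M u (D u (lift Y u) eta)"
proof (rule beta_unique[OF u])
  have l: "lift Y u \<in> TT u" by (rule slit.vf_tangent[OF lift_vf[OF Y] u])
  have K: "(\<lambda>u. D u (lift Y u) eta) \<in> Sec" by (rule D_psec[OF lift_vf[OF Y] eta_psec])
  note Ku = psec_tangent[OF K u]
  have v: "gamma M u (D u (lift Y u) eta) \<in> TT u" by (rule gamma_tangent[OF u Ku])
  show "lift Y u - gamma M u (D u (lift Y u) eta) \<in> TT u"
    by (rule slit.tangent_diff[OF l v])
  show "D u (lift Y u - gamma M u (D u (lift Y u) eta)) eta = 0"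
    using D_diff[OF u l v eta_psec] D_ver_eta[OF K u] by simp
  show "rho M u (lift Y u - gamma M u (D u (lift Y u) eta)) = Y u"
    using rho_lift[OF Y u] rho_gamma[OF u Ku] by (simp add: rho_diff)
qed

lemma hor_vf:
  assumes Y: "Y \<in> Sec" shows "hor Y \<in> VF"
proof (rule slit.vf_cong)
  show "(\<lambda>u. lift Y u - gamma M u (D u (lift Y u) eta)) \<in> VF"
    by (rule slit.vf_diff[OF lift_vf[OF Y] gamma_vf[OF D_psec[OF lift_vf[OF Y] eta_psec]]])
qed (rule beta_eq[OF Y])

lemma decomposition:
  assumes B: "B \<in> VF" and u: "u \<in> TM0"
  shows "B u = beta M D u (rho M u (B u)) + gamma M u (D u (B u) eta)"
proof -
  have R: "(\<lambda>u. rho M u (B u)) \<in> Sec" by (rule rho_psec[OF B])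
  have K: "(\<lambda>u. D u (B u) eta) \<in> Sec" by (rule D_psec[OF B eta_psec])
  note Bu = slit.vf_tangent[OF B u] and h = beta_tangent[OF R u] and v = gamma_tangent[OF u psec_tangent[OF K u]]
  have "B u - (beta M D u (rho M u (B u)) + gamma M u (D u (B u) eta)) = 0"
  proof (rule vertical_horizontal_zero[OF u slit.tangent_diff[OF Bu slit.tangent_add[OF h v]]])
    show "rho M u (B u - (beta M D u (rho M u (B u)) + gamma M u (D u (B u) eta))) = 0"
      using rho_beta[OF R u] rho_gamma[OF u psec_tangent[OF K u]] by (simp add: rho_diff rho_add)
    show "D u (B u - (beta M D u (rho M u (B u)) + gamma M u (D u (B u) eta))) eta = 0"
      using D_diff[OF u Bu slit.tangent_add[OF h v] eta_psec] D_add[OF u h v eta_psec]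
        beta_horizontal[OF R u] D_ver_eta[OF K u] by simp
  qed
  then show ?thesis by simp
qed

text \<open>In \<open>\<^bold>K(\<beta>X, \<gamma>Y)\<eta>\<close> the inner derivatives are \<open>D\<^bsub>\<gamma>Y\<^esub>\<eta> = Y\<close> and \<open>D\<^bsub>\<beta>X\<^esub>\<eta> = 0\<close>.\<close>

lemma vhv_torsion_eq:
  assumes X: "X \<in> Sec" and Y: "Y \<in> Sec" and u: "u \<in> TM0"
  shows "vhv_torsion M D X Y u = D u (lie (hor X) (ver Y) u) eta - D u (hor X u) Y"
proof -
  note hu = slit.vf_tangent[OF hor_vf[OF X] u] and vu = slit.vf_tangent[OF gamma_vf[OF Y] u]
  have "D u (hor X u) (\<lambda>w. D w (ver Y w) eta) = D u (hor X u) Y"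
    by (rule D_cong[OF u hu D_psec[OF gamma_vf[OF Y] eta_psec] Y D_ver_eta[OF Y]])
  moreover have "D u (ver Y u) (\<lambda>w. D w (hor X w) eta) = 0"
    by (rule D_section_zero[OF u vu beta_horizontal[OF X]])
  ultimately show ?thesis by (simp add: vhv_torsion_def curvature_def)
qed

end

section \<open>The Berwald connection\<close>

locale berwald = pullback_connection M L G D
  for M :: "('m, 'e::euclidean_space) atlas" and L and G and D +
  assumes berwald: "berwald_connection M L D"
begin

lemma torsion_free:
  assumes X: "X \<in> VF" and Y: "Y \<in> VF" and u: "u \<in> TM0"
  shows "rho M u (lie X Y u) =
    D u (X u) (\<lambda>w. rho M w (Y w)) - D u (Y u) (\<lambda>w. rho M w (X w))"
proof -
  have "torsion M D X Y u = 0" using berwald X Y u unfolding berwald_connection_def by blast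
  then show ?thesis by (simp add: torsion_def)
qed

text \<open>Vanishing torsion, applied to \<open>\<gamma>X\<close> and a vector field over \<open>Y\<close>, gives \<open>D\<^bsub>\<gamma>X\<^esub>Y = \<rho>[\<gamma>X, lift Y]\<close>.\<close>

lemma D_ver:
  assumes X: "X \<in> Sec" and Y: "Y \<in> Sec" and u: "u \<in> TM0"
  shows "D u (ver X u) Y = fibre_deriv M u (X u) Y"
proof -
  note vu = slit.vf_tangent[OF gamma_vf[OF X] u] and lu = slit.vf_tangent[OF lift_vf[OF Y] u]
  have "D u (ver X u) Y = D u (ver X u) (\<lambda>w. rho M w (lift Y w))"
    by (rule D_cong[OF u vu Y rho_psec[OF lift_vf[OF Y]] rho_lift[OF Y, symmetric]])
  moreover have "D u (lift Y u) (\<lambda>w. rho M w (ver X w)) = 0"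
    by (rule D_section_zero[OF u lu rho_gamma[OF _ psec_tangent[OF X]]])
  ultimately have "D u (ver X u) Y = rho M u (lie (ver X) (lift Y) u)"
    using torsion_free[OF gamma_vf[OF X] lift_vf[OF Y] u] by simp
  also have "\<dots> = fibre_deriv M u (X u) (\<lambda>q. rho M q (lift Y q))" by (rule rho_bracket[where W = "lift Y", OF u X lu])
  also have "\<dots> = fibre_deriv M u (X u) Y" by (rule fibre_deriv_cong[OF u psec_tangent[OF X u] rho_lift[OF Y]])
  finally show ?thesis .
qed

end

sublocale berwald \<subseteq> normal_connection
proof
  fix X u assume X: "X \<in> Sec" and u: "u \<in> TM0"
  show "D u (gamma M u (X u)) eta = X u"
    using D_ver[OF X eta_psec u] fibre_deriv_eta[OF u psec_tangent[OF X u]] by simp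
qed

context berwald
begin

lemma ver_dE:
  assumes X: "X \<in> Sec" and Z: "Z \<in> Sec" and u: "u \<in> TM0"
  shows "ver X u (\<lambda>q. dE q (Z q)) = g u (X u) (Z u) + dE u (D u (ver X u) Z)"
  using gamma_dE[OF u psec_tangent[OF X u] Z] D_ver[OF X Z u] by simp

lemma hor_energy:
  assumes X: "X \<in> Sec" and u: "u \<in> TM0" shows "hor X u E = 0"
proof -
  note hu = beta_tangent[OF X u]
  have "horizontal_projector M D u (hor X u) L = 0"
    using berwald u hu unfolding berwald_connection_def by blast
  then have "hor X u L = 0" using rho_beta[OF X u] by (simp add: horizontal_projector_def)
  moreover have "E = (\<lambda>q. (1/2) * (L q * L q))" by (auto simp: energy_def power2_eq_square)
  ultimately show ?thesis
    using slit.tv_cmult[OF hu slit.smooth_at_mult[OF L_smooth[OF u] L_smooth[OF u]], of "1/2"]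
      slit.tv_mult[OF hu L_smooth[OF u] L_smooth[OF u]] by simp
qed

text \<open>Vanishing torsion replaces \<open>D\<^sub>B \<rho>C - D\<^sub>C \<rho>B\<close> by \<open>\<rho>[B, C]\<close>; the cyclic sum of the curvature terms then becomes \<open>\<rho>\<close> of
  the cyclic sum of the double brackets.\<close>

lemma Bianchi_identity:
  assumes A: "A \<in> VF" and B: "B \<in> VF" and C: "C \<in> VF"
    and u: "u \<in> TM0"
  shows "curvature M D A B (\<lambda>w. rho M w (C w)) u + curvature M D B C (\<lambda>w. rho M w (A w)) u
    + curvature M D C A (\<lambda>w. rho M w (B w)) u = 0"
proof -
  have *: "rho M u (lie A (lie B C) u) =
      D u (A u) (\<lambda>w. D w (B w) (\<lambda>w. rho M w (C w))) - D u (A u) (\<lambda>w. D w (C w) (\<lambda>w. rho M w (B w)))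
      - D u (lie B C u) (\<lambda>w. rho M w (A w))"
    if A: "A \<in> VF" and B: "B \<in> VF" and C: "C \<in> VF" for A B C
  proof -
    note BC = slit.bracket_vf[OF B C]
    note P = D_psec[OF B rho_psec[OF C]] and Q = D_psec[OF C rho_psec[OF B]]
    have "D u (A u) (\<lambda>w. rho M w (lie B C w)) =
        D u (A u) (\<lambda>w. D w (B w) (\<lambda>w. rho M w (C w)) - D w (C w) (\<lambda>w. rho M w (B w)))"
      by (rule D_cong[OF u slit.vf_tangent[OF A u] rho_psec[OF BC] psec_diff[OF P Q] torsion_free[OF B C]])
    then show ?thesis
      using torsion_free[OF A BC u] D_section_diff[OF u slit.vf_tangent[OF A u] P Q] by simp
  qed
  have "rho M u (lie A (lie B C) u)
      + rho M u (lie B (lie C A) u)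
      + rho M u (lie C (lie A B) u) = 0"
    using slit.Jacobi_identity[OF A B C, of u] rho_zero[of u] by (simp only: rho_add[symmetric])
  then show ?thesis
    unfolding *[OF A B C] *[OF B C A] *[OF C A B] curvature_def by (simp add: algebra_simps)
qed

text \<open>The Bianchi identity for \<open>\<gamma>X\<close>, \<open>\<gamma>Y\<close>, \<open>G\<close> reduces to \<open>\<^bold>K(\<gamma>X, \<gamma>Y)\<eta> = 0\<close>, since \<open>\<rho>\<close> annihilates the vertical fields.
  This equation computes \<open>K[\<gamma>X, \<gamma>Y]\<close>, and the bracket is vertical by vanishing torsion.\<close>

lemma ver_bracket:
  assumes X: "X \<in> Sec" and Y: "Y \<in> Sec" and u: "u \<in> TM0"
  shows "lie (ver X) (ver Y) u = gamma M u (D u (ver X u) Y - D u (ver Y u) X)"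
proof -
  note Xv = gamma_vf[OF X] and Yv = gamma_vf[OF Y]
  note Xu = slit.vf_tangent[OF Xv u] and Yu = slit.vf_tangent[OF Yv u]
  note br = slit.bracket_vf[OF Xv Yv]
  have z: "rho M w (ver X w) = 0" "rho M w (ver Y w) = 0" if "w \<in> TM0" for w
    using rho_gamma[OF that psec_tangent[OF X that]] rho_gamma[OF that psec_tangent[OF Y that]] .
  have "curvature M D (ver X) (ver Y) (\<lambda>w. rho M w (G w)) u = 0"
    using Bianchi_identity[OF Xv Yv G_vf u] curvature_section_zero[OF u Yv G_vf z(1)]
      curvature_section_zero[OF u G_vf Xv z(2)] by simp
  moreover have eq: "D w V (\<lambda>w. rho M w (G w)) = D w V eta" if "w \<in> TM0" "V \<in> TT w" for w V
    by (rule D_cong[OF that rho_psec[OF G_vf] eta_psec rho_spray])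
  have "D u (ver X u) (\<lambda>w. D w (ver Y w) (\<lambda>w. rho M w (G w))) = D u (ver X u) Y"
  proof (rule D_cong[OF u Xu D_psec[OF Yv rho_psec[OF G_vf]] Y])
    show "D w (ver Y w) (\<lambda>w. rho M w (G w)) = Y w" if "w \<in> TM0" for w
      using eq[OF that slit.vf_tangent[OF Yv that]] D_ver_eta[OF Y that] by simp
  qed
  moreover have "D u (ver Y u) (\<lambda>w. D w (ver X w) (\<lambda>w. rho M w (G w))) = D u (ver Y u) X"
  proof (rule D_cong[OF u Yu D_psec[OF Xv rho_psec[OF G_vf]] X])
    show "D w (ver X w) (\<lambda>w. rho M w (G w)) = X w" if "w \<in> TM0" for w
      using eq[OF that slit.vf_tangent[OF Xv that]] D_ver_eta[OF X that] by simp
  qed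
  ultimately have K: "D u (lie (ver X) (ver Y) u) eta = D u (ver X u) Y - D u (ver Y u) X"
    using eq[OF u slit.vf_tangent[OF br u]] by (simp add: curvature_def algebra_simps)
  have "rho M u (lie (ver X) (ver Y) u) = 0"
    using torsion_free[OF Xv Yv u] D_section_zero[OF u Xu z(2)] D_section_zero[OF u Yu z(1)] by simp
  then show ?thesis using decomposition[OF br u] K beta_zero[OF u] by simp
qed

text \<open>Both \<open>g(Y, Z) - g(Z, Y)\<close>, expanded by \<open>ver_dE\<close>, and \<open>ver_bracket\<close> compute the same bracket \<open>[\<gamma>Y, \<gamma>Z]\<close> on \<open>E\<close>.\<close>

lemma g_sym:
  assumes Y: "Y \<in> Sec" and Z: "Z \<in> Sec" and u: "u \<in> TM0"
  shows "g u (Y u) (Z u) = g u (Z u) (Y u)"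
proof -
  note DY = psec_tangent[OF D_psec[OF gamma_vf[OF Y] Z] u] and DZ = psec_tangent[OF D_psec[OF gamma_vf[OF Z] Y] u]
  have "ver Y u (\<lambda>q. dE q (Z q)) - ver Z u (\<lambda>q. dE q (Y q)) = lie (ver Y) (ver Z) u E"
    using slit.bracket_apply[OF E_smooth[OF u]] by simp
  also have "\<dots> = dE u (D u (ver Y u) Z) - dE u (D u (ver Z u) Y)"
    unfolding ver_bracket[OF Y Z u] by (rule dE_diff[OF u DY DZ])
  finally show ?thesis using ver_dE[OF Y Z u] ver_dE[OF Z Y u] by simp
qed

lemma g_eta_left:
  assumes Z: "Z \<in> Sec" and u: "u \<in> TM0" shows "g u (eta u) (Z u) = dE u (Z u)"
  using g_sym[OF eta_psec Z u] g_eta_right[OF u psec_tangent[OF Z u]] by simp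

lemma bracket_hor_ver_vertical:
  assumes X: "X \<in> Sec" and Y: "Y \<in> Sec" and u: "u \<in> TM0"
  shows "D u (lie (hor X) (ver Y) u) eta = D u (hor X u) Y"
proof -
  have "vhv_torsion M D X Y u = 0" using berwald X Y u unfolding berwald_connection_def by blast
  then show ?thesis using vhv_torsion_eq[OF X Y u] by simp
qed

text \<open>The form \<open>Z \<mapsto> \<gamma>Z \<cdot> E\<close> is parallel along horizontal fields: as \<open>\<beta>X \<cdot> E = 0\<close>, only \<open>[\<beta>X, \<gamma>Z] \<cdot> E\<close> remains, and of the
  bracket only the vertical part \<open>\<gamma>(D\<^bsub>\<beta>X\<^esub>Z)\<close> contributes.\<close>

lemma hor_dE:
  assumes X: "X \<in> Sec" and Z: "Z \<in> Sec" and u: "u \<in> TM0"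
  shows "hor X u (\<lambda>q. dE q (Z q)) = dE u (D u (hor X u) Z)"
proof -
  note Xv = hor_vf[OF X] and Zv = gamma_vf[OF Z]
  note br = slit.bracket_vf[OF Xv Zv] and Zu = slit.vf_tangent[OF Zv u]
  have "ver Z u (\<lambda>q. hor X q E) = ver Z u (\<lambda>q. 0)"
    by (rule slit.tv_cong_carrier[OF Zu u]) (rule hor_energy[OF X])
  then have "hor X u (\<lambda>q. dE q (Z q)) = lie (hor X) (ver Z) u E"
    using slit.bracket_apply[OF E_smooth[OF u]] slit.tv_const[OF Zu] by simp
  also have "lie (hor X) (ver Z) u =
      beta M D u (rho M u (lie (hor X) (ver Z) u)) + gamma M u (D u (hor X u) Z)"
    using decomposition[OF br u] bracket_hor_ver_vertical[OF X Z u] by simp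
  also have "\<dots> E = dE u (D u (hor X u) Z)" using hor_energy[OF rho_psec[OF br] u] by simp
  finally show ?thesis .
qed

text \<open>The Ricci identity for the form \<open>\<alpha>(Z) = \<gamma>Z \<cdot> E\<close>: since \<open>g(Y, Z) = (D\<^bsub>\<gamma>Y\<^esub>\<alpha>)(Z)\<close> and \<open>D\<^bsub>\<beta>X\<^esub>\<alpha> = 0\<close>, interchanging the two
  derivatives of \<open>\<alpha>\<close> leaves the curvature.\<close>

lemma metric_derivative_hor:
  assumes X: "X \<in> Sec" and Y: "Y \<in> Sec" and Z: "Z \<in> Sec" and u: "u \<in> TM0"
  shows "metric_derivative D L (hor X) Y Z u = dE u (curvature M D (hor X) (ver Y) Z u)"
proof -
  note Xv = hor_vf[OF X] and Yv = gamma_vf[OF Y]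
  note Xu = slit.vf_tangent[OF Xv u] and Yu = slit.vf_tangent[OF Yv u]
  note br = slit.bracket_vf[OF Xv Yv]
  let ?b = "lie (hor X) (ver Y)"
  \<comment> \<open>the horizontal part of the bracket; its vertical part is \<open>\<gamma>(D\<^bsub>\<beta>X\<^esub>Y)\<close>\<close>
  define R where "R = (\<lambda>u. rho M u (?b u))"
  have R: "R \<in> Sec" unfolding R_def by (rule rho_psec[OF br])
  have DXY: "(\<lambda>w. D w (hor X w) Y) \<in> Sec" by (rule D_psec[OF Xv Y])
  have DXZ: "(\<lambda>w. D w (hor X w) Z) \<in> Sec" by (rule D_psec[OF Xv Z])
  have DYZ: "(\<lambda>w. D w (ver Y w) Z) \<in> Sec" by (rule D_psec[OF Yv Z])
  have bu: "?b u = hor R u + gamma M u (D u (hor X u) Y)"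
    using decomposition[OF br u] bracket_hor_ver_vertical[OF X Y u] by (simp add: R_def)
  note hR = beta_tangent[OF R u] and vXY = gamma_tangent[OF u psec_tangent[OF DXY u]]
  have s: "smooth_at (slit M) u (\<lambda>q. dE q (Z q))" by (rule dE_smooth[OF Z u])
  have "hor X u (\<lambda>q. g q (Y q) (Z q)) = hor X u (\<lambda>q. ver Y q (\<lambda>q. dE q (Z q)) - dE q (D q (ver Y q) Z))"
    by (rule slit.tv_cong_carrier[OF Xu u]) (simp add: ver_dE[OF Y Z])
  also have "\<dots> = hor X u (\<lambda>q. ver Y q (\<lambda>q. dE q (Z q))) - hor X u (\<lambda>q. dE q (D q (ver Y q) Z))"
    by (rule slit.tv_diff[OF Xu slit.vf_smooth[OF Yv s] dE_smooth[OF DYZ u]])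
  also have "hor X u (\<lambda>q. dE q (D q (ver Y q) Z)) = dE u (D u (hor X u) (\<lambda>w. D w (ver Y w) Z))"
    by (rule hor_dE[OF X DYZ u])
  also have "hor X u (\<lambda>q. ver Y q (\<lambda>q. dE q (Z q))) =
      ?b u (\<lambda>q. dE q (Z q)) + ver Y u (\<lambda>q. hor X q (\<lambda>q. dE q (Z q)))"
    using slit.bracket_apply[OF s] by simp
  also have "ver Y u (\<lambda>q. hor X q (\<lambda>q. dE q (Z q))) = ver Y u (\<lambda>q. dE q (D q (hor X q) Z))"
    by (rule slit.tv_cong_carrier[OF Yu u]) (rule hor_dE[OF X Z])
  also have "\<dots> = g u (Y u) (D u (hor X u) Z) + dE u (D u (ver Y u) (\<lambda>w. D w (hor X w) Z))"
    by (rule ver_dE[OF Y DXZ u])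
  also have "?b u (\<lambda>q. dE q (Z q)) = hor R u (\<lambda>q. dE q (Z q)) + gamma M u (D u (hor X u) Y) (\<lambda>q. dE q (Z q))"
    unfolding bu by simp
  also have "\<dots> = dE u (D u (hor R u) Z) + (g u (D u (hor X u) Y) (Z u) + dE u (D u (gamma M u (D u (hor X u) Y)) Z))"
    using hor_dE[OF R Z u] ver_dE[OF DXY Z u] by simp
  also have "\<dots> = dE u (D u (?b u) Z) + g u (D u (hor X u) Y) (Z u)"
    unfolding bu D_add[OF u hR vXY Z] dE_add[OF u D_tangent[OF u hR Z] D_tangent[OF u vXY Z]] by simp
  finally have *: "metric_derivative D L (hor X) Y Z u = dE u (D u (?b u) Z)
      + dE u (D u (ver Y u) (\<lambda>w. D w (hor X w) Z)) - dE u (D u (hor X u) (\<lambda>w. D w (ver Y w) Z))"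
    unfolding metric_derivative_def by simp
  note t1 = D_tangent[OF u slit.vf_tangent[OF br u] Z] and t2 = D_tangent[OF u Yu DXZ] and t3 = D_tangent[OF u Xu DYZ]
  have "curvature M D (hor X) (ver Y) Z u = (D u (?b u) Z + D u (ver Y u) (\<lambda>w. D w (hor X w) Z))
      - D u (hor X u) (\<lambda>w. D w (ver Y w) Z)" by (simp add: curvature_def algebra_simps)
  then have "dE u (curvature M D (hor X) (ver Y) Z u) = dE u (D u (?b u) Z)
      + dE u (D u (ver Y u) (\<lambda>w. D w (hor X w) Z)) - dE u (D u (hor X u) (\<lambda>w. D w (ver Y w) Z))"
    using dE_diff[OF u tangent_add[OF t1 t2] t3] dE_add[OF u t1 t2] by simp
  then show ?thesis using * by simp
qed

lemma metric_derivative_swap: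
  assumes X: "X \<in> VF" and Y: "Y \<in> Sec" and Z: "Z \<in> Sec" and u: "u \<in> TM0"
  shows "metric_derivative D L X Y Z u = metric_derivative D L X Z Y u"
proof -
  have "X u (\<lambda>w. g w (Y w) (Z w)) = X u (\<lambda>w. g w (Z w) (Y w))"
    by (rule slit.tv_cong_carrier[OF slit.vf_tangent[OF X u] u]) (rule g_sym[OF Y Z])
  then show ?thesis using g_sym[OF D_psec[OF X Y] Z u] g_sym[OF Y D_psec[OF X Z] u]
    by (simp add: metric_derivative_def)
qed

text \<open>In the Bianchi identity for \<open>\<beta>X\<close>, \<open>\<gamma>Y\<close>, \<open>\<beta>Z\<close> the term acting on \<open>\<rho>(\<gamma>Y) = 0\<close> drops out.  Together with
  \<open>metric_derivative_swap\<close> this shows that \<open>(D\<^bsub>\<beta>X\<^esub>g)(Y, Z)\<close> is totally symmetric.\<close>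

lemma metric_derivative_hor_exchange:
  assumes X: "X \<in> Sec" and Y: "Y \<in> Sec" and Z: "Z \<in> Sec" and u: "u \<in> TM0"
  shows "metric_derivative D L (hor X) Y Z u = metric_derivative D L (hor Z) Y X u"
proof -
  note Xv = hor_vf[OF X] and Yv = gamma_vf[OF Y] and Zv = hor_vf[OF Z]
  \<comment> \<open>the Bianchi identity is stated for sections \<open>\<rho>C\<close>; here \<open>C\<close> is a horizontal lift\<close>
  have cc: "curvature M D A B (\<lambda>w. rho M w (hor V w)) u = curvature M D A B V u"
    if A: "A \<in> VF" and B: "B \<in> VF" and V: "V \<in> Sec" for A B V
  proof -
    note P = rho_psec[OF hor_vf[OF V]]
    have e: "D w (F w) (\<lambda>w. rho M w (hor V w)) = D w (F w) V" if "F \<in> VF" "w \<in> TM0" for F w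
      by (rule D_cong[OF that(2) slit.vf_tangent[OF that] P V rho_beta[OF V]])
    have "D u (A u) (\<lambda>w. D w (B w) (\<lambda>w. rho M w (hor V w))) = D u (A u) (\<lambda>w. D w (B w) V)"
      by (rule D_cong[OF u slit.vf_tangent[OF A u] D_psec[OF B P] D_psec[OF B V] e[OF B]])
    moreover have "D u (B u) (\<lambda>w. D w (A w) (\<lambda>w. rho M w (hor V w))) = D u (B u) (\<lambda>w. D w (A w) V)"
      by (rule D_cong[OF u slit.vf_tangent[OF B u] D_psec[OF A P] D_psec[OF A V] e[OF A]])
    ultimately show ?thesis using e[OF slit.bracket_vf[OF A B] u] by (simp add: curvature_def)
  qed
  have "curvature M D (hor Z) (hor X) (\<lambda>w. rho M w (ver Y w)) u = 0"
    by (rule curvature_section_zero[OF u Zv Xv]) (simp add: rho_gamma psec_tangent[OF Y])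
  then have "curvature M D (hor X) (ver Y) Z u + curvature M D (ver Y) (hor Z) X u = 0"
    using Bianchi_identity[OF Xv Yv Zv u] cc[OF Xv Yv Z] cc[OF Yv Zv X] by simp
  then have "curvature M D (hor X) (ver Y) Z u = curvature M D (hor Z) (ver Y) X u"
    using curvature_antisym[OF u Yv Zv X] by simp
  then show ?thesis using metric_derivative_hor[OF X Y Z u] metric_derivative_hor[OF Z Y X u] by simp
qed

text \<open>Since \<open>g(\<eta>, Z) = \<gamma>Z \<cdot> E\<close>, this restates that the latter form is parallel and that \<open>D\<^bsub>\<beta>X\<^esub>\<eta> = 0\<close>.\<close>

lemma metric_derivative_hor_eta:
  assumes X: "X \<in> Sec" and Z: "Z \<in> Sec" and u: "u \<in> TM0"
  shows "metric_derivative D L (hor X) eta Z u = 0"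
proof -
  note Xv = hor_vf[OF X]
  have "hor X u (\<lambda>w. g w (eta w) (Z w)) = hor X u (\<lambda>q. dE q (Z q))"
    by (rule slit.tv_cong_carrier[OF slit.vf_tangent[OF Xv u] u]) (rule g_eta_left[OF Z])
  then show ?thesis
    using hor_dE[OF X Z u] g_eta_left[OF D_psec[OF Xv Z] u] beta_horizontal[OF X u] g_zero(1)[OF u psec_tangent[OF Z u]]
    by (simp add: metric_derivative_def)
qed

lemma metric_derivative_ver_eta:
  assumes X: "X \<in> Sec" and Z: "Z \<in> Sec" and u: "u \<in> TM0"
  shows "metric_derivative D L (ver X) eta Z u = 0"
proof -
  note Xv = gamma_vf[OF X]
  have "ver X u (\<lambda>w. g w (eta w) (Z w)) = ver X u (\<lambda>q. dE q (Z q))"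
    by (rule slit.tv_cong_carrier[OF slit.vf_tangent[OF Xv u] u]) (rule g_eta_left[OF Z])
  then show ?thesis
    using ver_dE[OF X Z u] g_eta_left[OF D_psec[OF Xv Z] u] D_ver_eta[OF X u]
    by (simp add: metric_derivative_def)
qed

text \<open>For a torsion-free connection \<open>\<Omega>(G, B)\<close> is the antisymmetrised covariant derivative of \<open>Z \<mapsto> \<gamma>Z \<cdot> E\<close>, which
  sees only vertical parts.  For horizontal \<open>B\<close> it equals \<open>g(K G, \<rho>B)\<close>, and it has to equal \<open>- B \<cdot> E = 0\<close>.  The choice
  \<open>\<rho>B = K G\<close> shows that \<open>G\<close> has no vertical part.\<close>

lemma spray_horizontal:
  assumes u: "u \<in> TM0" shows "G u = hor eta u"
proof -
  let ?K = "\<lambda>u. D u (G u) eta"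
  have K: "?K \<in> Sec" by (rule D_psec[OF G_vf eta_psec])
  have Gw: "G w = hor eta w + gamma M w (?K w)" if "w \<in> TM0" for w
    using decomposition[OF G_vf that] rho_spray[OF that] by simp
  let ?B = "hor ?K"
  have B: "?B \<in> VF" by (rule hor_vf[OF K])
  note Gu = slit.vf_tangent[OF G_vf u] and Bu = slit.vf_tangent[OF B u]
  note R = rho_psec[OF B]
  have "Omega M L G ?B u = - ?B u E" using spray B u by (simp add: canonical_spray_def)
  then have "Omega M L G ?B u = 0" using hor_energy[OF K u] by simp
  moreover have "Omega M L G ?B u = G u (\<lambda>q. dE q (rho M q (?B q))) - ?B u (\<lambda>q. dE q (rho M q (G q)))
      - dE u (rho M u (lie G ?B u))"
    by (simp add: Omega_def exterior_derivative_def J_def)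
  moreover have "?B u (\<lambda>q. dE q (rho M q (G q))) = 0"
  proof -
    have "?B u (\<lambda>q. dE q (rho M q (G q))) = ?B u (\<lambda>q. 2 * E q)"
      by (rule slit.tv_cong_carrier[OF Bu u]) (simp add: rho_spray dE_eta)
    then show ?thesis using slit.tv_cmult[OF Bu E_smooth[OF u]] hor_energy[OF K u] by simp
  qed
  moreover have "G u (\<lambda>q. dE q (rho M q (?B q))) = g u (?K u) (?K u) + dE u (D u (G u) ?K)"
  proof -
    have "G u (\<lambda>q. dE q (rho M q (?B q))) = G u (\<lambda>q. dE q (?K q))"
      by (rule slit.tv_cong_carrier[OF Gu u]) (simp add: rho_beta[OF K])
    also have "\<dots> = hor eta u (\<lambda>q. dE q (?K q)) + gamma M u (?K u) (\<lambda>q. dE q (?K q))"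
      by (subst (1) Gw[OF u]) simp
    also have "\<dots> = dE u (D u (hor eta u) ?K) + (g u (?K u) (?K u) + dE u (D u (ver ?K u) ?K))"
      using hor_dE[OF eta_psec K u] ver_dE[OF K K u] by simp
    also have "dE u (D u (hor eta u) ?K) + (g u (?K u) (?K u) + dE u (D u (ver ?K u) ?K)) =
        g u (?K u) (?K u) + dE u (D u (hor eta u + ver ?K u) ?K)"
      using D_add[OF u beta_tangent[OF eta_psec u] gamma_tangent[OF u psec_tangent[OF K u]] K]
        dE_add[OF u D_tangent[OF u beta_tangent[OF eta_psec u] K] D_tangent[OF u gamma_tangent[OF u psec_tangent[OF K u]] K]]
      by simp
    also have "hor eta u + ver ?K u = G u" using Gw[OF u] by simp
    finally show ?thesis .
  qed
  moreover have "rho M u (lie G ?B u) = D u (G u) ?K"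
  proof -
    have "D u (G u) (\<lambda>w. rho M w (?B w)) = D u (G u) ?K"
      by (rule D_cong[OF u Gu R K rho_beta[OF K]])
    moreover have "D u (?B u) (\<lambda>w. rho M w (G w)) = D u (?B u) eta"
      by (rule D_cong[OF u Bu rho_psec[OF G_vf] eta_psec rho_spray])
    ultimately show ?thesis using torsion_free[OF G_vf B u] beta_horizontal[OF K u] by simp
  qed
  ultimately have "g u (?K u) (?K u) = 0" by simp
  then have "?K u = 0" by (rule g_nondegenerate[OF u psec_tangent[OF K u]])
  then show ?thesis using Gw[OF u] gamma_zero[OF u] by simp
qed

lemma metric_parallel_along_spray: "metric_parallel_along M D L G"
  unfolding metric_parallel_along_def
proof (intro ballI)
  fix Y Z u assume Y: "Y \<in> Sec" and Z: "Z \<in> Sec" and u: "u \<in> TM0"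
  have "metric_derivative D L G Y Z u = metric_derivative D L (hor eta) Y Z u"
    by (simp add: metric_derivative_def spray_horizontal[OF u])
  also have "\<dots> = metric_derivative D L (hor Z) Y eta u" by (rule metric_derivative_hor_exchange[OF eta_psec Y Z u])
  also have "\<dots> = metric_derivative D L (hor Z) eta Y u" by (rule metric_derivative_swap[OF hor_vf[OF Z] Y eta_psec u])
  also have "\<dots> = 0" by (rule metric_derivative_hor_eta[OF Z Y u])
  finally show "metric_derivative D L G Y Z u = 0" .
qed

end

section \<open>The Cartan connection\<close>

locale cartan_berwald = berwald M L G D0 + c: pullback_connection M L G nabla
  for M :: "('m, 'e::euclidean_space) atlas" and L and G and D0 nabla +
  assumes cartan: "cartan_connection M L nabla"
begin

lemma cartan_metric:
  assumes X: "X \<in> VF" and Y: "Y \<in> Sec" and Z: "Z \<in> Sec" and u: "u \<in> TM0"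
  shows "X u (\<lambda>w. g w (Y w) (Z w)) = g u (nabla u (X u) Y) (Z u) + g u (Y u) (nabla u (X u) Z)"
proof -
  have "metric_derivative nabla L X Y Z u = 0"
    using cartan X Y Z u unfolding cartan_connection_def metric_parallel_along_def by blast
  then show ?thesis by (simp add: metric_derivative_def)
qed

text \<open>The horizontal lift occurring in the mixed torsion enters \<open>rho_bracket\<close> only through its values, so the formula
  is available before horizontal lifts of the Cartan connection are known to be smooth.\<close>

lemma mixed_torsion_eq:
  assumes X: "X \<in> Sec" and Y: "Y \<in> Sec" and u: "u \<in> TM0"
  shows "mixed_torsion M nabla X Y u = nabla u (ver X u) Y - fibre_deriv M u (X u) Y"
proof -
  note vu = slit.vf_tangent[OF gamma_vf[OF X] u] and hu = c.beta_tangent[OF Y u]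
  have R: "(\<lambda>w. rho M w (c.hor Y w)) \<in> Sec" by (rule psec_cong[OF Y c.rho_beta[OF Y]])
  have "nabla u (ver X u) (\<lambda>w. rho M w (c.hor Y w)) = nabla u (ver X u) Y"
    by (rule c.D_cong[OF u vu R Y c.rho_beta[OF Y]])
  moreover have "nabla u (c.hor Y u) (\<lambda>w. rho M w (ver X w)) = 0"
    by (rule c.D_section_zero[OF u hu rho_gamma[OF _ psec_tangent[OF X]]])
  moreover have "rho M u (lie (ver X) (c.hor Y) u) = fibre_deriv M u (X u) (\<lambda>w. rho M w (c.hor Y w))"
    by (rule rho_bracket[where W = "c.hor Y", OF u X hu])
  moreover have "fibre_deriv M u (X u) (\<lambda>w. rho M w (c.hor Y w)) = fibre_deriv M u (X u) Y"
    by (rule fibre_deriv_cong[OF u psec_tangent[OF X u] c.rho_beta[OF Y]])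
  ultimately show ?thesis by (simp add: mixed_torsion_def torsion_def)
qed

lemma mixed_torsion_psec:
  assumes X: "X \<in> Sec" and Y: "Y \<in> Sec"
  shows "mixed_torsion M nabla X Y \<in> Sec"
  by (rule psec_cong[OF psec_diff[OF c.D_psec[OF gamma_vf[OF X] Y] fibre_deriv_psec[OF X Y]] mixed_torsion_eq[OF X Y]])

text \<open>Subtract \<open>D\<^bsub>\<gamma>X\<^esub>g\<close> from \<open>\<nabla>\<^bsub>\<gamma>X\<^esub>g = 0\<close>.  The two resulting terms in \<open>T\<close> agree by the symmetry required of \<open>T\<close>.\<close>

lemma metric_derivative_ver:
  assumes X: "X \<in> Sec" and Y: "Y \<in> Sec" and Z: "Z \<in> Sec" and u: "u \<in> TM0"
  shows "metric_derivative D0 L (ver X) Y Z u = 2 * g u (mixed_torsion M nabla X Y u) (Z u)"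
proof -
  have n: "nabla u (ver X u) V = mixed_torsion M nabla X V u + D0 u (ver X u) V" if V: "V \<in> Sec" for V
    using mixed_torsion_eq[OF X V u] D_ver[OF X V u] by simp
  note T = mixed_torsion_psec[OF X] and D = D_psec[OF gamma_vf[OF X]]
  have "metric_derivative D0 L (ver X) Y Z u =
      g u (mixed_torsion M nabla X Y u) (Z u) + g u (Y u) (mixed_torsion M nabla X Z u)"
    using cartan_metric[OF gamma_vf[OF X] Y Z u] n[OF Y] n[OF Z]
      g_add(1)[OF u psec_tangent[OF T[OF Y] u] psec_tangent[OF D[OF Y] u] psec_tangent[OF Z u]]
      g_add(2)[OF u psec_tangent[OF T[OF Z] u] psec_tangent[OF D[OF Z] u] psec_tangent[OF Y u]]
    by (simp add: metric_derivative_def)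
  also have "g u (Y u) (mixed_torsion M nabla X Z u) = g u (mixed_torsion M nabla X Z u) (Y u)"
    by (rule g_sym[OF Y T[OF Z] u])
  also have "\<dots> = g u (mixed_torsion M nabla X Y u) (Z u)"
    using cartan X Y Z u unfolding cartan_connection_def by metis
  finally show ?thesis by simp
qed

text \<open>By \<open>metric_derivative_ver\<close> and because \<open>D\<^bsub>\<gamma>X\<^esub>g\<close> vanishes on \<open>\<eta>\<close>, which expresses the homogeneity of \<open>g\<close>.  This is what
  makes the connection map of \<open>\<nabla>\<close> inverse to \<open>\<gamma>\<close>.\<close>

lemma mixed_torsion_eta:
  assumes X: "X \<in> Sec" and u: "u \<in> TM0"
  shows "mixed_torsion M nabla X eta u = 0"
proof (rule g_nondegenerate[OF u])
  note T = mixed_torsion_psec[OF X eta_psec]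
  show "mixed_torsion M nabla X eta u \<in> T (fst u)" by (rule psec_tangent[OF T u])
  show "g u (mixed_torsion M nabla X eta u) (mixed_torsion M nabla X eta u) = 0"
    using metric_derivative_ver[OF X eta_psec T u] metric_derivative_ver_eta[OF X T u] by simp
qed

end

sublocale cartan_berwald \<subseteq> c: normal_connection M L G nabla
proof
  fix X u assume X: "X \<in> Sec" and u: "u \<in> TM0"
  show "nabla u (gamma M u (X u)) eta = X u"
    using mixed_torsion_eq[OF X eta_psec u] mixed_torsion_eta[OF X u] fibre_deriv_eta[OF u psec_tangent[OF X u]] by simp
qed

context cartan_berwald
begin

text \<open>The vertical component, with respect to the Berwald connection, of the Cartan horizontal lift of \<open>X\<close>.\<close>

definition defect :: "'m psection \<Rightarrow> 'm psection" where
  "defect X u = D0 u (c.hor X u) eta"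

definition difference :: "'m psection \<Rightarrow> 'm psection \<Rightarrow> 'm psection" where
  "difference X Y u = nabla u (c.hor X u) Y - D0 u (c.hor X u) Y"

lemma defect_psec: "X \<in> Sec \<Longrightarrow> defect X \<in> Sec"
  unfolding defect_def[abs_def] by (rule D_psec[OF c.hor_vf eta_psec])

lemma difference_psec: "X \<in> Sec \<Longrightarrow> Y \<in> Sec \<Longrightarrow> difference X Y \<in> Sec"
  unfolding difference_def[abs_def] by (rule psec_diff[OF c.D_psec[OF c.hor_vf] D_psec[OF c.hor_vf]])

lemma hor_compare:
  assumes X: "X \<in> Sec" and u: "u \<in> TM0"
  shows "c.hor X u = hor X u + ver (defect X) u"
  using decomposition[OF c.hor_vf[OF X] u] c.rho_beta[OF X u] by (simp add: defect_def)

lemma difference_eta: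
  assumes X: "X \<in> Sec" and u: "u \<in> TM0"
  shows "difference X eta u = - defect X u"
  using c.beta_horizontal[OF X u] by (simp add: difference_def defect_def)

text \<open>Both connections have vanishing torsion on a pair of horizontal lifts for \<open>\<nabla>\<close>.\<close>

lemma difference_sym:
  assumes X: "X \<in> Sec" and Y: "Y \<in> Sec" and u: "u \<in> TM0"
  shows "difference X Y u = difference Y X u"
proof -
  note Xv = c.hor_vf[OF X] and Yv = c.hor_vf[OF Y]
  note Xu = slit.vf_tangent[OF Xv u] and Yu = slit.vf_tangent[OF Yv u]
  note RX = rho_psec[OF Xv] and RY = rho_psec[OF Yv]
  have "h_torsion M nabla X Y u = 0" using cartan X Y u unfolding cartan_connection_def by blast
  then have "nabla u (c.hor X u) Y - nabla u (c.hor Y u) X = rho M u (lie (c.hor X) (c.hor Y) u)"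
    using c.D_cong[OF u Xu RY Y c.rho_beta[OF Y]] c.D_cong[OF u Yu RX X c.rho_beta[OF X]]
    by (simp add: h_torsion_def torsion_def)
  moreover have "D0 u (c.hor X u) Y - D0 u (c.hor Y u) X = rho M u (lie (c.hor X) (c.hor Y) u)"
    using D_cong[OF u Xu RY Y c.rho_beta[OF Y]] D_cong[OF u Yu RX X c.rho_beta[OF X]] torsion_free[OF Xv Yv u]
    by simp
  ultimately have "nabla u (c.hor X u) Y - nabla u (c.hor Y u) X = D0 u (c.hor X u) Y - D0 u (c.hor Y u) X" by simp
  then show ?thesis by (simp add: difference_def algebra_simps)
qed

abbreviation "Dg X Y Z u \<equiv> metric_derivative D0 L (c.hor X) Y Z u"

lemma Dg_difference:
  assumes X: "X \<in> Sec" and Y: "Y \<in> Sec" and Z: "Z \<in> Sec" and u: "u \<in> TM0"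
  shows "Dg X Y Z u = g u (difference X Y u) (Z u) + g u (difference X Z u) (Y u)"
proof -
  note Xv = c.hor_vf[OF X]
  have n: "nabla u (c.hor X u) V = difference X V u + D0 u (c.hor X u) V" for V
    by (simp add: difference_def)
  note Bt = difference_psec[OF X] and D = D_psec[OF Xv]
  have "Dg X Y Z u = g u (difference X Y u) (Z u) + g u (Y u) (difference X Z u)"
    using cartan_metric[OF Xv Y Z u] n[of Y] n[of Z]
      g_add(1)[OF u psec_tangent[OF Bt[OF Y] u] psec_tangent[OF D[OF Y] u] psec_tangent[OF Z u]]
      g_add(2)[OF u psec_tangent[OF Bt[OF Z] u] psec_tangent[OF D[OF Z] u] psec_tangent[OF Y u]]
    by (simp add: metric_derivative_def)
  then show ?thesis using g_sym[OF Y Bt[OF Z] u] by simp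
qed

text \<open>As in the uniqueness proof of the Levi-Civita connection: \<open>Dg_difference\<close> is solved for the symmetric
  tensor \<open>difference\<close> by an alternating sum.\<close>

lemma Dg_Christoffel:
  assumes X: "X \<in> Sec" and Y: "Y \<in> Sec" and Z: "Z \<in> Sec" and u: "u \<in> TM0"
  shows "2 * g u (difference X Y u) (Z u) = Dg X Y Z u + Dg Y X Z u - Dg Z X Y u"
  using Dg_difference[OF X Y Z u] Dg_difference[OF Y X Z u] Dg_difference[OF Z X Y u]
    difference_sym[OF X Y u] difference_sym[OF X Z u] difference_sym[OF Y Z u] by simp

lemma Dg_split:
  assumes X: "X \<in> Sec" and Y: "Y \<in> Sec" and Z: "Z \<in> Sec" and u: "u \<in> TM0"
  shows "Dg X Y Z u = metric_derivative D0 L (hor X) Y Z u + metric_derivative D0 L (ver (defect X)) Y Z u"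
proof -
  note A = defect_psec[OF X]
  note hu = slit.vf_tangent[OF hor_vf[OF X] u] and vu = slit.vf_tangent[OF gamma_vf[OF A] u]
  have D: "D0 u (c.hor X u) V = D0 u (hor X u) V + D0 u (ver (defect X) u) V" if "V \<in> Sec" for V
    unfolding hor_compare[OF X u] by (rule D_add[OF u hu vu that])
  note th = psec_tangent[OF D_psec[OF hor_vf[OF X]] u] and tv = psec_tangent[OF D_psec[OF gamma_vf[OF A]] u]
  have "c.hor X u F = hor X u F + ver (defect X) u F" for F unfolding hor_compare[OF X u] by simp
  then show ?thesis
    using D[OF Y] D[OF Z] g_add(1)[OF u th[OF Y] tv[OF Y] psec_tangent[OF Z u]]
      g_add(2)[OF u th[OF Z] tv[OF Z] psec_tangent[OF Y u]]
    by (simp add: metric_derivative_def)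
qed

lemma Dg_eta:
  assumes X: "X \<in> Sec" and Z: "Z \<in> Sec" and u: "u \<in> TM0"
  shows "Dg X eta Z u = 0" "Dg X Z eta u = 0"
proof -
  show *: "Dg X eta Z u = 0"
    using Dg_split[OF X eta_psec Z u] metric_derivative_hor_eta[OF X Z u]
      metric_derivative_ver_eta[OF defect_psec[OF X] Z u] by simp
  then show "Dg X Z eta u = 0" using metric_derivative_swap[OF c.hor_vf[OF X] Z eta_psec u] by simp
qed

text \<open>Put \<open>Y = \<eta>\<close> in \<open>Dg_Christoffel\<close>.  The left side becomes \<open>- 2 g(defect X, Z)\<close>, and on the right only the term with
  differentiation along \<open>\<beta>\<eta>\<close> is left.\<close>

lemma defect_from_metric:
  assumes X: "X \<in> Sec" and u: "u \<in> TM0"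
    and D0eta: "\<And>Z. Z \<in> Sec \<Longrightarrow> Dg eta X Z u = 0"
  shows "defect X u = 0"
proof (rule g_nondegenerate[OF u])
  note A = defect_psec[OF X]
  note Au = psec_tangent[OF A u]
  show "defect X u \<in> T (fst u)" by (rule Au)
  have "g u (difference X eta u) (defect X u) = 0"
    using Dg_Christoffel[OF X eta_psec A u] Dg_eta[OF X A u] Dg_eta[OF A X u] D0eta[OF A] by simp
  then show "g u (defect X u) (defect X u) = 0"
    using difference_eta[OF X u] g_diff(1)[OF u zero_tangent Au Au] g_zero(1)[OF u Au] by simp
qed

lemma defect_eta: assumes u: "u \<in> TM0" shows "defect eta u = 0"
  by (rule defect_from_metric[OF eta_psec u]) (rule Dg_eta(1)[OF eta_psec _ u])

text \<open>As \<open>defect eta\<close> is already known to vanish, \<open>\<beta>\<eta>\<close> is the spray, along which \<open>g\<close> is parallel.\<close>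

lemma defect_zero:
  assumes X: "X \<in> Sec" and u: "u \<in> TM0"
  shows "defect X u = 0"
proof (rule defect_from_metric[OF X u])
  fix Z assume Z: "Z \<in> Sec"
  have "metric_derivative D0 L G X Z u = 0"
    using metric_parallel_along_spray X Z u unfolding metric_parallel_along_def by blast
  then have h: "metric_derivative D0 L (hor eta) X Z u = 0"
    by (simp add: metric_derivative_def spray_horizontal[OF u])
  have v0: "ver (defect eta) u = 0" using defect_eta[OF u] gamma_zero[OF u] by simp
  have "metric_derivative D0 L (ver (defect eta)) X Z u = 0"
    unfolding metric_derivative_def v0
    using D_zero[OF u X] D_zero[OF u Z] g_zero[OF u psec_tangent[OF X u]] g_zero[OF u psec_tangent[OF Z u]] by simp
  then show "Dg eta X Z u = 0" using Dg_split[OF eta_psec X Z u] h by simp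
qed

lemma hor_eq:
  assumes X: "X \<in> Sec" and u: "u \<in> TM0" shows "c.hor X u = hor X u"
  using hor_compare[OF X u] defect_zero[OF X u] gamma_zero[OF u] by simp

text \<open>Since both connections have the same horizontal spaces and invert \<open>\<gamma>\<close>, they have the same connection map.  So the
  bracket term in \<open>vhv_torsion_eq\<close> can be evaluated with the Berwald connection, where it is \<open>D\<^bsub>\<beta>X\<^esub>Y\<close>.\<close>

lemma vhv_torsion_difference:
  assumes X: "X \<in> Sec" and Y: "Y \<in> Sec" and u: "u \<in> TM0"
  shows "vhv_torsion M nabla X Y u = - difference X Y u"
proof -
  let ?b = "lie (c.hor X) (ver Y)"
  have b: "?b \<in> VF" by (rule slit.bracket_vf[OF c.hor_vf[OF X] gamma_vf[OF Y]])
  note R = rho_psec[OF b] and K = D_psec[OF b eta_psec]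
  have "nabla u (?b u) eta = nabla u (hor (\<lambda>u. rho M u (?b u)) u + ver (\<lambda>u. D0 u (?b u) eta) u) eta"
    using decomposition[OF b u] by simp
  also have "\<dots> = nabla u (c.hor (\<lambda>u. rho M u (?b u)) u) eta + nabla u (ver (\<lambda>u. D0 u (?b u) eta) u) eta"
    unfolding hor_eq[OF R u, symmetric]
    by (rule c.D_add[OF u c.beta_tangent[OF R u] slit.vf_tangent[OF gamma_vf[OF K] u] eta_psec])
  also have "\<dots> = D0 u (?b u) eta"
    using c.beta_horizontal[OF R u] c.D_ver_eta[OF K u] by simp
  finally have "nabla u (?b u) eta = D0 u (?b u) eta" .
  moreover have "?b u = lie (hor X) (ver Y) u"
    by (rule slit.bracket_cong[where X = "hor X" and Y = "ver Y" and Y' = "ver Y", OF u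
        slit.vf_tangent[OF hor_vf[OF X] u] slit.vf_tangent[OF gamma_vf[OF Y] u] hor_eq[OF X] refl])
  ultimately have "nabla u (?b u) eta = D0 u (hor X u) Y"
    using bracket_hor_ver_vertical[OF X Y u] by simp
  then show ?thesis using c.vhv_torsion_eq[OF X Y u] hor_eq[OF X u] by (simp add: difference_def)
qed

lemma Dg_eq_hor:
  assumes X: "X \<in> Sec" and u: "u \<in> TM0"
  shows "Dg X Y Z u = metric_derivative D0 L (hor X) Y Z u"
  using hor_eq[OF X u] by (simp add: metric_derivative_def)

text \<open>By total symmetry the three terms in \<open>Dg_Christoffel\<close> coincide up to sign.\<close>

lemma metric_derivative_cartan_hor:
  assumes X: "X \<in> Sec" and Y: "Y \<in> Sec" and Z: "Z \<in> Sec" and u: "u \<in> TM0"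
  shows "Dg X Y Z u = - 2 * g u (vhv_torsion M nabla X Y u) (Z u)"
proof -
  have ex: "Dg A B C u = Dg C B A u" and sw: "Dg A B C u = Dg A C B u"
    if "A \<in> Sec" "B \<in> Sec" "C \<in> Sec" for A B C
    using metric_derivative_hor_exchange[OF that u] Dg_eq_hor[OF that(1) u] Dg_eq_hor[OF that(3) u]
      metric_derivative_swap[OF c.hor_vf[OF that(1)] that(2,3) u] by simp_all
  have "Dg Y X Z u = Dg X Y Z u" using ex[OF Y X Z] sw[OF Z X Y] ex[OF X Y Z] by simp
  moreover have "Dg Z X Y u = Dg X Y Z u" using sw[OF Z X Y] ex[OF X Y Z] by simp
  ultimately have "2 * g u (difference X Y u) (Z u) = Dg X Y Z u" using Dg_Christoffel[OF X Y Z u] by simp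
  moreover note Bu = psec_tangent[OF difference_psec[OF X Y] u] and Zu = psec_tangent[OF Z u]
  have "g u (vhv_torsion M nabla X Y u) (Z u) = - g u (difference X Y u) (Z u)"
    using vhv_torsion_difference[OF X Y u] g_diff(1)[OF u zero_tangent Bu Zu] g_zero(1)[OF u Zu] by simp
  ultimately show ?thesis by simp
qed

lemma vhv_torsion_psec:
  assumes X: "X \<in> Sec" and Y: "Y \<in> Sec"
  shows "vhv_torsion M nabla X Y \<in> Sec"
  by (rule psec_cong[OF psec_diff[OF psec_zero difference_psec[OF X Y]]]) (simp add: vhv_torsion_difference[OF X Y])

text \<open>The right side refers to the Berwald connection only, so that the criterion is the same for every connection
  satisfying the axioms of the Cartan connection.\<close>

lemma vhv_torsion_zero_iff:
  "(\<forall>X\<in>Sec. \<forall>Y\<in>Sec. \<forall>u\<in>TM0. vhv_torsion M nabla X Y u = 0) \<longleftrightarrow>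
   (\<forall>X\<in>Sec. metric_parallel_along M D0 L (hor X))" (is "?l \<longleftrightarrow> ?r")
proof
  assume l: ?l
  show ?r unfolding metric_parallel_along_def
  proof (intro ballI)
    fix X Y Z u assume X: "X \<in> Sec" and Y: "Y \<in> Sec" and Z: "Z \<in> Sec" and u: "u \<in> TM0"
    show "metric_derivative D0 L (hor X) Y Z u = 0"
      using metric_derivative_cartan_hor[OF X Y Z u] l X Y u Dg_eq_hor[OF X u] g_zero(1)[OF u psec_tangent[OF Z u]] by simp
  qed
next
  assume r: ?r
  show ?l
  proof (intro ballI)
    fix X Y u assume X: "X \<in> Sec" and Y: "Y \<in> Sec" and u: "u \<in> TM0"
    note P = vhv_torsion_psec[OF X Y]
    have "Dg X Y (vhv_torsion M nabla X Y) u = 0"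
      using r X Y P u Dg_eq_hor[OF X u] unfolding metric_parallel_along_def by simp
    then have "g u (vhv_torsion M nabla X Y u) (vhv_torsion M nabla X Y u) = 0"
      using metric_derivative_cartan_hor[OF X Y P u] by simp
    then show "vhv_torsion M nabla X Y u = 0" by (rule g_nondegenerate[OF u psec_tangent[OF P u]])
  qed
qed

lemma metric_parallel_along_hor_eq:
  "X \<in> Sec \<Longrightarrow> metric_parallel_along M D0 L (c.hor X) \<longleftrightarrow> metric_parallel_along M D0 L (hor X)"
  unfolding metric_parallel_along_def by (simp add: Dg_eq_hor)

end

section \<open>Riemannian metrics\<close>

context base_manifold
begin

lemma pullback_psec:
  assumes V: "V \<in> vector_fields M" shows "(\<lambda>u. V (fst u)) \<in> Sec"
  unfolding psections_iff
proof (intro conjI ballI allI impI)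
  show "V (fst u) \<in> T (fst u)" if "u \<in> TM0" for u by (rule vf_tangent[OF V slit_carrierD(1)[OF that]])
  fix u f assume u: "u \<in> TM0" and f: "smooth_at M (fst u) f"
  show "smooth_at (slit M) u (\<lambda>w. V (fst w) f)"
    using smooth_at_base[OF u vf_smooth[OF V f]] by (simp add: o_def)
qed

lemma fibre_deriv_pullback:
  assumes u: "u \<in> TM0" and y: "y \<in> T (fst u)"
  shows "fibre_deriv M u y (\<lambda>u. V (fst u)) = 0"
proof
  fix f
  show "fibre_deriv M u y (\<lambda>u. V (fst u)) f = 0 f"
    using gamma_base[OF u y, of "\<lambda>p. V p f"] by (simp add: fibre_deriv_def o_def)
qed

text \<open>Used to extend functions with support in a chart by zero; this is where the Hausdorff property enters.\<close>

lemma closedin_chart_cball: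
  assumes H: "Hausdorff_space (manifold_topology M)" and c: "(U, \<phi>) \<in> M" and K: "compact K" "K \<subseteq> \<phi> ` U"
  shows "closedin (manifold_topology M) (inv_into U \<phi> ` K)"
proof (rule compactin_imp_closedin[OF H], rule image_compactin)
  show "compactin (top_of_set (\<phi> ` U)) K" using K by (simp add: compactin_subtopology)
  show "continuous_map (top_of_set (\<phi> ` U)) (manifold_topology M) (inv_into U \<phi>)"
    unfolding continuous_map_def
  proof (intro conjI funcsetI allI impI)
    fix x assume "x \<in> topspace (top_of_set (\<phi> ` U))"
    then have "inv_into U \<phi> x \<in> U" by (intro inv_in_chart) simp
    then show "inv_into U \<phi> x \<in> topspace (manifold_topology M)"
      using chart_subset_carrier[OF c] topspace_eq by auto
  next
    fix W assume W: "openin (manifold_topology M) W"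
    have "{x \<in> topspace (top_of_set (\<phi> ` U)). inv_into U \<phi> x \<in> W} = \<phi> ` (U \<inter> W)" (is "?l = ?r")
    proof
      show "?r \<subseteq> ?l" using chart_inv[OF c] by auto
      show "?l \<subseteq> ?r" using chart_inv[OF c] by auto
    qed
    then show "openin (top_of_set (\<phi> ` U)) {x \<in> topspace (top_of_set (\<phi> ` U)). inv_into U \<phi> x \<in> W}"
      using openin_chart_image[OF W c] by (simp add: openin_open_eq chart_open[OF c] image_mono)
  qed
qed

text \<open>The coordinate field with the given components, multiplied by a cut-off function supported in the chart.\<close>

lemma vector_field_through:
  assumes H: "Hausdorff_space (manifold_topology M)" and p: "p \<in> carrier M" and v: "v \<in> T p"
  obtains V where "V \<in> vector_fields M" "V p = v"
proof -
  obtain U \<phi> where c: "(U, \<phi>) \<in> M" "p \<in> U" using carrier_chart[OF p] by metis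
  obtain r where r: "r > 0" "cball (\<phi> p) r \<subseteq> \<phi> ` U"
    using open_contains_cball[of "\<phi> ` U"] chart_open[OF c(1)] c(2) by auto
  obtain b :: "'e \<Rightarrow> real" where b: "smooth_on UNIV b" "b (\<phi> p) \<noteq> 0" "\<And>x. x \<notin> cball (\<phi> p) r \<Longrightarrow> b x = 0"
    by (rule smooth_bump[OF r(1), of "\<phi> p"], rule that)
  define V where "V q = (if q \<in> U then scal (b (\<phi> q) / b (\<phi> p)) (coord_vec M U \<phi> q (tvec_components \<phi> v)) else 0)" for q
  have "V \<in> vector_fields M" unfolding vector_fields_iff
  proof (intro conjI ballI allI impI)
    show "V q \<in> T q" if "q \<in> carrier M" for q
      unfolding V_def using tangent_scal[OF coord_vec_tangent[OF c(1)]] zero_tangent by simp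
    fix q f assume f: "smooth_at M q f"
    show "smooth_at M q (\<lambda>q. V q f)"
    proof (cases "q \<in> U")
      case True
      obtain N where N: "open N" "\<phi> q \<in> N" "N \<subseteq> \<phi> ` U" "smooth_on N (f \<circ> inv_into U \<phi>)"
        using smooth_at_rep[OF c(1) True f] .
      show ?thesis
      proof (rule smooth_at_of_rep[OF c(1) True N(1-3)])
        show "smooth_on N (\<lambda>x. (1 / b (\<phi> p)) * b x * frechet_derivative (f \<circ> inv_into U \<phi>) (at x) (tvec_components \<phi> v))"
          by (intro smooth_on_mult smooth_on_const N(1) smooth_on_frechet_const[OF N(4)])
            (rule smooth_on_subset[OF b(1)], simp)
        fix q' assume q': "q' \<in> U" "\<phi> q' \<in> N"
        have "smooth_at M q' f"
          by (rule smooth_at_of_rep[OF c(1) q'(1) N(1) q'(2) N(3,4)]) (simp add: chart_inv[OF c(1)])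
        then show "V q' f = (1 / b (\<phi> p)) * b (\<phi> q') *
            frechet_derivative (f \<circ> inv_into U \<phi>) (at (\<phi> q')) (tvec_components \<phi> v)"
          using q'(1) by (simp add: V_def scal_def coord_vec_def)
      qed
    next
      case False
      let ?W = "carrier M - inv_into U \<phi> ` cball (\<phi> p) r"
      have W: "openin (manifold_topology M) ?W"
        using closedin_chart_cball[OF H c(1) compact_cball r(2)] by (simp add: closedin_def topspace_eq)
      have "q \<notin> inv_into U \<phi> ` cball (\<phi> p) r"
      proof
        assume "q \<in> inv_into U \<phi> ` cball (\<phi> p) r"
        then obtain x where "x \<in> cball (\<phi> p) r" "q = inv_into U \<phi> x" by blast
        then have "q \<in> U" using inv_in_chart[OF subsetD[OF r(2)]] by simp
        then show False using False by simp
      qed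
      then have qW: "q \<in> ?W" using smooth_at_carrier[OF f] by simp
      show ?thesis
      proof (rule smooth_at_cong[OF W qW _ smooth_at_const[OF smooth_at_carrier[OF f], of 0]])
        fix q' assume q': "q' \<in> ?W"
        show "0 = V q' f"
        proof (cases "q' \<in> U")
          case True
          have "\<phi> q' \<notin> cball (\<phi> p) r"
          proof
            assume "\<phi> q' \<in> cball (\<phi> p) r"
            then have "inv_into U \<phi> (\<phi> q') \<in> inv_into U \<phi> ` cball (\<phi> p) r" by (rule imageI)
            then show False using q' chart_inv[OF c(1) True] by simp
          qed
          then show ?thesis using b(3) by (simp add: V_def scal_def)
        qed (simp add: V_def)
      qed
    qed
  qed
  moreover have "V p = v"
    using c b(2) coord_vec_components[OF c v] by (simp add: V_def scal_def)
  ultimately show ?thesis by (rule that)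
qed

end

context finsler
begin

lemma Hausdorff: "Hausdorff_space (manifold_topology M)"
  using finsler unfolding finsler_manifold_def smooth_manifold_def by simp

text \<open>The product rule along a fibre for an inner product that is frozen at \<open>u\<close>.  If \<open>g\<close> is constant along the fibres,
  it may be frozen, and the formula says that \<open>g\<close> is parallel for the fibre derivative.\<close>

lemma fixed_metric_derivative:
  assumes X: "X \<in> Sec" and Y: "Y \<in> Sec" and Z: "Z \<in> Sec" and u: "u \<in> TM0"
  shows "((\<lambda>s. g u (Y (fst u, snd u + scal s (X u))) (Z (fst u, snd u + scal s (X u)))) has_real_derivative
    g u (fibre_deriv M u (X u) Y) (Z u) + g u (Y u) (fibre_deriv M u (X u) Z)) (at 0)"
proof -
  obtain U \<phi> where c: "(U, \<phi>) \<in> M" "fst u \<in> U" "u \<in> sdom M U" using slit_obtain_chart[OF u] .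
  note Xu = psec_tangent[OF X u] and Yu = psec_tangent[OF Y u] and Zu = psec_tangent[OF Z u]
  let ?l = "\<lambda>s. (fst u, snd u + scal s (X u))"
  let ?k = "coord_vec M U \<phi> (fst u)"
  let ?c = "tvec_components \<phi>"
  define b where "b x y = g u (?k x) (?k y)" for x y
  have kT: "?k x \<in> T (fst u)" for x by (rule coord_vec_tangent[OF c(1,2)])
  have "bilinear b" unfolding bilinear_def
  proof (intro conjI allI)
    show "linear (\<lambda>y. b x y)" for x
      using g_add(2)[OF u kT kT kT] g_lincomb_right[OF u kT kT zero_tangent] g_zero(2)[OF u kT]
      by (intro linearI) (simp_all add: b_def coord_vec_add[OF c(1,2)] coord_vec_scale[OF c(1,2)])
    show "linear (\<lambda>x. b x y)" for y
      using g_add(1)[OF u kT kT kT] g_lincomb_left[OF u kT zero_tangent kT] g_zero(1)[OF u kT]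
      by (intro linearI) (simp_all add: b_def coord_vec_add[OF c(1,2)] coord_vec_scale[OF c(1,2)])
  qed
  then have bb: "bounded_bilinear b" by (simp add: bilinear_conv_bounded_bilinear)
  have bg: "b (?c v) (?c w) = g u v w" if "v \<in> T (fst u)" "w \<in> T (fst u)" for v w
    by (simp add: b_def coord_vec_components[OF c(1,2)] that)
  have l0: "?l 0 = u" by (simp add: scal_def plus_fun_def)
  have d: "((\<lambda>s. ?c (V (?l s))) has_derivative (\<lambda>h. h *\<^sub>R ?c (fibre_deriv M u (X u) V))) (at 0)" if V: "V \<in> Sec" for V
  proof (subst has_derivative_componentwise_within, rule ballI)
    fix i :: 'e assume i: "i \<in> Basis"
    have si: "smooth_at M (fst u) (\<lambda>q. \<phi> q \<bullet> i)" by (rule smooth_at_coord[OF c(1,2)])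
    have "((\<lambda>s. V (?l s) (\<lambda>q. \<phi> q \<bullet> i)) has_real_derivative gamma M u (X u) (\<lambda>q. V q (\<lambda>q. \<phi> q \<bullet> i))) (at 0)"
      by (rule gamma_deriv[OF u Xu psec_smooth[OF V u si]])
    then show "((\<lambda>s. ?c (V (?l s)) \<bullet> i) has_derivative (\<lambda>h. (h *\<^sub>R ?c (fibre_deriv M u (X u) V)) \<bullet> i)) (at 0)"
      by (simp add: has_field_derivative_def tvec_components_inner[OF i] fibre_deriv_apply[OF si] mult.commute[of _ "gamma M u (X u) _"])
  qed
  note vY = fibre_deriv_tangent[OF u Xu Y] and vZ = fibre_deriv_tangent[OF u Xu Z]
  have "((\<lambda>s. b (?c (Y (?l s))) (?c (Z (?l s)))) has_derivative
    (\<lambda>h. b (?c (Y (?l 0))) (h *\<^sub>R ?c (fibre_deriv M u (X u) Z)) + b (h *\<^sub>R ?c (fibre_deriv M u (X u) Y)) (?c (Z (?l 0))))) (at 0)"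
    by (rule bounded_bilinear.FDERIV[OF bb d[OF Y] d[OF Z]])
  moreover have "b (?c (Y (?l 0))) (h *\<^sub>R ?c (fibre_deriv M u (X u) Z)) + b (h *\<^sub>R ?c (fibre_deriv M u (X u) Y)) (?c (Z (?l 0))) =
      (g u (fibre_deriv M u (X u) Y) (Z u) + g u (Y u) (fibre_deriv M u (X u) Z)) * h" for h
    unfolding l0 bounded_bilinear.scaleR_left[OF bb] bounded_bilinear.scaleR_right[OF bb]
      bg[OF Yu vZ] bg[OF vY Zu] by (simp add: algebra_simps)
  ultimately have "((\<lambda>s. b (?c (Y (?l s))) (?c (Z (?l s)))) has_real_derivative
      g u (fibre_deriv M u (X u) Y) (Z u) + g u (Y u) (fibre_deriv M u (X u) Z)) (at 0)"
    unfolding has_field_derivative_def by simp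
  moreover have "\<forall>\<^sub>F s in nhds 0. b (?c (Y (?l s))) (?c (Z (?l s))) = g u (Y (?l s)) (Z (?l s))"
    using eventually_line_slit[OF u Xu]
  proof (rule eventually_mono)
    fix s assume q: "?l s \<in> TM0"
    show "b (?c (Y (?l s))) (?c (Z (?l s))) = g u (Y (?l s)) (Z (?l s))"
      by (rule bg) (use psec_tangent[OF Y q] psec_tangent[OF Z q] in simp_all)
  qed
  ultimately show ?thesis by (simp only: DERIV_cong_ev[OF refl _ refl])
qed

lemma g_reversible:
  assumes rev: "reversible M L" and u: "u \<in> TM0" and v: "v \<in> T (fst u)" and w: "w \<in> T (fst u)"
  shows "g (fst u, scal (-1) (snd u)) v w = g u v w"
proof -
  note p = slit_carrierD(1)[OF u] and y = slit_carrierD(2)[OF u]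
  have "E (fst u, scal (-1) (snd u) + scal s v + scal t w) =
      E (fst u, snd u + scal s (scal (-1) v) + scal t (scal (-1) w))" for s t
  proof -
    let ?z = "scal (-1) (snd u) + scal s v + scal t w"
    have z: "?z \<in> T (fst u)" by (intro tangent_add tangent_scal y v w)
    have "snd u + scal s (scal (-1) v) + scal t (scal (-1) w) = scal (-1) ?z"
      by (auto simp: scal_def fun_eq_iff algebra_simps)
    moreover have "\<forall>(p, v)\<in>carrier (tangent_bundle M). L (p, scal (-1) v) = L (p, v)"
      using rev unfolding reversible_def .
    then have "L (fst u, scal (-1) ?z) = L (fst u, ?z)" using tangent_bundle_carrier[OF p z] by fast
    ultimately show ?thesis by (simp add: energy_def)
  qed
  then have "g (fst u, scal (-1) (snd u)) v w = g u (scal (-1) v) (scal (-1) w)"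
    unfolding finsler_metric_def by simp
  also have "\<dots> = g u v w"
    using g_lincomb_left[OF u v zero_tangent tangent_scal[OF w], of "-1" "-1"]
      g_lincomb_right[OF u v w zero_tangent, of "-1"] g_zero[OF u v] g_zero(1)[OF u tangent_scal[OF w]] by simp
  finally show ?thesis .
qed

lemma g_constant_on_segment:
  assumes vert: "\<And>u x v w. u \<in> TM0 \<Longrightarrow> x \<in> T (fst u) \<Longrightarrow> v \<in> T (fst u) \<Longrightarrow> w \<in> T (fst u) \<Longrightarrow>
      ((\<lambda>s. g (fst u, snd u + scal s x) v w) has_real_derivative 0) (at 0)"
    and p: "p \<in> carrier M" and y: "y \<in> T p" "y' \<in> T p" and v: "v \<in> T p" and w: "w \<in> T p"
    and seg: "\<And>s. s \<in> {0..1} \<Longrightarrow> scal (1 - s) y + scal s y' \<noteq> 0"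
  shows "g (p, y) v w = g (p, y') v w"
proof -
  define f where "f s = g (p, scal (1 - s) y + scal s y') v w" for s
  have d: "(f has_real_derivative 0) (at s)" if s: "s \<in> {0..1}" for s
  proof -
    let ?u = "(p, scal (1 - s) y + scal s y')"
    have "?u \<in> TM0"
      using p seg[OF s] tangent_add[OF tangent_scal[OF y(1)] tangent_scal[OF y(2)]] by (simp add: carrier_slit_iff)
    from vert[OF this, of "y' - y" v w] tangent_diff[OF y(2,1)] v w
    have "((\<lambda>h. g (p, scal (1 - s) y + scal s y' + scal h (y' - y)) v w) has_real_derivative 0) (at 0)" by simp
    moreover have "scal (1 - s) y + scal s y' + scal h (y' - y) = scal (1 - (h + s)) y + scal (h + s) y'" for h
      by (auto simp: scal_def fun_eq_iff algebra_simps)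
    ultimately have "((\<lambda>h. f (h + s)) has_real_derivative 0) (at 0)" by (simp add: f_def)
    then show ?thesis using DERIV_shift[of f 0 0 s] by simp
  qed
  have "f 1 = f 0"
  proof (rule DERIV_isconst_end[of 0 1 f])
    show "continuous_on {0..1} f"
      using d by (meson DERIV_isCont continuous_at_imp_continuous_on)
  qed (use d in auto)
  then show ?thesis by (simp add: f_def scal_def plus_fun_def)
qed

text \<open>If the segment from \<open>y\<close> to \<open>y'\<close> meets the origin, then \<open>y'\<close> is a negative multiple of \<open>y\<close>.  In dimension at least two
  one passes through a third vector outside the line spanned by \<open>y\<close>; for a reversible \<open>L\<close> one first replaces \<open>y\<close>
  by \<open>- y\<close>.\<close>

lemma g_constant_on_fibre:
  assumes vert: "\<And>u x v w. u \<in> TM0 \<Longrightarrow> x \<in> T (fst u) \<Longrightarrow> v \<in> T (fst u) \<Longrightarrow> w \<in> T (fst u) \<Longrightarrow>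
      ((\<lambda>s. g (fst u, snd u + scal s x) v w) has_real_derivative 0) (at 0)"
    and dim: "2 \<le> DIM('e) \<or> reversible M L"
    and y: "(p, y) \<in> TM0" "(p, y') \<in> TM0" and v: "v \<in> T p" and w: "w \<in> T p"
  shows "g (p, y) v w = g (p, y') v w"
proof (cases "\<exists>s\<in>{0..1}. scal (1 - s) y + scal s y' = 0")
  case False
  then show ?thesis
    using y by (intro g_constant_on_segment[OF vert _ _ _ v w]) (auto simp: carrier_slit_iff)
next
  case True
  have p: "p \<in> carrier M" and yT: "y \<in> T p" "y' \<in> T p" and yn: "y \<noteq> 0" "y' \<noteq> 0" using y by (auto simp: carrier_slit_iff)
  obtain s where s: "s \<in> {0..1}" "scal (1 - s) y + scal s y' = 0" using True by blast
  have "s \<noteq> 0" using s yn by (auto simp: scal_def plus_fun_def zero_fun_def)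
  define k where "k = (1 - s) / s"
  have "s * y' f + (1 - s) * y f = 0" for f
    using fun_cong[OF s(2), of f] by (simp add: scal_def)
  then have y': "y' = scal (- k) y" using \<open>s \<noteq> 0\<close> by (auto simp: scal_def k_def fun_eq_iff field_simps)
  have "k \<ge> 0" using s by (simp add: k_def)
  then have k: "k > 0" using y' yn by (cases "k = 0") (auto simp: scal_def zero_fun_def)
  from dim show ?thesis
  proof
    assume "2 \<le> DIM('e)"
    obtain U \<phi> where c: "(U, \<phi>) \<in> M" "p \<in> U" using carrier_chart[OF p] by metis
    have "dim {tvec_components \<phi> y} < DIM('e)" using \<open>2 \<le> DIM('e)\<close> by (simp add: dim_singleton)
    then have "span {tvec_components \<phi> y} \<noteq> UNIV" using dim_span dim_UNIV by (metis less_irrefl)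
    then obtain e where e: "e \<notin> span {tvec_components \<phi> y}" by blast
    define x where "x = coord_vec M U \<phi> p e"
    have x: "x \<in> T p" "tvec_components \<phi> x = e"
      unfolding x_def by (rule coord_vec_tangent[OF c], rule components_coord_vec[OF c])
    have nx: "x \<noteq> scal a y" for a
    proof
      assume "x = scal a y"
      then have "e = a *\<^sub>R tvec_components \<phi> y" using x(2) by (simp add: tvec_components_scal)
      then show False using e span_mul[OF span_base] by blast
    qed
    have "g (p, y) v w = g (p, x) v w"
    proof (rule g_constant_on_segment[OF vert p yT(1) x(1) v w])
      fix s :: real assume "s \<in> {0..1}"
      show "scal (1 - s) y + scal s x \<noteq> 0"
      proof
        assume a: "scal (1 - s) y + scal s x = 0"
        have "s \<noteq> 0" using a yn by (auto simp: scal_def plus_fun_def zero_fun_def)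
        moreover have "(1 - s) * y f + s * x f = 0" for f using fun_cong[OF a, of f] by (simp add: scal_def)
        ultimately have "x = scal (- ((1 - s) / s)) y" by (auto simp: scal_def fun_eq_iff field_simps eq_neg_iff_add_eq_0)
        then show False using nx by blast
      qed
    qed
    also have "\<dots> = g (p, y') v w"
    proof (rule g_constant_on_segment[OF vert p x(1) yT(2) v w])
      fix s :: real assume "s \<in> {0..1}"
      show "scal (1 - s) x + scal s y' \<noteq> 0"
      proof
        assume a: "scal (1 - s) x + scal s y' = 0"
        have "s \<noteq> 1" using a yn by (auto simp: scal_def plus_fun_def zero_fun_def)
        moreover have "(1 - s) * x f + s * (- k * y f) = 0" for f
          using fun_cong[OF a, of f] by (simp add: scal_def y')
        ultimately have "x = scal (s * k / (1 - s)) y" by (auto simp: scal_def fun_eq_iff field_simps)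
        then show False using nx by blast
      qed
    qed
    finally show ?thesis .
  next
    assume rev: "reversible M L"
    have "g (p, scal (-1) y) v w = g (p, y') v w"
    proof (rule g_constant_on_segment[OF vert p tangent_scal[OF yT(1)] yT(2) v w])
      fix s :: real assume s: "s \<in> {0..1}"
      have pos: "1 - s + s * k > 0"
      proof (cases "s = 0")
        case False
        then have "0 < s * k" using s k by simp
        then show ?thesis using s by simp
      qed simp
      show "scal (1 - s) (scal (-1) y) + scal s y' \<noteq> 0"
      proof
        assume "scal (1 - s) (scal (-1) y) + scal s y' = 0"
        from fun_cong[OF this] have "(1 - s + s * k) * y f = 0" for f
          by (simp add: scal_def y' algebra_simps)
        then have "y f = 0" for f using pos by (metis less_irrefl mult_eq_0_iff)
        then show False using yn by (auto simp: fun_eq_iff)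
      qed
    qed
    then show ?thesis using g_reversible[OF rev y(1)] v w by simp
  qed
qed

end

context berwald
begin

lemma riemannian_imp_parallel:
  assumes R: "riemannian M L" and X: "X \<in> Sec"
  shows "metric_parallel_along M D L (ver X)"
  unfolding metric_parallel_along_def
proof (intro ballI)
  fix Y Z u assume Y: "Y \<in> Sec" and Z: "Z \<in> Sec" and u: "u \<in> TM0"
  note Xu = psec_tangent[OF X u]
  obtain a where "\<forall>u\<in>TM0. \<forall>v\<in>T (fst u). \<forall>w\<in>T (fst u). g u v w = a (fst u) v w"
    using R unfolding riemannian_def by blast
  then have a: "g u v w = a (fst u) v w" if "u \<in> TM0" "v \<in> T (fst u)" "w \<in> T (fst u)" for u v w using that by blast
  have "ver X u (\<lambda>w. g w (Y w) (Z w)) = g u (fibre_deriv M u (X u) Y) (Z u) + g u (Y u) (fibre_deriv M u (X u) Z)"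
  proof (rule gamma_eqI[OF u Xu g_section_smooth[OF Y Z u]])
    let ?l = "\<lambda>s. (fst u, snd u + scal s (X u))"
    have "\<forall>\<^sub>F s in nhds 0. g u (Y (?l s)) (Z (?l s)) = g (?l s) (Y (?l s)) (Z (?l s))"
      using eventually_line_slit[OF u Xu]
    proof (rule eventually_mono)
      fix s assume q: "?l s \<in> TM0"
      have "Y (?l s) \<in> T (fst u)" "Z (?l s) \<in> T (fst u)" using psec_tangent[OF Y q] psec_tangent[OF Z q] by simp_all
      then show "g u (Y (?l s)) (Z (?l s)) = g (?l s) (Y (?l s)) (Z (?l s))"
        using a[OF u] a[OF q] by simp
    qed
    then show "((\<lambda>s. g (?l s) (Y (?l s)) (Z (?l s))) has_real_derivative
        g u (fibre_deriv M u (X u) Y) (Z u) + g u (Y u) (fibre_deriv M u (X u) Z)) (at 0)"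
      using fixed_metric_derivative[OF X Y Z u] by (simp only: DERIV_cong_ev[OF refl _ refl])
  qed
  then show "metric_derivative D L (ver X) Y Z u = 0"
    using D_ver[OF X Y u] D_ver[OF X Z u] by (simp add: metric_derivative_def)
qed

text \<open>For sections pulled back from vector fields on the base the fibre derivative vanishes, so that \<open>D\<^bsub>\<gamma>X\<^esub>g\<close> is the plain
  derivative of the coefficients.  By \<open>vector_field_through\<close> these sections attain all values.\<close>

lemma parallel_imp_line_derivative:
  assumes par: "\<And>X. X \<in> Sec \<Longrightarrow> metric_parallel_along M D L (ver X)"
    and u: "u \<in> TM0" and x: "x \<in> T (fst u)" and v: "v \<in> T (fst u)" and w: "w \<in> T (fst u)"
  shows "((\<lambda>s. g (fst u, snd u + scal s x) v w) has_real_derivative 0) (at 0)"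
proof -
  note p = slit_carrierD(1)[OF u]
  obtain X where X: "X \<in> vector_fields M" "X (fst u) = x" by (rule vector_field_through[OF Hausdorff p x])
  obtain V where V: "V \<in> vector_fields M" "V (fst u) = v" by (rule vector_field_through[OF Hausdorff p v])
  obtain W where W: "W \<in> vector_fields M" "W (fst u) = w" by (rule vector_field_through[OF Hausdorff p w])
  let ?p = "\<lambda>V u. V (fst u)"
  note Xp = pullback_psec[OF X(1)] and Vp = pullback_psec[OF V(1)] and Wp = pullback_psec[OF W(1)]
  have "metric_derivative D L (ver (?p X)) (?p V) (?p W) u = 0"
    using par[OF Xp] Vp Wp u unfolding metric_parallel_along_def by blast
  moreover have "D u (ver (?p X) u) (?p V) = 0" "D u (ver (?p X) u) (?p W) = 0"
    using D_ver[OF Xp Vp u] D_ver[OF Xp Wp u] fibre_deriv_pullback[OF u] vf_tangent[OF X(1) p] by simp_all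
  ultimately have "gamma M u x (\<lambda>q. g q (V (fst q)) (W (fst q))) = 0"
    using g_zero(1)[OF u w] g_zero(2)[OF u v] X(2) V(2) W(2) by (simp add: metric_derivative_def)
  then show ?thesis
    using gamma_deriv[OF u x g_section_smooth[OF Vp Wp u]] V(2) W(2) by simp
qed

lemma g_sym_vec:
  assumes u: "u \<in> TM0" and v: "v \<in> T (fst u)" and w: "w \<in> T (fst u)"
  shows "g u v w = g u w v"
proof -
  note p = slit_carrierD(1)[OF u]
  obtain V where V: "V \<in> vector_fields M" "V (fst u) = v" by (rule vector_field_through[OF Hausdorff p v])
  obtain W where W: "W \<in> vector_fields M" "W (fst u) = w" by (rule vector_field_through[OF Hausdorff p w])
  show ?thesis using g_sym[OF pullback_psec[OF V(1)] pullback_psec[OF W(1)] u] V(2) W(2) by simp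
qed

text \<open>The metric on the base is \<open>g\<close> evaluated at an arbitrary nonzero vector \<open>\<sigma> p\<close> of each fibre.  The choice \<open>\<sigma>\<close> need not be
  smooth; as \<open>g\<close> is constant on the fibres, a constant vector \<open>e\<close> in a chart may be used instead to see
  that the metric is smooth.\<close>

lemma parallel_imp_riemannian:
  assumes par: "\<And>X. X \<in> Sec \<Longrightarrow> metric_parallel_along M D L (ver X)"
    and dim: "2 \<le> DIM('e) \<or> reversible M L"
  shows "riemannian M L"
proof -
  define \<sigma> where "\<sigma> p = (SOME y. y \<in> T p \<and> y \<noteq> 0)" for p
  define a where "a p v w = g (p, \<sigma> p) v w" for p v w
  obtain e :: 'e where e: "e \<in> Basis" using nonempty_Basis by blast
  have ec: "(q, coord_vec M U \<phi> q e) \<in> sdom M U" if c: "(U, \<phi>) \<in> M" "q \<in> U" for q U \<phi>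
    using coord_vec_tangent[OF c, of e] components_eq_0_iff[OF c, of "coord_vec M U \<phi> q e"] c e
    by (auto simp: sdom_iff components_coord_vec)
  have s: "(p, \<sigma> p) \<in> TM0" if p: "p \<in> carrier M" for p
  proof -
    obtain U \<phi> where c: "(U, \<phi>) \<in> M" "p \<in> U" using carrier_chart[OF p] by metis
    have "\<exists>y. y \<in> T p \<and> y \<noteq> 0" using ec[OF c] by (auto simp: sdom_iff)
    then have "\<sigma> p \<in> T p \<and> \<sigma> p \<noteq> 0" unfolding \<sigma>_def by (rule someI_ex)
    then show ?thesis using p by (simp add: carrier_slit_iff)
  qed
  have ga: "g u v w = a (fst u) v w" if u: "u \<in> TM0" and v: "v \<in> T (fst u)" and w: "w \<in> T (fst u)" for u v w
    using g_constant_on_fibre[OF parallel_imp_line_derivative[OF par] dim, of "fst u" "snd u" "\<sigma> (fst u)" v w]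
      u v w s[OF slit_carrierD(1)[OF u]] by (simp add: a_def)
  have "riemannian_metric M a" unfolding riemannian_metric_def
  proof (intro conjI ballI allI impI)
    fix p assume p: "p \<in> carrier M"
    note sp = s[OF p]
    show "a p (scal r u + v) w = r * a p u w + a p v w" if "u \<in> T p" "v \<in> T p" "w \<in> T p" for u v w r
      unfolding a_def using g_lincomb_left[OF sp] that by simp
    show "a p v w = a p w v" if "v \<in> T p" "w \<in> T p" for v w
      unfolding a_def using g_sym_vec[OF sp] that by simp
    show "0 < a p v v" if "v \<in> T p" "v \<noteq> 0" for v
      unfolding a_def using g_pos[OF sp] that by simp
  next
    fix X Y assume X: "X \<in> vector_fields M" and Y: "Y \<in> vector_fields M"
    show "smooth_fun M (carrier M) (\<lambda>p. a p (X p) (Y p))" unfolding smooth_fun_carrier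
    proof
      fix p assume p: "p \<in> carrier M"
      obtain U \<phi> where c: "(U, \<phi>) \<in> M" "p \<in> U" using carrier_chart[OF p] by metis
      note sc = slit_chart[OF c(1)]
      let ?F = "\<lambda>q. g q (X (fst q)) (Y (fst q))"
      let ?u = "(p, coord_vec M U \<phi> p e)"
      have u: "?u \<in> sdom M U" by (rule ec[OF c])
      have su: "schart \<phi> ?u = (\<phi> p, e)" by (simp add: schart_def components_coord_vec[OF c])
      obtain N where N: "open N" "schart \<phi> ?u \<in> N" "N \<subseteq> schart \<phi> ` sdom M U"
          "smooth_on N (?F \<circ> sinv U \<phi>)"
        using slit.smooth_at_rep[OF sc u g_section_smooth[OF pullback_psec[OF X] pullback_psec[OF Y] sdom_subset[OF c(1) u]]] .
      let ?N = "(\<lambda>x. (x, e)) -` N \<inter> \<phi> ` U"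
      have oN: "open ?N"
        by (intro open_Int chart_open[OF c(1)] open_vimage N(1) continuous_intros)
      show "smooth_at M p (\<lambda>p. a p (X p) (Y p))"
      proof (rule smooth_at_of_rep[OF c oN])
        show "\<phi> p \<in> ?N" using N(2) su c(2) by simp
        have sN: "smooth_on ?N (\<lambda>x. (x, e))"
          by (intro smooth_on_Pair smooth_on_const oN smooth_on_linear bounded_linear_ident)
        show "smooth_on ?N (\<lambda>x. (?F \<circ> sinv U \<phi>) (x, e))"
          by (rule smooth_on_compose[OF oN N(1) _ sN N(4)]) auto
        fix q assume q: "q \<in> U" "\<phi> q \<in> ?N"
        have "sinv U \<phi> (\<phi> q, e) = (q, coord_vec M U \<phi> q e)"
          using schart_inv[OF c(1) imageI[OF q(1)], of e] chart_inv[OF c(1) q(1)] nonzero_Basis[OF e] by simp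
        moreover have "g (q, coord_vec M U \<phi> q e) (X q) (Y q) = a q (X q) (Y q)"
        proof -
          have "q \<in> carrier M" using q(1) chart_subset_carrier[OF c(1)] by blast
          then show ?thesis using ga[OF sdom_subset[OF c(1) ec[OF c(1) q(1)]]] vf_tangent[OF X] vf_tangent[OF Y] by simp
        qed
        ultimately show "a q (X q) (Y q) = (?F \<circ> sinv U \<phi>) (\<phi> q, e)" by simp
      qed auto
    qed
  qed
  then show ?thesis unfolding riemannian_def using ga by blast
qed

end

theorem proposition4p6:
  fixes M :: "('m, 'e::euclidean_space) atlas"
    and L :: "'m tpoint \<Rightarrow> real"
    and nabla D0 :: "'m conn"
    and G :: "'m vfield"
  assumes "finsler_manifold M L"
    and "cartan_connection M L nabla"
    and "berwald_connection M L D0"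
    and "canonical_spray M L G"
  shows
    "(\<forall>X\<in>psections M. \<forall>Y\<in>psections M. \<forall>Z\<in>psections M. \<forall>u\<in>carrier (slit M).
        metric_derivative D0 L (\<lambda>w. gamma M w (X w)) Y Z u
        = 2 * finsler_metric L u (mixed_torsion M nabla X Y u) (Z u)) \<and>
     (\<forall>X\<in>psections M. \<forall>Y\<in>psections M. \<forall>Z\<in>psections M. \<forall>u\<in>carrier (slit M).
        metric_derivative D0 L (\<lambda>w. beta M nabla w (X w)) Y Z u
        = - 2 * finsler_metric L u (vhv_torsion M nabla X Y u) (Z u)) \<and>
     metric_parallel_along M D0 L G \<and>
     (riemannian M L \<longrightarrow>
        (\<forall>X\<in>psections M. metric_parallel_along M D0 L (\<lambda>w. gamma M w (X w)))) \<and>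
     (2 \<le> DIM('e) \<or> reversible M L \<longrightarrow>
        (\<forall>X\<in>psections M. metric_parallel_along M D0 L (\<lambda>w. gamma M w (X w))) \<longrightarrow>
        riemannian M L) \<and>
     (landsbergian M L \<longleftrightarrow>
        (\<forall>X\<in>psections M. metric_parallel_along M D0 L (\<lambda>w. beta M nabla w (X w))))"
proof -
  have cb: "cartan_berwald M L G D0 D" if "cartan_connection M L D" for D
  proof
    show "smooth_atlas M" using assms(1) by (simp add: finsler_manifold_def smooth_manifold_def)
    show "regular_connection M D0" using assms(3) by (simp add: berwald_connection_def)
    show "regular_connection M D" using that by (simp add: cartan_connection_def)
  qed (fact assms that)+
  interpret cartan_berwald M L G D0 nabla by (rule cb[OF assms(2)])
  have a: "\<forall>X\<in>psections M. \<forall>Y\<in>psections M. \<forall>Z\<in>psections M. \<forall>u\<in>carrier (slit M).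
        metric_derivative D0 L (\<lambda>w. gamma M w (X w)) Y Z u
        = 2 * finsler_metric L u (mixed_torsion M nabla X Y u) (Z u)"
    by (intro ballI metric_derivative_ver)
  have b: "\<forall>X\<in>psections M. \<forall>Y\<in>psections M. \<forall>Z\<in>psections M. \<forall>u\<in>carrier (slit M).
        metric_derivative D0 L (\<lambda>w. beta M nabla w (X w)) Y Z u
        = - 2 * finsler_metric L u (vhv_torsion M nabla X Y u) (Z u)"
    by (intro ballI metric_derivative_cartan_hor)
  have d: "riemannian M L \<longrightarrow> (\<forall>X\<in>psections M. metric_parallel_along M D0 L (\<lambda>w. gamma M w (X w)))"
    by (intro impI ballI riemannian_imp_parallel)
  have e: "2 \<le> DIM('e) \<or> reversible M L \<longrightarrow>
        (\<forall>X\<in>psections M. metric_parallel_along M D0 L (\<lambda>w. gamma M w (X w))) \<longrightarrow> riemannian M L"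
    using parallel_imp_riemannian by blast
  have "landsbergian M L \<longleftrightarrow> (\<forall>X\<in>psections M. metric_parallel_along M D0 L (hor X))"
  proof
    assume "landsbergian M L"
    then have "\<forall>X\<in>psections M. \<forall>Y\<in>psections M. \<forall>u\<in>carrier (slit M). vhv_torsion M nabla X Y u = 0"
      using assms(2) unfolding landsbergian_def by blast
    then show "\<forall>X\<in>psections M. metric_parallel_along M D0 L (hor X)" unfolding vhv_torsion_zero_iff .
  next
    assume r: "\<forall>X\<in>psections M. metric_parallel_along M D0 L (hor X)"
    show "landsbergian M L" unfolding landsbergian_def
    proof (intro allI impI)
      fix D assume "cartan_connection M L D"
      then show "\<forall>X\<in>psections M. \<forall>Y\<in>psections M. \<forall>u\<in>carrier (slit M). vhv_torsion M D X Y u = 0"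
        using cartan_berwald.vhv_torsion_zero_iff[OF cb] r by blast
    qed
  qed
  then have f: "landsbergian M L \<longleftrightarrow> (\<forall>X\<in>psections M. metric_parallel_along M D0 L (\<lambda>w. beta M nabla w (X w)))"
    using metric_parallel_along_hor_eq by blast
  show ?thesis using a b metric_parallel_along_spray d e f by blast
qed

end
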